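(* Let $k\ge 1$ and $m$ be integers with $0\le m\le k+1$. Let $\hat\Theta\subset\mathbb{R}^n$ be a rectangular reference element and let $\hat\Pi_k$ be the $k$-degree Lagrange interpolation operator over $\hat\Theta$, with $\hat\Pi_k\in\mathcal{L}(\mathcal{H}^{k+1}(\hat\Theta);\mathcal{H}^m(\hat\Theta))$ and $\hat\Pi_k\hat F=\hat F$ for each $\hat F\in P_k(\hat\Theta)$. Let $\kappa>0$. Then there is a constant $C$, independent of $\Theta$ and $F$, such that for every interpolation element $\Theta\subset\Omega=[0,1)^n$ that is affine equivalent to $\hat\Theta$ and satisfies $h_\Theta/\rho_\Theta\le\kappa$, and for the operator $\Pi_k$ over $\Theta$ defined by $$(\Pi_kF)^{\hat{}}=\hat\Pi_k\hat F,\qquad F\in\mathcal{H}^{k+1}(\Theta),$$ one has $$\|F-\Pi_kF\|_{m,\Theta}\le C\,h_\Theta^{\,k+1-m}\,|F|_{k+1,\Theta},\qquad \forall F\in\mathcal{H}^{k+1}(\Theta).$$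
   Context: Two elements $\Theta,\hat\Theta\subset\mathbb{R}^n$ are affine equivalent if there is an invertible affine transformation $\mathcal{A}:\hat\Theta\to\Theta$, $\hat{\boldsymbol{s}}\mapsto\boldsymbol{B}\hat{\boldsymbol{s}}+\boldsymbol{b}$, with $\boldsymbol{B}\in\mathbb{R}^{n\times n}$ invertible and $\boldsymbol{b}\in\mathbb{R}^n$, mapping $\hat\Theta$ onto $\Theta$. For a function $F$ on $\Theta$, $\hat F:=F\circ\mathcal{A}$ is the corresponding function on $\hat\Theta$; likewise $(\Pi_kF)^{\hat{}}:=(\Pi_kF)\circ\mathcal{A}$. $h_\Theta=\mathrm{diam}\,\Theta$ and $\rho_\Theta=\sup\{\mathrm{diam}\,\Gamma:\Gamma\subset\Theta\text{ a closed ball}\}$. The interpolation elements are of regular shape, i.e. there is a constant $\kappa>0$ with $h_\Theta/\rho_\Theta\le\kappa$. For an integer $m\ge0$, $\mathcal{H}^m(\Theta)$ is the Sobolev space of $F\in\mathcal{L}^2(\Theta)$ with $\|F\|_{m,\Theta}=\big(\sum_{|\boldsymbol\alpha|\le m}\|D^{\boldsymbol\alpha}F\|^2_{\mathcal{L}^2(\Theta)}\big)^{1/2}<\infty$, and semi-norm $|F|_{m,\Theta}=\big(\sum_{|\boldsymbol\alpha|=m}\|D^{\boldsymbol\alpha}F\|^2_{\mathcal{L}^2(\Theta)}\big)^{1/2}$, where $\boldsymbol\alpha$ is a multi-index and $|\boldsymbol\alpha|=\alpha_1+\dots+\alpha_n$. $P_k(\hat\Theta)$ is the space of polynomials of degree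 $k$ or less on $\hat\Theta$. The $k$-degree Lagrange interpolation on a rectangular element uses $(k+1)^n$ interpolation nodes $\hat{\boldsymbol\tau}_i$ with interpolation basis functions $\phi_i$: $\hat\Pi_k\hat F=\sum_i\hat F(\hat{\boldsymbol\tau}_i)\phi_i$. $\mathcal{L}(A;B)$ denotes the (bounded) linear operators from the space $A$ to the space $B$. *)

theory Defs
  imports "HOL-Analysis.Analysis"
begin

text \<open>Functions take values in a type of class \<open>{real_normed_field, euclidean_space}\<close>, so that real-valued
  and complex-valued functions are both covered. They are total functions on \<open>real^'n\<close>, of which
  only the values on the set under consideration matter. Elements of Lebesgue and
  Sobolev spaces are represented by functions; equality in these spaces is \<open>ae_eq\<close>.\<close>

definition ae_eq :: "(real^'n) set \<Rightarrow> (real^'n \<Rightarrow> 'a) \<Rightarrow> (real^'n \<Rightarrow> 'a) \<Rightarrow> bool" where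
  "ae_eq S F G \<longleftrightarrow> (AE x in lebesgue. x \<in> S \<longrightarrow> F x = G x)"


subsection \<open>Multi-indices, derivatives, test functions\<close>

type_synonym 'n multi_index = "'n \<Rightarrow> nat"

definition morder :: "('n::finite) multi_index \<Rightarrow> nat" where
  "morder \<alpha> = (\<Sum>j\<in>UNIV. \<alpha> j)"

definition partial_deriv :: "'n::finite \<Rightarrow> (real^'n \<Rightarrow> real) \<Rightarrow> real^'n \<Rightarrow> real" where
  "partial_deriv j f x = frechet_derivative f (at x) (axis j 1)"

text \<open>The order in which the partial derivatives are taken is irrelevant for smooth functions,
  and \<open>mixed_partial\<close> is only applied to those; as the index type carries no order,
  some list that contains each \<open>j\<close> exactly \<open>\<alpha> j\<close> times is chosen.\<close>

definition mixed_partial :: "('n::finite) multi_index \<Rightarrow> (real^'n \<Rightarrow> real) \<Rightarrow> real^'n \<Rightarrow> real" where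
  "mixed_partial \<alpha> f = foldr partial_deriv (SOME js. \<forall>j. count_list js j = \<alpha> j) f"

primrec C_diff :: "nat \<Rightarrow> (real^('n::finite) \<Rightarrow> real) \<Rightarrow> bool" where
  "C_diff 0 f \<longleftrightarrow> continuous_on UNIV f"
| "C_diff (Suc r) f \<longleftrightarrow> (\<forall>x. f differentiable (at x)) \<and> (\<forall>j. C_diff r (partial_deriv j f))"

definition test_functions :: "(real^('n::finite)) set \<Rightarrow> (real^'n \<Rightarrow> real) set" where
  "test_functions U =
     {\<phi>. (\<forall>r. C_diff r \<phi>) \<and> (\<exists>K. compact K \<and> K \<subseteq> U \<and> (\<forall>x. x \<notin> K \<longrightarrow> \<phi> x = 0))}"


subsection \<open>Sobolev spaces\<close>

definition locally_integrable ::
    "(real^('n::finite)) set \<Rightarrow> (real^'n \<Rightarrow> 'a::{real_normed_field, euclidean_space}) \<Rightarrow> bool" where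
  "locally_integrable U F \<longleftrightarrow> (\<forall>K. compact K \<and> K \<subseteq> U \<longrightarrow> set_integrable lebesgue K F)"

definition has_weak_deriv ::
    "(real^('n::finite)) set \<Rightarrow> 'n multi_index \<Rightarrow>
     (real^'n \<Rightarrow> 'a::{real_normed_field, euclidean_space}) \<Rightarrow> (real^'n \<Rightarrow> 'a) \<Rightarrow> bool" where
  "has_weak_deriv U \<alpha> F G \<longleftrightarrow>
     locally_integrable U F \<and> locally_integrable U G \<and>
     (\<forall>\<phi>\<in>test_functions U.
        (LINT x:U|lebesgue. mixed_partial \<alpha> \<phi> x *\<^sub>R F x) =
        (-1) ^ morder \<alpha> *\<^sub>R (LINT x:U|lebesgue. \<phi> x *\<^sub>R G x))"

text \<open>On an open set weak derivatives are unique almost everywhere, so the choice does not affect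
  the norms below.\<close>

definition weak_deriv ::
    "(real^('n::finite)) set \<Rightarrow> 'n multi_index \<Rightarrow>
     (real^'n \<Rightarrow> 'a::{real_normed_field, euclidean_space}) \<Rightarrow> real^'n \<Rightarrow> 'a" where
  "weak_deriv U \<alpha> F = (SOME G. has_weak_deriv U \<alpha> F G)"

definition L2_on ::
    "(real^('n::finite)) set \<Rightarrow> (real^'n \<Rightarrow> 'a::{real_normed_field, euclidean_space}) \<Rightarrow> bool" where
  "L2_on U F \<longleftrightarrow> set_borel_measurable lebesgue U F \<and> set_integrable lebesgue U (\<lambda>x. (norm (F x))\<^sup>2)"

definition L2_norm_on ::
    "(real^('n::finite)) set \<Rightarrow> (real^'n \<Rightarrow> 'a::{real_normed_field, euclidean_space}) \<Rightarrow> real" where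
  "L2_norm_on U F = sqrt (LINT x:U|lebesgue. (norm (F x))\<^sup>2)"

text \<open>Elements may contain all, part or none of their boundary, which is a null set. The
  Sobolev space of an element is that of its interior.\<close>

definition sobolev ::
    "nat \<Rightarrow> (real^('n::finite)) set \<Rightarrow> (real^'n \<Rightarrow> 'a::{real_normed_field, euclidean_space}) set" where
  "sobolev m S =
     {F. L2_on (interior S) F \<and>
         (\<forall>\<alpha>. morder \<alpha> \<le> m \<longrightarrow>
            (\<exists>G. has_weak_deriv (interior S) \<alpha> F G \<and> L2_on (interior S) G))}"

definition sobolev_norm ::
    "nat \<Rightarrow> (real^('n::finite)) set \<Rightarrow> (real^'n \<Rightarrow> 'a::{real_normed_field, euclidean_space}) \<Rightarrow> real" where
  "sobolev_norm m S F =
     sqrt (\<Sum>\<alpha> | morder \<alpha> \<le> m. (L2_norm_on (interior S) (weak_deriv (interior S) \<alpha> F))\<^sup>2)"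

definition sobolev_seminorm ::
    "nat \<Rightarrow> (real^('n::finite)) set \<Rightarrow> (real^'n \<Rightarrow> 'a::{real_normed_field, euclidean_space}) \<Rightarrow> real" where
  "sobolev_seminorm m S F =
     sqrt (\<Sum>\<alpha> | morder \<alpha> = m. (L2_norm_on (interior S) (weak_deriv (interior S) \<alpha> F))\<^sup>2)"

text \<open>Bounded linear operators from \<open>sobolev p S\<close> to \<open>sobolev m S\<close>; the second condition says
  that the operator acts on classes of almost everywhere equal functions.\<close>

definition sobolev_operators ::
    "nat \<Rightarrow> nat \<Rightarrow> (real^('n::finite)) set \<Rightarrow>
     ((real^'n \<Rightarrow> 'a::{real_normed_field, euclidean_space}) \<Rightarrow> real^'n \<Rightarrow> 'a) set" where
  "sobolev_operators p m S =
     {T. (\<forall>F\<in>sobolev p S. T F \<in> sobolev m S) \<and>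
         (\<forall>F\<in>sobolev p S. \<forall>G\<in>sobolev p S. ae_eq S F G \<longrightarrow> ae_eq S (T F) (T G)) \<and>
         (\<forall>F\<in>sobolev p S. \<forall>G\<in>sobolev p S.
            ae_eq S (T (\<lambda>x. F x + G x)) (\<lambda>x. T F x + T G x)) \<and>
         (\<forall>c. \<forall>F\<in>sobolev p S. ae_eq S (T (\<lambda>x. c * F x)) (\<lambda>x. c * T F x)) \<and>
         (\<exists>K. \<forall>F\<in>sobolev p S. sobolev_norm m S (T F) \<le> K * sobolev_norm p S F)}"


subsection \<open>Elements\<close>

text \<open>A nondegenerate axis-parallel box, with an arbitrary part of its boundary.\<close>

definition rectangular_element :: "(real^('n::finite)) set \<Rightarrow> bool" where
  "rectangular_element S \<longleftrightarrow> (\<exists>a b. (\<forall>j. a $ j < b $ j) \<and> box a b \<subseteq> S \<and> S \<subseteq> cbox a b)"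

definition affine_map :: "real^'n^'n \<Rightarrow> real^'n \<Rightarrow> real^'n \<Rightarrow> real^('n::finite)" where
  "affine_map B b s = B *v s + b"

definition affine_equivalent_via ::
    "real^'n^'n \<Rightarrow> real^'n \<Rightarrow> (real^('n::finite)) set \<Rightarrow> (real^'n) set \<Rightarrow> bool" where
  "affine_equivalent_via B b S' S \<longleftrightarrow> invertible B \<and> affine_map B b ` S' = S"

definition inner_diameter :: "(real^('n::finite)) set \<Rightarrow> real" where
  "inner_diameter S = (SUP (c, r)\<in>{(c, r). 0 < r \<and> cball c r \<subseteq> S}. diameter (cball c r))"

definition unit_cell :: "(real^('n::finite)) set" where
  "unit_cell = {x. \<forall>j. 0 \<le> x $ j \<and> x $ j < 1}"


subsection \<open>Polynomials and Lagrange interpolation\<close>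

definition poly_space ::
    "nat \<Rightarrow> (real^('n::finite)) set \<Rightarrow> (real^'n \<Rightarrow> 'a::{real_normed_field, euclidean_space}) set" where
  "poly_space k S =
     {p. \<exists>c. \<forall>x\<in>S. p x = (\<Sum>\<alpha> | morder \<alpha> \<le> k. (\<Prod>j\<in>UNIV. (x $ j) ^ \<alpha> j) *\<^sub>R c \<alpha>)}"

text \<open>A tensor-product grid is given by the coordinates \<open>t j 0, \<dots>, t j k\<close> in each direction \<open>j\<close>; its
  \<open>(k+1) ^ CARD('n)\<close> nodes are indexed by the functions \<open>\<nu>\<close> with \<open>\<nu> j \<le> k\<close> for all \<open>j\<close>.\<close>

definition grid_node :: "('n \<Rightarrow> nat \<Rightarrow> real) \<Rightarrow> ('n \<Rightarrow> nat) \<Rightarrow> real^('n::finite)" where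
  "grid_node t \<nu> = (\<chi> j. t j (\<nu> j))"

definition lagrange_grid :: "nat \<Rightarrow> (real^('n::finite)) set \<Rightarrow> ('n \<Rightarrow> nat \<Rightarrow> real) \<Rightarrow> bool" where
  "lagrange_grid k S t \<longleftrightarrow>
     (\<forall>j. inj_on (t j) {..k}) \<and> (\<forall>\<nu>. (\<forall>j. \<nu> j \<le> k) \<longrightarrow> grid_node t \<nu> \<in> closure S)"

definition lagrange_basis ::
    "nat \<Rightarrow> ('n \<Rightarrow> nat \<Rightarrow> real) \<Rightarrow> ('n \<Rightarrow> nat) \<Rightarrow> real^('n::finite) \<Rightarrow> real" where
  "lagrange_basis k t \<nu> x =
     (\<Prod>j\<in>UNIV. \<Prod>l\<in>{..k} - {\<nu> j}. (x $ j - t j l) / (t j (\<nu> j) - t j l))"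

text \<open>The nodal values of an element of a Sobolev space are those of its representative that is
  continuous up to the boundary. On a box this representative is unique on the closure if it
  exists. For functions without such a representative the value of the operator is
  meaningless.\<close>

definition continuous_representative ::
    "(real^('n::finite)) set \<Rightarrow> (real^'n \<Rightarrow> 'a::{real_normed_field, euclidean_space}) \<Rightarrow> real^'n \<Rightarrow> 'a" where
  "continuous_representative S F = (SOME G. continuous_on (closure S) G \<and> ae_eq S F G)"

definition lagrange_interpolation ::
    "nat \<Rightarrow> (real^('n::finite)) set \<Rightarrow> ('n \<Rightarrow> nat \<Rightarrow> real) \<Rightarrow>
     (real^'n \<Rightarrow> 'a::{real_normed_field, euclidean_space}) \<Rightarrow> real^'n \<Rightarrow> 'a" where
  "lagrange_interpolation k S t F x =
     (\<Sum>\<nu> | \<forall>j. \<nu> j \<le> k. lagrange_basis k t \<nu> x *\<^sub>R continuous_representative S F (grid_node t \<nu>))"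

end

theory Submission
  imports Defs "HOL-Computational_Algebra.Polynomial"
begin

text \<open>On the reference box the estimate is the Bramble--Hilbert lemma: subtract from \<open>v\<close> a polynomial
  \<open>p\<close> of degree at most \<open>k\<close> with \<open>\<integral> \<eta> D\<^sup>\<alpha>(v - p) = 0\<close> for all \<open>|\<alpha>| \<le> k\<close>, where \<open>\<eta>\<close> is a fixed bump, iterate the
  Poincare inequality, and use that the interpolation operator reproduces \<open>p\<close>. The Poincare
  inequality for weak derivatives is proved by duality: a test function \<open>\<psi>\<close> differs from a multiple
  of \<open>\<eta>\<close> by a divergence \<open>\<Sum>\<^sub>j \<partial>\<^sub>j \<Phi>\<^sub>j\<close> whose potentials are bounded by \<open>\<psi>\<close> in \<open>L\<^sup>2\<close>; they are found by
  averaging in one coordinate after the other. Pulling back to an element of diameter \<open>h\<close> costs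
  \<open>h\<^sup>k\<^sup>+\<^sup>1\<close> for the seminorm of \<open>F\<close> and \<open>h\<^sup>-\<^sup>m\<close> for the norm of the error, since shape regularity bounds the
  entries of the inverse matrix by a multiple of \<open>1/h\<close>; the volume factors cancel.\<close>

subsection \<open>Differentiation of smooth functions\<close>

text \<open>Weak derivatives are known only through their pairings with test functions, so all
  calculus is moved onto the test functions, where the classical rules hold: the Poincare inequality
  becomes a decomposition of test functions, and the chain rule for an affine map is applied to the
  transported test function. The means are weighted by a compactly supported bump instead of being
  plain averages because the bump is itself a test function: its integral against a derivative of
  \<open>v\<close> is, up to sign, an integral of \<open>v\<close> against a derivative of the bump,
  and so depends on \<open>v\<close> and the multi-index only. Derivatives are indexed by words of
  directions rather than by multi-indices: a word grows by one letter at a time, as the iteration of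
  the Poincare inequality requires, and the chain rule over words has no multinomial coefficients.
  The left side of the estimate is a full norm, so orders below \<open>m\<close> produce smaller
  powers of 1/h; they are absorbed into the m-th power because an element inside the unit cell has
  bounded diameter.\<close>

lemma C_diff_differentiable: "C_diff (Suc r) f \<Longrightarrow> f differentiable (at x)"
  by simp

lemma C_diff_continuous: "C_diff r f \<Longrightarrow> continuous_on UNIV f"
  by (cases r) (auto intro!: continuous_at_imp_continuous_on differentiable_imp_continuous_within)

lemma C_diff_Suc_imp: "C_diff (Suc r) f \<Longrightarrow> C_diff r f"
proof (induction r arbitrary: f)
  case 0 then show ?case using C_diff_continuous[of "Suc 0" f] by simp
next
  case (Suc r) then show ?case by (metis C_diff.simps(2))
qed

lemma partial_deriv_eqI: "(f has_derivative f') (at x) \<Longrightarrow> partial_deriv j f x = f' (axis j 1)"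
  unfolding partial_deriv_def using frechet_derivative_at by metis

lemma has_derivative_partial_deriv:
  fixes f :: "real^'n::finite \<Rightarrow> real"
  assumes "f differentiable (at x)"
  shows "(f has_derivative (\<lambda>h. \<Sum>j\<in>UNIV. h $ j * partial_deriv j f x)) (at x)"
proof -
  let ?D = "frechet_derivative f (at x)"
  have D: "(f has_derivative ?D) (at x)"
    using assms frechet_derivative_works by blast
  then have lin: "linear ?D" by (rule has_derivative_linear)
  have "?D h = (\<Sum>j\<in>UNIV. h $ j * partial_deriv j f x)" for h
  proof -
    have "?D h = ?D (\<Sum>j\<in>UNIV. h $ j *s axis j 1)" by (simp add: basis_expansion)
    also have "\<dots> = (\<Sum>j\<in>UNIV. h $ j * ?D (axis j 1))"
      by (simp add: linear_sum[OF lin] scalar_mult_eq_scaleR linear_scale[OF lin])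
    finally show ?thesis by (simp add: partial_deriv_def)
  qed
  then have "?D = (\<lambda>h. \<Sum>j\<in>UNIV. h $ j * partial_deriv j f x)" by auto
  with D show ?thesis by simp
qed

lemma partial_deriv_add:
  fixes f g :: "real^'n::finite \<Rightarrow> real"
  shows
  "f differentiable (at x) \<Longrightarrow> g differentiable (at x) \<Longrightarrow>
   partial_deriv j (\<lambda>x. f x + g x) x = partial_deriv j f x + partial_deriv j g x"
  using partial_deriv_eqI[OF has_derivative_add[of f "frechet_derivative f (at x)" "at x" g "frechet_derivative g (at x)"], of j]
  by (simp add: frechet_derivative_works[symmetric]) (simp add: partial_deriv_def)

lemma partial_deriv_mult:
  fixes f g :: "real^'n::finite \<Rightarrow> real"
  shows "f differentiable (at x) \<Longrightarrow> g differentiable (at x) \<Longrightarrow>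
   partial_deriv j (\<lambda>x. f x * g x) x = f x * partial_deriv j g x + partial_deriv j f x * g x"
  using partial_deriv_eqI[OF has_derivative_mult[of f "frechet_derivative f (at x)" x UNIV g "frechet_derivative g (at x)"], of j]
  by (simp add: frechet_derivative_works[symmetric]) (simp add: partial_deriv_def)

lemma partial_deriv_const [simp]: "partial_deriv j (\<lambda>x. c) = (\<lambda>x. 0)"
  by (auto simp: fun_eq_iff intro!: partial_deriv_eqI[THEN trans])

lemma partial_deriv_cmult:
  fixes f :: "real^'n::finite \<Rightarrow> real"
  shows "f differentiable (at x) \<Longrightarrow> partial_deriv j (\<lambda>x. c * f x) x = c * partial_deriv j f x"
  using partial_deriv_mult[of "\<lambda>x. c" x f j] by simp

lemma partial_deriv_sum:
  fixes f :: "'i \<Rightarrow> real^'n::finite \<Rightarrow> real"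
  assumes "finite I" "\<And>i. i \<in> I \<Longrightarrow> f i differentiable (at x)"
  shows "partial_deriv j (\<lambda>x. \<Sum>i\<in>I. f i x) x = (\<Sum>i\<in>I. partial_deriv j (f i) x)"
  using assms by (induction I) (auto simp: partial_deriv_add)

lemma C_diff_const [simp]: "C_diff r (\<lambda>x. c)"
  by (induction r arbitrary: c) auto

lemma C_diff_add: "C_diff r f \<Longrightarrow> C_diff r g \<Longrightarrow> C_diff r (\<lambda>x. f x + g x)"
proof (induction r arbitrary: f g)
  case 0 then show ?case by (auto intro: continuous_intros)
next
  case (Suc r)
  then have "partial_deriv j (\<lambda>x. f x + g x) = (\<lambda>x. partial_deriv j f x + partial_deriv j g x)" for j
    by (auto simp: partial_deriv_add)
  with Suc show ?case by auto
qed

lemma C_diff_mult: "C_diff r f \<Longrightarrow> C_diff r g \<Longrightarrow> C_diff r (\<lambda>x. f x * g x)"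
proof (induction r arbitrary: f g)
  case 0 then show ?case by (auto intro: continuous_intros)
next
  case (Suc r)
  then have "partial_deriv j (\<lambda>x. f x * g x) = (\<lambda>x. f x * partial_deriv j g x + partial_deriv j f x * g x)" for j
    by (auto simp: partial_deriv_mult)
  moreover have "C_diff r f" "C_diff r g" using Suc.prems C_diff_Suc_imp by auto
  ultimately show ?case using Suc by (auto intro!: C_diff_add)
qed

section \<open>Infinitely differentiable functions\<close>

definition smooth :: "(real^('n::finite) \<Rightarrow> real) \<Rightarrow> bool" where
  "smooth f \<longleftrightarrow> (\<forall>r. C_diff r f)"

lemma smooth_const [simp]: "smooth (\<lambda>x. c)"
  by (simp add: smooth_def)

lemma smooth_add: "smooth f \<Longrightarrow> smooth g \<Longrightarrow> smooth (\<lambda>x. f x + g x)"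
  by (auto simp: smooth_def C_diff_add)

lemma smooth_mult: "smooth f \<Longrightarrow> smooth g \<Longrightarrow> smooth (\<lambda>x. f x * g x)"
  by (auto simp: smooth_def C_diff_mult)

lemma smooth_prod: "(\<And>i. i \<in> I \<Longrightarrow> smooth (f i)) \<Longrightarrow> smooth (\<lambda>x. \<Prod>i\<in>I. f i x)"
  by (induction I rule: infinite_finite_induct) (auto intro: smooth_mult)

lemma smooth_power: "smooth f \<Longrightarrow> smooth (\<lambda>x. f x ^ n)"
  by (induction n) (auto intro: smooth_mult)

lemma smooth_partial_deriv: "smooth f \<Longrightarrow> smooth (partial_deriv j f)"
  unfolding smooth_def using C_diff.simps(2) by blast

lemma smooth_differentiable: "smooth f \<Longrightarrow> f differentiable (at x)"
  unfolding smooth_def using C_diff.simps(2) by blast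

lemma smooth_continuous: "smooth f \<Longrightarrow> continuous_on S f"
  unfolding smooth_def using C_diff_continuous continuous_on_subset by blast

text \<open>The recursion of \<open>C_diff\<close> only descends to partial derivatives, so one
  check of closure replaces an induction on the order. Used for families whose derivatives are again
  members: iterated one-variable derivatives and line integrals of test functions.\<close>

lemma smooth_coinduct:
  assumes "P f"
    and "\<And>f x. P f \<Longrightarrow> f differentiable (at x)"
    and "\<And>f j. P f \<Longrightarrow> P (partial_deriv j f)"
  shows "smooth f"
proof -
  have "C_diff r f" if "P f" for r f
    using that
  proof (induction r arbitrary: f)
    case 0 then show ?case
      using assms(2) by (auto intro!: continuous_at_imp_continuous_on differentiable_imp_continuous_within)
  next
    case (Suc r) then show ?case using assms by auto
  qed
  then show ?thesis using assms(1) by (simp add: smooth_def)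
qed

lemma partial_deriv_linear:
  fixes f :: "real^'n::finite \<Rightarrow> real"
  assumes "bounded_linear f"
  shows "partial_deriv j f = (\<lambda>x. f (axis j 1))"
  by (auto intro!: partial_deriv_eqI bounded_linear_imp_has_derivative assms)

lemma smooth_linear:
  fixes f :: "real^'n::finite \<Rightarrow> real"
  assumes "bounded_linear f" shows "smooth f"
proof -
  have "C_diff r f" for r
    using assms by (cases r) (auto simp: partial_deriv_linear linear_continuous_on bounded_linear_imp_differentiable)
  then show ?thesis by (simp add: smooth_def)
qed

lemma smooth_real_polynomial_function:
  fixes f :: "real^'n::finite \<Rightarrow> real"
  shows "real_polynomial_function f \<Longrightarrow> smooth f"
  by (induction rule: real_polynomial_function.induct)
     (auto intro: smooth_linear smooth_add smooth_mult)

lemma smooth_compose_coord: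
  fixes D :: "nat \<Rightarrow> real \<Rightarrow> real" and i :: "'n::finite"
  assumes D: "\<And>n y. (D n has_real_derivative D (Suc n) y) (at y)"
  shows "smooth (\<lambda>x::real^'n. D 0 (x $ i))"
\<comment> \<open>The scalar \<open>c\<close> absorbs the factor \<open>axis j 1 $ i\<close>, which
  is 1 for \<open>j = i\<close> and 0 otherwise, so derivatives in the other directions stay in the
  class.\<close>
proof (rule smooth_coinduct[where P = "\<lambda>f. \<exists>n c. f = (\<lambda>x. c * D n (x $ i))"])
  have der: "((\<lambda>x::real^'n. c * D n (x $ i)) has_derivative (\<lambda>h. c * (D (Suc n) (x $ i) * h $ i))) (at x)"
    for n c and x :: "real^'n"
  proof -
    have "((\<lambda>x::real^'n. D n (x $ i)) has_derivative (\<lambda>h. D (Suc n) (x $ i) * h $ i)) (at x)"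
      using has_derivative_compose[OF bounded_linear_imp_has_derivative[OF bounded_linear_vec_nth[of i]]
          D[of n "x $ i", unfolded has_field_derivative_def]] by simp
    then show ?thesis by (rule has_derivative_mult_right)
  qed
  show "\<exists>n c. (\<lambda>x::real^'n. D 0 (x $ i)) = (\<lambda>x. c * D n (x $ i))"
    by (rule exI[of _ 0], rule exI[of _ 1]) simp
  show "f differentiable at x" if "\<exists>n c. f = (\<lambda>x. c * D n (x $ i))" for f :: "real^'n \<Rightarrow> real" and x
    using that der differentiable_def by blast
  show "\<exists>n c. partial_deriv j f = (\<lambda>x. c * D n (x $ i))" if hf: "\<exists>n c. f = (\<lambda>x. c * D n (x $ i))"
    for f :: "real^'n \<Rightarrow> real" and j
  proof -
    obtain n c where f: "f = (\<lambda>x. c * D n (x $ i))" using hf by blast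
    have "partial_deriv j f x = (c * axis j 1 $ i) * D (Suc n) (x $ i)" for x
      unfolding f partial_deriv_eqI[OF der] by (simp add: mult_ac)
    then show ?thesis by blast
  qed
qed

section \<open>Composition with affine maps\<close>

lemma has_derivative_affine_map: "(affine_map B b has_derivative (\<lambda>h. B *v h)) (at x)"
proof -
  have "((\<lambda>s. B *v s + b) has_derivative (\<lambda>h. B *v h + 0)) (at x)"
    by (intro has_derivative_add has_derivative_const bounded_linear_imp_has_derivative matrix_vector_mul_bounded_linear)
  then show ?thesis by (simp add: affine_map_def[abs_def])
qed

lemma affine_comp_derivative:
  fixes f :: "real^'n::finite \<Rightarrow> real"
  assumes "\<And>x. f differentiable (at x)"
  shows "(f \<circ> affine_map B b) differentiable (at x)"
    and "partial_deriv j (f \<circ> affine_map B b) = (\<lambda>x. \<Sum>i\<in>UNIV. B $ i $ j * (partial_deriv i f \<circ> affine_map B b) x)"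
proof -
  have d: "((f \<circ> affine_map B b) has_derivative
     (\<lambda>h. \<Sum>i\<in>UNIV. (B *v h) $ i * partial_deriv i f (affine_map B b x))) (at x)" for x
    using diff_chain_at[OF has_derivative_affine_map has_derivative_partial_deriv[OF assms]]
    by (simp add: o_def)
  show "(f \<circ> affine_map B b) differentiable (at x)" using d differentiable_def by blast
  show "partial_deriv j (f \<circ> affine_map B b) = (\<lambda>x. \<Sum>i\<in>UNIV. B $ i $ j * (partial_deriv i f \<circ> affine_map B b) x)"
    by (rule ext, subst partial_deriv_eqI[OF d]) (simp add: matrix_vector_mul_component inner_axis)
qed

text \<open>The partial derivatives of the composite are linear combinations of composites of the
  same form, with a partial derivative of \<open>f\<close> in place of \<open>f\<close>; hence the
  generalisation over \<open>f\<close>.\<close>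

lemma C_diff_affine:
  "C_diff r f \<Longrightarrow> C_diff r (f \<circ> affine_map B b)"
proof (induction r arbitrary: f)
  case 0
  have "continuous_on UNIV (affine_map B b)"
    by (meson continuous_at_imp_continuous_on has_derivative_affine_map has_derivative_continuous)
  with 0 show ?case using continuous_on_compose2 by (fastforce simp: o_def)
next
  case (Suc r)
  have sm: "C_diff r (\<lambda>x. \<Sum>i\<in>I. g i x)" if "\<And>i. C_diff r (g i)" for I :: "'b set" and g
    using that by (induction I rule: infinite_finite_induct) (auto intro: C_diff_add)
  have "C_diff r (partial_deriv j (f \<circ> affine_map B b))" for j
    using Suc unfolding affine_comp_derivative(2)[OF C_diff_differentiable[OF Suc.prems]]
    by (intro sm C_diff_mult) auto
  with Suc.prems show ?case by (simp only: C_diff.simps) (auto simp del: o_apply intro!: affine_comp_derivative(1))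
qed

lemma smooth_affine: "smooth f \<Longrightarrow> smooth (f \<circ> affine_map B b)"
  by (simp add: smooth_def C_diff_affine)

section \<open>Integrals along segments and symmetry of second derivatives\<close>

lemma continuous_on_line:
  fixes g :: "real^'n::finite \<Rightarrow> real"
  assumes "smooth g"
  shows "continuous_on S (\<lambda>s. g (x + s *\<^sub>R v))"
  by (rule continuous_on_compose2[OF smooth_continuous[OF assms, of UNIV]])
     (auto intro!: continuous_intros)

lemma
  fixes g :: "real^'n::finite \<Rightarrow> real"
  assumes g: "smooth g"
  shows differentiable_line_integral:
      "(\<lambda>x. integral {c..d} (\<lambda>s. g (x + s *\<^sub>R v))) differentiable (at x)" (is ?d)
    and partial_deriv_line_integral:
      "partial_deriv j (\<lambda>x. integral {c..d} (\<lambda>s. g (x + s *\<^sub>R v))) x =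
       integral {c..d} (\<lambda>s. partial_deriv j g (x + s *\<^sub>R v))" (is ?p)
proof -
  \<comment> \<open>The gradient. Pairing with it presents the derivative as a bounded linear map
    that depends continuously on the point, the form in which \<open>leibniz_rule\<close>
    differentiates under the integral.\<close>
  define G where "G y = (\<chi> j. partial_deriv j g y)" for y
  have contG: "continuous_on UNIV G"
    unfolding G_def by (intro continuous_intros smooth_continuous smooth_partial_deriv g)
  have dg: "(g has_derivative (\<lambda>h. h \<bullet> G y)) (at y)" for y
    using has_derivative_partial_deriv[OF smooth_differentiable[OF g], of y]
    by (simp add: G_def inner_vec_def)
  have "((\<lambda>x. integral (cbox c d) (\<lambda>s. g (x + s *\<^sub>R v))) has_derivative
      integral (cbox c d) (\<lambda>s. blinfun_inner_left (G (x + s *\<^sub>R v)))) (at x within UNIV)"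
  proof (rule leibniz_rule)
    show "((\<lambda>x. g (x + s *\<^sub>R v)) has_derivative blinfun_apply (blinfun_inner_left (G (x + s *\<^sub>R v)))) (at x within UNIV)"
      for x s
    proof -
      have "((\<lambda>x. x + s *\<^sub>R v) has_derivative (\<lambda>h. h)) (at x)"
        by (auto intro!: derivative_eq_intros)
      from has_derivative_compose[OF this dg] show ?thesis by (simp add: blinfun_inner_left.rep_eq)
    qed
    show "(\<lambda>s. g (x + s *\<^sub>R v)) integrable_on cbox c d" for x
      by (intro integrable_continuous continuous_on_line g)
    have "continuous_on (UNIV \<times> cbox c d) (\<lambda>z. G (fst z + snd z *\<^sub>R v))"
      by (rule continuous_on_compose2[OF contG]) (auto intro!: continuous_intros)
    then show "continuous_on (UNIV \<times> cbox c d) (\<lambda>(x, s). blinfun_inner_left (G (x + s *\<^sub>R v)))"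
      by (auto simp: split_beta intro!: continuous_intros)
  qed auto
  then have d: "((\<lambda>x. integral {c..d} (\<lambda>s. g (x + s *\<^sub>R v))) has_derivative
      integral {c..d} (\<lambda>s. blinfun_inner_left (G (x + s *\<^sub>R v)))) (at x)" by simp
  then show ?d using differentiable_def by blast
  have "continuous_on {c..d} (\<lambda>s. blinfun_inner_left (G (x + s *\<^sub>R v)))"
    by (intro continuous_intros continuous_on_compose2[OF contG]) auto
  then have "(\<lambda>s. blinfun_inner_left (G (x + s *\<^sub>R v))) integrable_on {c..d}"
    by (rule integrable_continuous_real)
  then show ?p unfolding partial_deriv_eqI[OF d]
    by (subst blinfun_apply_integral) (auto simp: G_def inner_axis' inner_commute)
qed

lemma has_vector_derivative_line:
  fixes g :: "real^'n::finite \<Rightarrow> real"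
  assumes g: "smooth g"
  shows "((\<lambda>s. g (x + s *\<^sub>R axis i 1)) has_vector_derivative partial_deriv i g (x + s *\<^sub>R axis i 1)) (at s within S)"
proof -
  have "((\<lambda>s. x + s *\<^sub>R axis i 1) has_derivative (\<lambda>h. h *\<^sub>R axis i 1)) (at s)"
    by (auto intro!: derivative_eq_intros)
  from has_derivative_compose[OF this has_derivative_partial_deriv[OF smooth_differentiable[OF g]]]
  have "((\<lambda>s. g (x + s *\<^sub>R axis i 1)) has_derivative
      (\<lambda>h. \<Sum>j\<in>UNIV. (h *\<^sub>R axis i 1) $ j * partial_deriv j g (x + s *\<^sub>R axis i 1))) (at s)" .
  also have "(\<lambda>h. \<Sum>j\<in>UNIV. (h *\<^sub>R axis i 1) $ j * partial_deriv j g (x + s *\<^sub>R axis i 1)) =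
      (\<lambda>h. h *\<^sub>R partial_deriv i g (x + s *\<^sub>R axis i 1))"
    by (auto simp: axis_def if_distrib if_distribR sum.delta cong: if_cong)
  finally show ?thesis
    unfolding has_vector_derivative_def using has_derivative_at_withinI by blast
qed

lemma line_integral_partial_deriv:
  fixes g :: "real^'n::finite \<Rightarrow> real"
  assumes g: "smooth g" and "c \<le> d"
  shows "integral {c..d} (\<lambda>s. partial_deriv i g (x + s *\<^sub>R axis i 1)) =
    g (x + d *\<^sub>R axis i 1) - g (x + c *\<^sub>R axis i 1)"
  by (rule integral_unique[OF fundamental_theorem_of_calculus[OF assms(2) has_vector_derivative_line[OF g]]])

text \<open>Differentiate \<open>g (x + t e\<^sub>j) - g x = \<integral> \<partial>\<^sub>j g\<close> first in \<open>x\<^sub>i\<close>, then in \<open>t\<close>.\<close>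

lemma partial_deriv_commute:
  fixes g :: "real^'n::finite \<Rightarrow> real"
  assumes g: "smooth g"
  shows "partial_deriv i (partial_deriv j g) = partial_deriv j (partial_deriv i g)"
proof
  fix x :: "real^'n"
  let ?e = "axis j 1 :: real^'n"
  let ?l = "\<lambda>s. partial_deriv i (partial_deriv j g) (x + s *\<^sub>R ?e)"
  have eq: "partial_deriv i g (x + t *\<^sub>R ?e) - partial_deriv i g x = integral {0..t} ?l" if "0 \<le> t" for t
  proof -
    have "integral {0..t} ?l = partial_deriv i (\<lambda>x. integral {0..t} (\<lambda>s. partial_deriv j g (x + s *\<^sub>R ?e))) x"
      by (simp add: partial_deriv_line_integral smooth_partial_deriv g)
    also have "\<dots> = partial_deriv i (\<lambda>x. g (x + t *\<^sub>R ?e) - g x) x"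
      using line_integral_partial_deriv[OF g that] by simp
    also have "\<dots> = partial_deriv i g (x + t *\<^sub>R ?e) - partial_deriv i g x"
    proof -
      have "((\<lambda>x. x + t *\<^sub>R ?e) has_derivative (\<lambda>h. h)) (at x)"
        by (auto intro!: derivative_eq_intros)
      note A = has_derivative_compose[OF this has_derivative_partial_deriv[OF smooth_differentiable[OF g]]]
      show ?thesis
        unfolding partial_deriv_eqI[OF has_derivative_diff[OF A has_derivative_partial_deriv[OF smooth_differentiable[OF g]]]]
        by (simp add: axis_def if_distrib if_distribR sum.delta cong: if_cong)
    qed
    finally show ?thesis by simp
  qed
  \<comment> \<open>Since \<open>eq\<close> speaks of \<open>0 \<le> t\<close> only, both
    derivatives are taken at 0 within \<open>{0..1}\<close>, where they are still unique.\<close>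
  have "((\<lambda>t. integral {0..t} ?l) has_vector_derivative ?l 0) (at 0 within {0..1})"
    by (rule integral_has_vector_derivative) (auto intro!: continuous_on_line smooth_partial_deriv g)
  then have "((\<lambda>t. partial_deriv i g (x + t *\<^sub>R ?e) - partial_deriv i g x) has_vector_derivative ?l 0) (at 0 within {0..1})"
    by (rule has_vector_derivative_transform[rotated 2]) (auto simp: eq)
  moreover have "((\<lambda>t. partial_deriv i g (x + t *\<^sub>R ?e) - partial_deriv i g x) has_vector_derivative
      partial_deriv j (partial_deriv i g) (x + 0 *\<^sub>R ?e) - 0) (at 0 within {0..1})"
    by (intro has_vector_derivative_diff has_vector_derivative_line smooth_partial_deriv g has_vector_derivative_const)
  ultimately show "partial_deriv i (partial_deriv j g) x = partial_deriv j (partial_deriv i g) x"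
    using vector_derivative_unique_within[of 0 "{0..1::real}"] by (force simp: trivial_limit_within)
qed

subsection \<open>Iterated derivatives\<close>

text \<open>Words of directions stand in for multi-indices; \<open>count_list\<close> maps a word to
  its multi-index.\<close>

abbreviation partial_derivs :: "'n::finite list \<Rightarrow> (real^'n \<Rightarrow> real) \<Rightarrow> real^'n \<Rightarrow> real" where
  "partial_derivs js f \<equiv> foldr partial_deriv js f"

lemma smooth_partial_derivs: "smooth f \<Longrightarrow> smooth (partial_derivs js f)"
  by (induction js) (auto intro: smooth_partial_deriv)

lemma partial_derivs_commute1:
  "smooth f \<Longrightarrow> partial_derivs js (partial_deriv i f) = partial_deriv i (partial_derivs js f)"
  by (induction js) (simp_all add: partial_deriv_commute smooth_partial_derivs)

text \<open>A single derivative commutes past an iterated one, so the head of the first word can be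
  moved to its place in the second.\<close>

lemma partial_derivs_perm:
  "smooth f \<Longrightarrow> mset js = mset is \<Longrightarrow> partial_derivs js f = partial_derivs is f"
proof (induction js arbitrary: "is")
  case (Cons j js)
  then obtain xs ys where xy: "is = xs @ j # ys"
    by (metis list.set_intros(1) mset_eq_setD split_list)
  have "partial_derivs js f = partial_derivs (xs @ ys) f"
    using Cons.prems by (intro Cons.IH) (simp_all add: xy)
  moreover have "partial_derivs xs (partial_deriv j (partial_derivs ys f)) = partial_deriv j (partial_derivs xs (partial_derivs ys f))"
    by (intro partial_derivs_commute1 smooth_partial_derivs Cons.prems)
  ultimately show ?case by (simp add: xy)
qed simp

lemma ex_list_count: "\<exists>js. \<forall>j::'n::finite. count_list js j = \<alpha> j"
proof -
  obtain xs :: "'n list" where xs: "set xs = UNIV" "distinct xs" using finite_distinct_list[OF finite] by blast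
  have "count_list (concat (map (\<lambda>j. replicate (\<alpha> j) j) ys)) i = (if i \<in> set ys then \<alpha> i else 0)"
    if "distinct ys" for ys i
    using that
  proof (induction ys)
    case (Cons y ys)
    moreover have "count_list (replicate n y) i = (if i = y then n else 0)" for n by (induction n) auto
    ultimately show ?case by auto
  qed simp
  then show ?thesis using xs by force
qed

text \<open>The word picked by \<open>SOME\<close> in \<open>mixed_partial\<close> is a permutation
  of \<open>js\<close>, so the choice is immaterial for smooth functions.\<close>

lemma mixed_partial_count_list:
  assumes "smooth f" shows "mixed_partial (count_list js) f = partial_derivs js f"
  unfolding mixed_partial_def
proof (rule partial_derivs_perm[OF assms])
  have "\<forall>j. count_list (SOME is. \<forall>j. count_list is j = count_list js j) j = count_list js j"
    by (rule someI[of _ js]) simp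
  then show "mset (SOME is. \<forall>j. count_list is j = count_list js j) = mset js"
    unfolding multiset_eq_iff count_mset .
qed

lemma morder_count_list: "morder (count_list js) = length js"
  unfolding morder_def using sum_count_set[of js UNIV] by simp

lemma ex_list_multi_index:
  obtains js :: "'n::finite list" where "\<alpha> = count_list js" "length js = morder \<alpha>"
proof -
  obtain js where "\<forall>j. count_list js j = \<alpha> j" using ex_list_count by blast
  then have "\<alpha> = count_list js" by auto
  then show thesis using that morder_count_list by metis
qed

lemma finite_multi_index: "finite {\<alpha>::'n::finite multi_index. morder \<alpha> \<le> k}"
proof -
  have "{\<alpha>::'n multi_index. morder \<alpha> \<le> k} \<subseteq> count_list ` {js. set js \<subseteq> UNIV \<and> length js \<le> k}"
  proof
    fix \<alpha> :: "'n multi_index" assume \<alpha>: "\<alpha> \<in> {\<alpha>. morder \<alpha> \<le> k}"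
    obtain js where "\<alpha> = count_list js" "length js = morder \<alpha>" by (rule ex_list_multi_index)
    with \<alpha> show "\<alpha> \<in> count_list ` {js. set js \<subseteq> UNIV \<and> length js \<le> k}" by auto
  qed
  then show ?thesis by (rule finite_subset) (intro finite_imageI finite_lists_length_le finite)
qed

lemma finite_multi_index_eq: "finite {\<alpha>::'n::finite multi_index. morder \<alpha> = k}"
  by (rule finite_subset[OF _ finite_multi_index[of k]]) auto

lemma finite_lists_length: "finite {js::'n::finite list. length js = n}"
  using finite_lists_length_eq[of "UNIV::'n set" n] by simp

lemma sum_lists_Suc:
  "(\<Sum>is | length is = Suc n. f is) = (\<Sum>i\<in>UNIV. \<Sum>is | length is = n. f (i # is))"
  for f :: "'n::finite list \<Rightarrow> 'b::comm_monoid_add"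
proof -
  have "{is::'n list. length is = Suc n} = (\<lambda>(i, is). i # is) ` (UNIV \<times> {is. length is = n})"
    by (auto simp: image_iff length_Suc_conv)
  then show ?thesis
    by (simp add: sum.cartesian_product sum.reindex inj_on_def split_beta)
qed

text \<open>An entry of the tensor power of \<open>B\<close>, with row and column indexed by words
  of equal length.\<close>

definition matrix_coeff :: "real^'n^'n \<Rightarrow> 'n list \<Rightarrow> 'n list \<Rightarrow> real" where
  "matrix_coeff B is js = prod_list (map2 (\<lambda>i j. B $ i $ j) is js)"

text \<open>Because the sum runs over all words, each induction step is one plain chain rule: the
  outermost derivative contributes one more factor \<open>B $ i $ j\<close> and one more letter
  \<open>i\<close>.\<close>

lemma partial_derivs_affine:
  fixes f :: "real^'n::finite \<Rightarrow> real"
  assumes "smooth f"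
  shows "partial_derivs js (f \<circ> affine_map B b) x =
    (\<Sum>is | length is = length js. matrix_coeff B is js * partial_derivs is f (affine_map B b x))"
  using assms
proof (induction js arbitrary: f x)
  case Nil then show ?case by (simp add: matrix_coeff_def)
next
  case (Cons j js)
  have "partial_derivs (j # js) (f \<circ> affine_map B b) x =
      partial_deriv j (\<lambda>x. \<Sum>is | length is = length js. matrix_coeff B is js * (partial_derivs is f \<circ> affine_map B b) x) x"
  proof -
    have "partial_derivs js (f \<circ> affine_map B b) =
        (\<lambda>x. \<Sum>is | length is = length js. matrix_coeff B is js * (partial_derivs is f \<circ> affine_map B b) x)"
      by (rule ext, subst Cons.IH[OF Cons.prems]) simp
    then show ?thesis by (simp only: foldr.simps o_apply)
  qed
  also have "\<dots> = (\<Sum>is | length is = length js. matrix_coeff B is js * partial_deriv j (partial_derivs is f \<circ> affine_map B b) x)"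
    by (subst partial_deriv_sum)
       (auto simp: finite_lists_length partial_deriv_cmult smooth_affine smooth_partial_derivs Cons.prems
         smooth_differentiable simp del: o_apply intro!: smooth_differentiable smooth_mult)
  also have "\<dots> = (\<Sum>is | length is = length js. \<Sum>i\<in>UNIV. matrix_coeff B is js * (B $ i $ j * partial_derivs (i # is) f (affine_map B b x)))"
    by (simp add: affine_comp_derivative(2) smooth_differentiable smooth_partial_derivs Cons.prems sum_distrib_left)
  also have "\<dots> = (\<Sum>is | length is = length (j # js). matrix_coeff B is (j # js) * partial_derivs is f (affine_map B b x))"
    by (subst sum.swap) (simp add: sum_lists_Suc matrix_coeff_def mult_ac)
  finally show ?case .
qed

subsection \<open>A smooth bump\<close>

text \<open>The classical \<open>exp (- (1 / x))\<close>, extended by 0. The polynomial factor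
  closes the family under differentiation: with y = 1/x, the derivative of p(y) exp(-y) in x is y^2
  (p - p')(y) exp(-y).\<close>

definition flat :: "real poly \<Rightarrow> real \<Rightarrow> real" where
  "flat p x = (if 0 < x then poly p (1 / x) * exp (- (1 / x)) else 0)"

lemma poly_over_exp_tendsto_0: "((\<lambda>x. poly p x / exp x) \<longlongrightarrow> (0::real)) at_top"
proof -
  have "((\<lambda>x. \<Sum>i\<le>degree p. coeff p i * (x ^ i / exp x)) \<longlongrightarrow> (\<Sum>i\<le>degree p. coeff p i * 0)) at_top"
    by (intro tendsto_intros tendsto_power_div_exp_0)
  then show ?thesis by (simp add: poly_altdef sum_divide_distrib)
qed

lemma flat_has_derivative:
  "(flat p has_real_derivative flat ([:0, 0, 1:] * (p - pderiv p)) x) (at x)"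
proof (cases x "0::real" rule: linorder_cases)
  case less
  have "((\<lambda>x. 0) has_real_derivative 0) (at x)" by simp
  then have "(flat p has_real_derivative 0) (at x)"
    by (rule has_field_derivative_transform_within_open[of _ _ _ "{..<0}"]) (use less in \<open>auto simp: flat_def\<close>)
  then show ?thesis using less by (simp add: flat_def)
next
  case greater
  have "((\<lambda>x. poly p (1 / x) * exp (- (1 / x))) has_real_derivative
      poly ([:0, 0, 1:] * (p - pderiv p)) (1 / x) * exp (- (1 / x))) (at x)"
    using greater
    by (auto intro!: derivative_eq_intros simp: field_simps power2_eq_square)
  then have "(flat p has_real_derivative poly ([:0, 0, 1:] * (p - pderiv p)) (1 / x) * exp (- (1 / x))) (at x)"
    by (rule has_field_derivative_transform_within_open[of _ _ _ "{0<..}"]) (use greater in \<open>auto simp: flat_def\<close>)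
  then show ?thesis using greater by (simp add: flat_def)
next
  case equal
  have "((\<lambda>h. flat p h / h) \<longlongrightarrow> 0) (at_right 0)"
    unfolding filterlim_at_right_to_top
  proof (rule Lim_transform_eventually)
    \<comment> \<open>With h = 1/x the difference quotient at 0 becomes x p(x) / exp x;
      \<open>pCons 0 p\<close> supplies the extra factor x.\<close>
    show "((\<lambda>x. poly (pCons 0 p) x / exp x) \<longlongrightarrow> 0) at_top" by (rule poly_over_exp_tendsto_0)
    show "\<forall>\<^sub>F x in at_top. poly (pCons 0 p) x / exp x = flat p (inverse x) / inverse x"
      using eventually_gt_at_top[of 0]
      by eventually_elim (simp add: flat_def field_simps exp_minus)
  qed
  moreover have "((\<lambda>h. flat p h / h) \<longlongrightarrow> 0) (at_left 0)"
    by (rule Lim_transform_eventually[of "\<lambda>h. 0"])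
       (auto simp: flat_def eventually_at_left_field intro!: exI[of _ "-1"])
  ultimately have "((\<lambda>h. flat p h / h) \<longlongrightarrow> 0) (at 0)" by (simp add: filterlim_at_split)
  then show ?thesis using equal by (simp add: has_field_derivative_iff flat_def)
qed

lemma smooth_flat_coord:
  fixes i :: "'n::finite"
  shows "smooth (\<lambda>x::real^'n. flat 1 (s * x $ i + c))"
proof -
  define D where "D n y = s ^ n * flat (((\<lambda>p. [:0, 0, 1:] * (p - pderiv p)) ^^ n) 1) (s * y + c)" for n y
  have "smooth (\<lambda>x::real^'n. D 0 (x $ i))"
  proof (rule smooth_compose_coord)
    fix n y
    have "((\<lambda>y. s * y + c) has_real_derivative s) (at y)" by (auto intro!: derivative_eq_intros)
    from DERIV_cmult[OF DERIV_chain2[OF flat_has_derivative this], of "s ^ n"]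
    show "(D n has_real_derivative D (Suc n) y) (at y)" by (simp add: D_def[abs_def] mult_ac)
  qed
  then show ?thesis by (simp add: D_def)
qed

lemma flat_bounds: "0 \<le> flat 1 x" "flat 1 x \<le> 1" "0 < x \<Longrightarrow> 0 < flat 1 x" "x \<le> 0 \<Longrightarrow> flat 1 x = 0"
  by (auto simp: flat_def)

lemma isCont_flat: "isCont (flat p) x"
  using flat_has_derivative DERIV_isCont by blast

lemma flat_tendsto_1:
  assumes "0 < y" shows "(\<lambda>n. flat 1 (real n * y - 1)) \<longlonglongrightarrow> 1"
proof -
  have lim: "filterlim (\<lambda>n. real n * y - 1) at_top sequentially"
    using filterlim_tendsto_add_at_top[OF tendsto_const[of "-1"] filterlim_at_top_mult_tendsto_pos[OF tendsto_const assms filterlim_real_sequentially]]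
    by (simp add: algebra_simps)
  then have "(\<lambda>n. exp (- (1 / (real n * y - 1)))) \<longlonglongrightarrow> exp (- 0)"
    by (intro tendsto_intros tendsto_divide_0[OF tendsto_const] filterlim_at_top_imp_at_infinity)
  moreover have "\<forall>\<^sub>F n in sequentially. exp (- (1 / (real n * y - 1))) = flat 1 (real n * y - 1)"
    using lim[unfolded filterlim_at_top_dense, rule_format, of 0] by eventually_elim (simp add: flat_def)
  ultimately show ?thesis by (simp add: Lim_transform_eventually)
qed

subsection \<open>Test functions on boxes\<close>

lemma test_functionsD:
  assumes "\<phi> \<in> test_functions U"
  shows "smooth \<phi>" "x \<notin> U \<Longrightarrow> \<phi> x = 0"
  using assms by (auto simp: test_functions_def smooth_def)

lemma test_functionsI: "smooth \<phi> \<Longrightarrow> compact K \<Longrightarrow> K \<subseteq> U \<Longrightarrow> (\<And>x. x \<notin> K \<Longrightarrow> \<phi> x = 0) \<Longrightarrow> \<phi> \<in> test_functions U"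
  by (auto simp: test_functions_def smooth_def)

lemma test_functionsE:
  assumes "\<phi> \<in> test_functions U"
  obtains K where "compact K" "K \<subseteq> U" "\<And>x. x \<notin> K \<Longrightarrow> \<phi> x = 0"
  using assms by (auto simp: test_functions_def)

lemma test_functions_mono: "U \<subseteq> V \<Longrightarrow> test_functions U \<subseteq> test_functions V"
  by (auto simp: test_functions_def)

lemma partial_deriv_zero_outside:
  assumes "closed K" "\<And>x. x \<notin> K \<Longrightarrow> \<phi> x = (0::real)" "x \<notin> K"
  shows "partial_deriv j \<phi> x = 0"
proof -
  have "((\<lambda>x. 0::real) has_derivative (\<lambda>h. 0)) (at x)" by simp
  then have "(\<phi> has_derivative (\<lambda>h. 0)) (at x)"
    by (rule has_derivative_transform_within_open[of _ _ _ _ "- K"]) (use assms in auto)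
  then show ?thesis by (simp add: partial_deriv_eqI)
qed

lemma test_partial_deriv: 
  assumes "\<phi> \<in> test_functions U" shows "partial_deriv j \<phi> \<in> test_functions U"
proof -
  from assms obtain K where K: "compact K" "K \<subseteq> U" "\<And>x. x \<notin> K \<Longrightarrow> \<phi> x = 0" by (rule test_functionsE) blast
  show ?thesis
    by (rule test_functionsI[OF smooth_partial_deriv[OF test_functionsD(1)[OF assms]] K(1,2)
          partial_deriv_zero_outside[OF compact_imp_closed[OF K(1)] K(3)]])
qed

lemma test_partial_derivs: "\<phi> \<in> test_functions U \<Longrightarrow> partial_derivs js \<phi> \<in> test_functions U"
  by (induction js) (auto intro: test_partial_deriv)

lemma test_mult:
  assumes "\<phi> \<in> test_functions U" "smooth f" shows "(\<lambda>x. f x * \<phi> x) \<in> test_functions U"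
  using assms(1)
  by (elim test_functionsE)
     (auto intro!: test_functionsI smooth_mult simp: test_functionsD(1)[OF assms(1)] assms(2))

lemma test_add:
  assumes f: "\<phi> \<in> test_functions U" and g: "\<psi> \<in> test_functions U"
  shows "(\<lambda>x. \<phi> x + \<psi> x) \<in> test_functions U"
proof -
  from f obtain K where K: "compact K" "K \<subseteq> U" "\<And>x. x \<notin> K \<Longrightarrow> \<phi> x = 0" by (rule test_functionsE) blast
  from g obtain L where L: "compact L" "L \<subseteq> U" "\<And>x. x \<notin> L \<Longrightarrow> \<psi> x = 0" by (rule test_functionsE) blast
  show ?thesis
    by (rule test_functionsI[of _ "K \<union> L"])
       (use K L in \<open>auto intro!: smooth_add test_functionsD(1)[OF f] test_functionsD(1)[OF g]\<close>)
qed

lemma test_diff: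
  assumes f: "\<phi> \<in> test_functions U" and g: "\<psi> \<in> test_functions U"
  shows "(\<lambda>x. \<phi> x - \<psi> x) \<in> test_functions U"
  using test_add[OF f test_mult[OF g smooth_const[of "-1"]]] by simp

lemma test_bounded:
  assumes "\<phi> \<in> test_functions U"
  obtains B where "0 \<le> B" "\<And>x. \<bar>\<phi> x\<bar> \<le> B"
proof -
  from assms obtain K where K: "compact K" "K \<subseteq> U" "\<And>x. x \<notin> K \<Longrightarrow> \<phi> x = 0" by (rule test_functionsE) blast
  have "bounded (\<phi> ` K)"
    by (intro compact_imp_bounded compact_continuous_image smooth_continuous test_functionsD[OF assms] K)
  then obtain B where "B > 0" "\<And>x. x \<in> K \<Longrightarrow> norm (\<phi> x) \<le> B"
    unfolding bounded_pos by auto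
  then show thesis using that[of B] K by (metis abs_zero less_eq_real_def real_norm_def)
qed

lemma compact_subset_box:
  fixes a b :: "real^'n::finite"
  assumes ab: "\<And>j. a $ j < b $ j" and K: "compact K" "K \<subseteq> box a b"
  obtains c d where "\<And>j. a $ j < c $ j" "\<And>j. d $ j < b $ j" "\<And>j. c $ j < d $ j" "K \<subseteq> cbox c d"
proof -
  have "\<exists>l u. a $ j < l \<and> u < b $ j \<and> l < u \<and> (\<forall>x\<in>K. l \<le> x $ j \<and> x $ j \<le> u)" for j
  proof -
    \<comment> \<open>The inserted midpoint keeps the set nonempty when \<open>K\<close> is empty.
      The later averaging with \<open>a $ j\<close> and \<open>b $ j\<close> makes the interval
      nondegenerate even when \<open>K\<close> is flat in direction \<open>j\<close>.\<close>
    have "compact (insert ((a $ j + b $ j) / 2) ((\<lambda>x. x $ j) ` K))"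
      by (intro compact_insert compact_continuous_image K continuous_intros)
    moreover have "insert ((a $ j + b $ j) / 2) ((\<lambda>x. x $ j) ` K) \<subseteq> {a $ j<..<b $ j}"
      using K(2) ab[of j] by (auto simp: mem_box_cart)
    ultimately obtain l u where "insert ((a $ j + b $ j) / 2) ((\<lambda>x. x $ j) ` K) \<subseteq> {l..u}"
      "a $ j < l" "u < b $ j"
    proof -
      let ?S = "insert ((a $ j + b $ j) / 2) ((\<lambda>x. x $ j) ` K)"
      assume *: "\<And>l u. ?S \<subseteq> {l..u} \<Longrightarrow> a $ j < l \<Longrightarrow> u < b $ j \<Longrightarrow> thesis"
        and S: "compact ?S" "?S \<subseteq> {a $ j<..<b $ j}"
      obtain l where l: "l \<in> ?S" "\<forall>x\<in>?S. l \<le> x" using compact_attains_inf[OF S(1)] by blast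
      obtain u where u: "u \<in> ?S" "\<forall>x\<in>?S. x \<le> u" using compact_attains_sup[OF S(1)] by blast
      have "?S \<subseteq> {l..u}" using l(2) u(2) by auto
      moreover have "a $ j < l" "u < b $ j" using S(2) l(1) u(1) by auto
      ultimately show thesis by (rule *)
    qed
    then have "a $ j < (a $ j + l) / 2" "(u + b $ j) / 2 < b $ j" "(a $ j + l) / 2 < (u + b $ j) / 2"
      "\<forall>x\<in>K. (a $ j + l) / 2 \<le> x $ j \<and> x $ j \<le> (u + b $ j) / 2" using ab[of j] by force+
    then show ?thesis by blast
  qed
  then obtain l u where "\<And>j. a $ j < l j" "\<And>j. u j < b $ j" "\<And>j. l j < u j" "\<And>j x. x \<in> K \<Longrightarrow> l j \<le> x $ j \<and> x $ j \<le> u j"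
    by metis
  then show thesis by (intro that[of "\<chi> j. l j" "\<chi> j. u j"]) (auto simp: mem_box_cart)
qed

lemma cbox_subset_box:
  fixes a b :: "real^'n::finite"
  shows "(\<And>j. a $ j < c $ j) \<Longrightarrow> (\<And>j. d $ j < b $ j) \<Longrightarrow> cbox c d \<subseteq> box a b"
  by (auto simp: mem_box_cart) (meson less_le_trans le_less_trans)+

text \<open>Applied to n times the distance to a face, minus 1, the function \<open>flat 1\<close>
  vanishes near the face and tends to 1 inside the box. Uniform bounds together with pointwise
  convergence are what dominated convergence asks for.\<close>

lemma box_cutoff:
  fixes a b :: "real^'n::finite"
  assumes ab: "\<And>j. a $ j < b $ j"
  obtains cut :: "nat \<Rightarrow> real^'n \<Rightarrow> real" where
    "\<And>n. cut n \<in> test_functions (box a b)" "\<And>n x. 0 \<le> cut n x" "\<And>n x. cut n x \<le> 1"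
    "\<And>x. x \<in> box a b \<Longrightarrow> (\<lambda>n. cut n x) \<longlonglongrightarrow> 1"
proof
  define cut :: "nat \<Rightarrow> real^'n \<Rightarrow> real"
    where "cut n x = (\<Prod>j\<in>UNIV. flat 1 (real n * (x $ j - a $ j) - 1) * flat 1 (real n * (b $ j - x $ j) - 1))" for n x
  show "cut n \<in> test_functions (box a b)" for n
  proof (rule test_functionsI)
    have "smooth (\<lambda>x. flat 1 (real n * (x $ j - a $ j) - 1))" "smooth (\<lambda>x. flat 1 (real n * (b $ j - x $ j) - 1))" for j
      using smooth_flat_coord[of "real n" j "- real n * a $ j - 1"] smooth_flat_coord[of "- real n" j "real n * b $ j - 1"]
      by (auto simp: algebra_simps)
    then show "smooth (cut n)" unfolding cut_def[abs_def] by (intro smooth_prod smooth_mult)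
    \<comment> \<open>The margin \<open>1 / (real n + 1)\<close> instead of 1/n also covers
      \<open>n = 0\<close>, where the cutoff is identically 0.\<close>
    define c where "c = (\<chi> j. a $ j + 1 / (real n + 1))"
    define d where "d = (\<chi> j. b $ j - 1 / (real n + 1))"
    show "compact (cbox c d)" by (rule compact_cbox)
    show "cbox c d \<subseteq> box a b" by (rule cbox_subset_box) (auto simp: c_def d_def)
    fix x assume "x \<notin> cbox c d"
    then obtain j where "x $ j - a $ j < 1 / (real n + 1) \<or> b $ j - x $ j < 1 / (real n + 1)"
      by (auto simp: mem_box_cart c_def d_def not_le algebra_simps)
    moreover have "real n * y - 1 \<le> 0" if "y < 1 / (real n + 1)" for y :: real
    proof -
      have "real n * y \<le> real n * (1 / (real n + 1))" using that by (intro mult_left_mono) auto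
      also have "\<dots> \<le> 1" by (simp add: field_simps)
      finally show ?thesis by simp
    qed
    ultimately have "flat 1 (real n * (x $ j - a $ j) - 1) * flat 1 (real n * (b $ j - x $ j) - 1) = 0"
      using flat_bounds(4) by auto
    then show "cut n x = 0" unfolding cut_def by (intro prod_zero) auto
  qed
  show "0 \<le> cut n x" for n x unfolding cut_def by (intro prod_nonneg) (auto simp: flat_bounds)
  show "cut n x \<le> 1" for n x unfolding cut_def by (intro prod_le_1) (auto simp: flat_bounds mult_le_one)
  fix x assume x: "x \<in> box a b"
  have "(\<lambda>n. cut n x) \<longlonglongrightarrow> (\<Prod>j\<in>(UNIV::'n set). 1 * 1)"
    unfolding cut_def by (intro tendsto_prod tendsto_mult flat_tendsto_1) (use x in \<open>auto simp: mem_box_cart\<close>)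
  then show "(\<lambda>n. cut n x) \<longlonglongrightarrow> 1" by simp
qed

subsection \<open>Approximation by test functions\<close>

text \<open>Measurability provides continuous functions converging almost everywhere; clipping to
  [-N, N] makes them bounded, Stone-Weierstrass on the closed box makes them polynomials, and the
  cutoffs make their supports compact. The bound \<open>N + 1\<close> is the clipping level plus a
  uniform error of at most 1.\<close>

lemma test_approximation:
  fixes w :: "real^'n::finite \<Rightarrow> real"
  assumes ab: "\<And>j. a $ j < b $ j" and w: "w \<in> borel_measurable (lebesgue_on (box a b))"
    and N: "\<And>x. x \<in> box a b \<Longrightarrow> \<bar>w x\<bar> \<le> N" "0 \<le> N"
  obtains \<psi> where "\<And>n. \<psi> n \<in> test_functions (box a b)" "\<And>n x. x \<in> box a b \<Longrightarrow> \<bar>\<psi> n x\<bar> \<le> N + 1"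
    "AE x in lebesgue_on (box a b). (\<lambda>n::nat. \<psi> n x) \<longlonglongrightarrow> w x"
proof -
  from w have "w measurable_on box a b" by (simp add: measurable_on_iff_borel_measurable)
  then obtain Z g where Z: "negligible Z" and g: "\<And>n::nat. continuous_on UNIV (g n)"
    and lim: "\<And>x. x \<notin> Z \<Longrightarrow> (\<lambda>n. g n x) \<longlonglongrightarrow> (if x \<in> box a b then w x else 0)"
    unfolding measurable_on_def by metis
  define h where "h n x = max (-N) (min N (g n x))" for n x
  have "\<exists>p. real_polynomial_function p \<and> (\<forall>x\<in>cbox a b. \<bar>h n x - p x\<bar> < 1 / (real n + 1))" for n
  proof -
    have "continuous_on (cbox a b) (h n)" unfolding h_def
      by (intro continuous_intros continuous_on_subset[OF g]) auto
    moreover have "0 < 1 / (real n + 1)" by simp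
    ultimately obtain p where "real_polynomial_function p" "\<And>x. x \<in> cbox a b \<Longrightarrow> \<bar>h n x - p x\<bar> < 1 / (real n + 1)"
      using Stone_Weierstrass_real_polynomial_function[OF compact_cbox] by metis
    then show ?thesis by blast
  qed
  then obtain p where p: "\<And>n. real_polynomial_function (p n)"
    "\<And>n x. x \<in> cbox a b \<Longrightarrow> \<bar>h n x - p n x\<bar> < 1 / (real n + 1)" by metis
  obtain cut :: "nat \<Rightarrow> real^'n \<Rightarrow> real" where cut: "\<And>n. cut n \<in> test_functions (box a b)" "\<And>n x. 0 \<le> cut n x" "\<And>n x. cut n x \<le> 1"
    "\<And>x. x \<in> box a b \<Longrightarrow> (\<lambda>n. cut n x) \<longlonglongrightarrow> 1" using box_cutoff[OF ab] by blast
  show thesis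
  proof
    show "(\<lambda>x. p n x * cut n x) \<in> test_functions (box a b)" for n
      by (intro test_mult cut smooth_real_polynomial_function p)
    show "\<bar>p n x * cut n x\<bar> \<le> N + 1" if "x \<in> box a b" for n x
    proof -
      have "\<bar>h n x - p n x\<bar> < 1 / (real n + 1)" using that box_subset_cbox by (intro p) auto
      also have "\<dots> \<le> 1" by simp
      finally have "\<bar>p n x\<bar> \<le> N + 1" using N(2) by (auto simp: h_def)
      then have "\<bar>p n x\<bar> * \<bar>cut n x\<bar> \<le> (N + 1) * 1" using cut(2,3) by (intro mult_mono) auto
      then show ?thesis by (simp add: abs_mult)
    qed
    have "(\<lambda>n. p n x * cut n x) \<longlonglongrightarrow> w x" if x: "x \<in> box a b" "x \<notin> Z" for x
    proof -
      have "(\<lambda>n. h n x) \<longlonglongrightarrow> max (-N) (min N (w x))"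
        unfolding h_def using lim[OF x(2)] x(1) by (intro tendsto_max tendsto_min tendsto_const) simp
      also have "max (-N) (min N (w x)) = w x" using N(1)[OF x(1)] by auto
      finally have h: "(\<lambda>n. h n x) \<longlonglongrightarrow> w x" .
      have "(\<lambda>n. 1 / (real n + 1)) \<longlonglongrightarrow> 0"
        using LIMSEQ_inverse_real_of_nat by (simp add: inverse_eq_divide add.commute)
      then have "(\<lambda>n. h n x - p n x) \<longlonglongrightarrow> 0"
      proof (rule Lim_null_comparison[rotated])
        have "x \<in> cbox a b" using x(1) box_subset_cbox by blast
        then show "\<forall>\<^sub>F n in sequentially. norm (h n x - p n x) \<le> 1 / (real n + 1)"
          using p(2)[of x] by (auto simp: less_imp_le intro!: always_eventually)
      qed
      from tendsto_mult[OF tendsto_diff[OF h this] cut(4)[OF x(1)]] show ?thesis by simp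
    qed
    moreover have "AE x in lebesgue_on (box a b). x \<in> box a b \<and> x \<notin> Z"
      using Z by (auto simp: AE_restrict_space_iff negligible_iff_null_sets dest!: AE_not_in)
    ultimately show "AE x in lebesgue_on (box a b). (\<lambda>n. p n x * cut n x) \<longlonglongrightarrow> w x" by fastforce
  qed
qed

lemma test_measurable:
  "\<phi> \<in> test_functions V \<Longrightarrow> U \<in> sets lebesgue \<Longrightarrow> \<phi> \<in> borel_measurable (lebesgue_on U)"
  by (intro continuous_imp_measurable_on_sets_lebesgue smooth_continuous test_functionsD(1))

lemma integrable_test_mult:
  fixes G :: "real^'n::finite \<Rightarrow> 'a::euclidean_space"
  assumes "\<phi> \<in> test_functions V" "integrable (lebesgue_on U) G" "U \<in> sets lebesgue"
  shows "integrable (lebesgue_on U) (\<lambda>x. \<phi> x *\<^sub>R G x)"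
proof -
  obtain B where B: "0 \<le> B" "\<And>x. \<bar>\<phi> x\<bar> \<le> B" using test_bounded[OF assms(1)] by blast
  have [measurable]: "\<phi> \<in> borel_measurable (lebesgue_on U)" "G \<in> borel_measurable (lebesgue_on U)"
    using assms test_measurable by auto
  show ?thesis
    by (rule Bochner_Integration.integrable_bound[of _ "\<lambda>x. B *\<^sub>R norm (G x)"])
       (use B assms in \<open>auto intro!: mult_right_mono AE_I2\<close>)
qed

lemma finite_measure_lebesgue_on_box: "finite_measure (lebesgue_on (box a (b::'a::euclidean_space)))"
  by (rule finite_measureI) (simp add: emeasure_restrict_space emeasure_lborel_box_eq)

lemma tendsto_integral_bounded:
  fixes f :: "real^'n::finite \<Rightarrow> real"
  assumes f: "integrable (lebesgue_on U) f" and U: "U \<in> sets lebesgue"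
    and \<psi>: "\<And>n. \<psi> n \<in> borel_measurable (lebesgue_on U)" "\<And>n x. x \<in> U \<Longrightarrow> \<bar>\<psi> n x\<bar> \<le> N"
    and w: "w \<in> borel_measurable (lebesgue_on U)"
    and lim: "AE x in lebesgue_on U. (\<lambda>n. \<psi> n x) \<longlonglongrightarrow> w x"
  shows "(\<lambda>n. LINT x|lebesgue_on U. \<psi> n x * f x) \<longlonglongrightarrow> (LINT x|lebesgue_on U. w x * f x)"
proof (rule integral_dominated_convergence[of _ _ _ "\<lambda>x. N * \<bar>f x\<bar>"])
  have [measurable]: "f \<in> borel_measurable (lebesgue_on U)" using f by auto
  note [measurable] = \<psi>(1) w
  show "(\<lambda>x. w x * f x) \<in> borel_measurable (lebesgue_on U)" by measurable
  show "(\<lambda>x. \<psi> n x * f x) \<in> borel_measurable (lebesgue_on U)" for n by measurable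
  show "integrable (lebesgue_on U) (\<lambda>x. N * \<bar>f x\<bar>)" using f by auto
  show "AE x in lebesgue_on U. (\<lambda>n. \<psi> n x * f x) \<longlonglongrightarrow> w x * f x"
    using lim by eventually_elim (intro tendsto_intros)
  show "AE x in lebesgue_on U. norm (\<psi> n x * f x) \<le> N * \<bar>f x\<bar>" for n
    using U \<psi>(2) by (auto simp: abs_mult space_restrict_space intro!: AE_I2 mult_right_mono)
qed

text \<open>Test functions approximating \<open>sgn G\<close> turn the hypothesis, in the limit,
  into a vanishing integral of the absolute value of \<open>G\<close>.\<close>

lemma test_dense_zero:
  fixes G :: "real^'n::finite \<Rightarrow> real"
  assumes ab: "\<And>j. a $ j < b $ j" and G: "integrable (lebesgue_on (box a b)) G"
    and 0: "\<And>\<phi>. \<phi> \<in> test_functions (box a b) \<Longrightarrow> (LINT x|lebesgue_on (box a b). \<phi> x * G x) = 0"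
  shows "AE x in lebesgue_on (box a b). G x = 0"
proof -
  let ?M = "lebesgue_on (box a b)"
  have [measurable]: "G \<in> borel_measurable ?M" using G by auto
  have w: "(\<lambda>x. sgn (G x)) \<in> borel_measurable ?M" by measurable
  obtain \<psi> where \<psi>: "\<And>n. \<psi> n \<in> test_functions (box a b)" "\<And>n x. x \<in> box a b \<Longrightarrow> \<bar>\<psi> n x\<bar> \<le> 1 + 1"
    "AE x in lebesgue_on (box a b). (\<lambda>n::nat. \<psi> n x) \<longlonglongrightarrow> sgn (G x)"
    by (rule test_approximation[OF ab w, of 1]) (auto simp: sgn_if)
  have "(\<lambda>n. LINT x|?M. \<psi> n x * G x) \<longlonglongrightarrow> (LINT x|?M. sgn (G x) * G x)"
    by (rule tendsto_integral_bounded[OF G _ _ \<psi>(2) w \<psi>(3)]) (auto intro: test_measurable[OF \<psi>(1)])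
  then have "(LINT x|?M. \<bar>G x\<bar>) = 0"
    using 0[OF \<psi>(1)] by (simp add: abs_sgn mult.commute LIMSEQ_const_iff)
  then show ?thesis using G by (subst (asm) integral_nonneg_eq_0_iff_AE) auto
qed

text \<open>If \<open>u\<close> itself could be inserted for \<open>\<phi>\<close>, the bound would
  read I \<le> M sqrt I for the integral I of u^2, and one factor cancels. The truncations
  \<open>w N\<close> stand in for \<open>u\<close> because they admit uniformly bounded
  approximations by test functions; w^2 \<le> w u keeps the inequality, and N goes to infinity at
  the end.\<close>

lemma L2_duality:
  fixes u :: "real^'n::finite \<Rightarrow> real"
  assumes ab: "\<And>j. a $ j < b $ j" and u: "u \<in> borel_measurable (lebesgue_on (box a b))"
    and u2: "integrable (lebesgue_on (box a b)) (\<lambda>x. (u x)\<^sup>2)" and M: "0 \<le> M"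
    and bound: "\<And>\<phi>. \<phi> \<in> test_functions (box a b) \<Longrightarrow>
      \<bar>LINT x|lebesgue_on (box a b). \<phi> x * u x\<bar> \<le> M * sqrt (LINT x|lebesgue_on (box a b). (\<phi> x)\<^sup>2)"
  shows "(LINT x|lebesgue_on (box a b). (u x)\<^sup>2) \<le> M\<^sup>2"
proof -
  let ?M = "lebesgue_on (box a b)"
  interpret finite_measure ?M by (rule finite_measure_lebesgue_on_box)
  note [measurable] = u
  have u1: "integrable ?M u"
  proof (rule Bochner_Integration.integrable_bound[of _ "\<lambda>x. 1 + (u x)\<^sup>2"])
    show "integrable ?M (\<lambda>x. 1 + (u x)\<^sup>2)" using u2 by auto
    have "\<bar>y\<bar> \<le> 1 + y\<^sup>2" for y :: real
    proof -
      have "(\<bar>y\<bar> - 1)\<^sup>2 = y\<^sup>2 - 2 * \<bar>y\<bar> + 1" by (simp add: power2_diff)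
      then show ?thesis using zero_le_power2[of "\<bar>y\<bar> - 1"] by linarith
    qed
    then show "AE x in ?M. norm (u x) \<le> norm (1 + (u x)\<^sup>2)" by (auto intro!: AE_I2)
  qed auto
  define w where "w N x = max (- real N) (min (real N) (u x))" for N x
  have w[measurable]: "w N \<in> borel_measurable ?M" for N unfolding w_def by measurable
  have wb: "\<bar>w N x\<bar> \<le> real N" for N x by (auto simp: w_def)
  have wu: "(w N x)\<^sup>2 \<le> w N x * u x" "(w N x)\<^sup>2 \<le> (u x)\<^sup>2" "\<bar>w N x * u x\<bar> \<le> (u x)\<^sup>2" for N x
  proof -
    have A: "\<bar>w N x\<bar> \<le> \<bar>u x\<bar>" and B: "w N x * u x = \<bar>w N x\<bar> * \<bar>u x\<bar>"
      by (auto simp: w_def min_def max_def abs_if)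
    have C: "(w N x)\<^sup>2 = \<bar>w N x\<bar> * \<bar>w N x\<bar>" "(u x)\<^sup>2 = \<bar>u x\<bar> * \<bar>u x\<bar>"
      by (simp_all add: power2_eq_square)
    show "(w N x)\<^sup>2 \<le> w N x * u x" unfolding B C by (intro mult_left_mono A) simp
    show "(w N x)\<^sup>2 \<le> (u x)\<^sup>2" unfolding C by (intro mult_mono A) simp_all
    show "\<bar>w N x * u x\<bar> \<le> (u x)\<^sup>2" unfolding C abs_mult by (intro mult_right_mono A) simp
  qed
  have wint: "integrable ?M (\<lambda>x. (w N x)\<^sup>2)" "integrable ?M (\<lambda>x. w N x * u x)" for N
    by (rule Bochner_Integration.integrable_bound[OF u2]; use wu in \<open>auto intro!: AE_I2\<close>)+
  have "(LINT x|?M. (w N x)\<^sup>2) \<le> M\<^sup>2" for N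
  proof -
    obtain \<psi> where \<psi>: "\<And>n. \<psi> n \<in> test_functions (box a b)" "\<And>n x. x \<in> box a b \<Longrightarrow> \<bar>\<psi> n x\<bar> \<le> real N + 1"
      "AE x in lebesgue_on (box a b). (\<lambda>n::nat. \<psi> n x) \<longlonglongrightarrow> w N x"
      using test_approximation[OF ab w wb, of N] by auto
    note \<psi>m = test_measurable[OF \<psi>(1), of "box a b"]
    have "(\<lambda>n. LINT x|?M. \<psi> n x * u x) \<longlonglongrightarrow> (LINT x|?M. w N x * u x)"
      by (rule tendsto_integral_bounded[OF u1 _ _ \<psi>(2) w \<psi>(3)]) (auto intro: \<psi>m)
    moreover have "(\<lambda>n. LINT x|?M. (\<psi> n x)\<^sup>2 * 1) \<longlonglongrightarrow> (LINT x|?M. (w N x)\<^sup>2 * 1)"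
    proof (rule tendsto_integral_bounded[where N = "(real N + 1)\<^sup>2"])
      show "AE x in ?M. (\<lambda>n. (\<psi> n x)\<^sup>2) \<longlonglongrightarrow> (w N x)\<^sup>2"
        using \<psi>(3) by eventually_elim (intro tendsto_intros)
      show "\<bar>(\<psi> n x)\<^sup>2\<bar> \<le> (real N + 1)\<^sup>2" if "x \<in> box a b" for n x
        using power_mono[OF \<psi>(2)[OF that, of n], of 2] by simp
    qed (use \<psi>m in auto)
    ultimately have lim: "\<bar>LINT x|?M. w N x * u x\<bar> \<le> M * sqrt (LINT x|?M. (w N x)\<^sup>2)"
      by (intro LIMSEQ_le[OF tendsto_rabs tendsto_mult[OF tendsto_const tendsto_real_sqrt]])
         (auto intro!: bound \<psi>)
    let ?I = "LINT x|?M. (w N x)\<^sup>2"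
    have I0: "0 \<le> ?I" by simp
    have "?I \<le> (LINT x|?M. w N x * u x)" by (intro integral_mono wint wu)
    with lim have "?I \<le> M * sqrt ?I" by linarith
    then have "sqrt ?I * sqrt ?I \<le> M * sqrt ?I" using I0 by simp
    then have "sqrt ?I \<le> M"
      using M I0 by (metis mult_right_le_imp_le order_le_less real_sqrt_ge_0_iff)
    then show ?thesis by (rule sqrt_le_D)
  qed
  moreover have "(\<lambda>N. LINT x|?M. (w N x)\<^sup>2) \<longlonglongrightarrow> (LINT x|?M. (u x)\<^sup>2)"
  proof (rule integral_dominated_convergence[OF _ _ u2])
    show "AE x in ?M. (\<lambda>N. (w N x)\<^sup>2) \<longlonglongrightarrow> (u x)\<^sup>2"
    proof (intro AE_I2 tendsto_eventually)
      fix x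
      obtain N0 where N0: "\<bar>u x\<bar> \<le> real N0" using real_arch_simple by blast
      have "w N x = u x" if "N \<ge> N0" for N
        using N0 of_nat_mono[OF that, where 'a = real] by (auto simp: w_def)
      then show "\<forall>\<^sub>F N in sequentially. (w N x)\<^sup>2 = (u x)\<^sup>2"
        unfolding eventually_at_top_linorder by (metis (no_types))
    qed
  qed (use wu in \<open>auto intro!: AE_I2\<close>)
  ultimately show ?thesis by (intro LIMSEQ_le_const2[of _ _ "M\<^sup>2"]) auto
qed

text \<open>\<open>U\<close> is a countable union of closed boxes whose faces are null sets, and a
  test function of an open box inside \<open>U\<close> is a test function of \<open>U\<close>. This
  reduces the claim to \<open>test_dense_zero\<close> for each coordinate of \<open>G\<close> on
  each box.\<close>

lemma weak_zero_ae:
  fixes G :: "real^'n::finite \<Rightarrow> 'a::{real_normed_field, euclidean_space}"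
  assumes U: "open U" and G: "locally_integrable U G"
    and 0: "\<And>\<phi>. \<phi> \<in> test_functions U \<Longrightarrow> (LINT x:U|lebesgue. \<phi> x *\<^sub>R G x) = 0"
  shows "AE x in lebesgue. x \<in> U \<longrightarrow> G x = 0"
proof -
  obtain \<D> where D: "countable \<D>" "\<And>X. X \<in> \<D> \<Longrightarrow> X \<subseteq> U" "\<And>X. X \<in> \<D> \<Longrightarrow> \<exists>a b. X = cbox a b" "\<Union>\<D> = U"
    by (rule open_countable_Union_open_cbox[OF U]) (metis PowD subsetD)
  have "AE x in lebesgue. x \<in> X \<longrightarrow> G x = 0" if XD: "X \<in> \<D>" for X
  proof -
    obtain a b where X: "X = cbox a b" using D(3)[OF XD] by blast
    have neg: "AE x in lebesgue. x \<notin> cbox a b - box a b"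
      using negligible_frontier_interval[of a b] by (intro AE_not_in) (simp add: negligible_iff_null_sets)
    have "AE x in lebesgue. x \<in> box a b \<longrightarrow> G x = 0"
    proof (cases "\<forall>j. a $ j < b $ j")
      case True
      let ?M = "lebesgue_on (box a b)"
      have sub: "box a b \<subseteq> U" using D(2)[OF XD] X box_subset_cbox by blast
      have "set_integrable lebesgue (cbox a b) G"
        using G D(2)[OF XD] by (auto simp: locally_integrable_def X)
      then have "set_integrable lebesgue (box a b) G"
        by (rule set_integrable_subset) (auto simp: box_subset_cbox)
      then have Gi: "integrable ?M G" by (simp add: set_integrable_def integrable_restrict_space)
      have "AE x in ?M. G x \<bullet> e = 0" if "e \<in> Basis" for e
      proof (rule test_dense_zero)
        show "integrable ?M (\<lambda>x. G x \<bullet> e)" using Gi by auto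
        fix \<phi> :: "real^'n \<Rightarrow> real" assume \<phi>: "\<phi> \<in> test_functions (box a b)"
        have "(LINT x|?M. \<phi> x *\<^sub>R G x) = (LINT x:box a b|lebesgue. \<phi> x *\<^sub>R G x)"
          by (simp add: set_lebesgue_integral_def integral_restrict_space)
        also have "\<dots> = (LINT x:U|lebesgue. \<phi> x *\<^sub>R G x)"
          unfolding set_lebesgue_integral_def
          by (rule Bochner_Integration.integral_cong) (use test_functionsD(2)[OF \<phi>] sub in \<open>auto simp: indicator_def\<close>)
        also have "\<dots> = 0" using 0 \<phi> test_functions_mono[OF sub] by blast
        finally have "(LINT x|?M. \<phi> x *\<^sub>R G x) \<bullet> e = 0" by simp
        also have "(LINT x|?M. \<phi> x *\<^sub>R G x) \<bullet> e = (LINT x|?M. (\<phi> x *\<^sub>R G x) \<bullet> e)"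
          by (rule integral_inner_left[symmetric]) (intro integrable_test_mult[OF \<phi> Gi], simp)
        finally show "(LINT x|?M. \<phi> x * (G x \<bullet> e)) = 0" by simp
      qed (use True in auto)
      then have "AE x in ?M. \<forall>e\<in>Basis. G x \<bullet> e = 0" by (intro AE_finite_allI) auto
      then have "AE x in ?M. G x = 0" by eventually_elim (simp add: euclidean_all_zero_iff)
      then show ?thesis by (simp add: AE_restrict_space_iff)
    next
      case False
      then have "box a b = {}" by (auto simp: mem_box_cart) (metis less_trans)
      then show ?thesis by simp
    qed
    with neg show ?thesis unfolding X by eventually_elim auto
  qed
  then have "AE x in lebesgue. \<forall>X\<in>\<D>. x \<in> X \<longrightarrow> G x = 0"
    using D(1) by (intro AE_ball_countable')
  then show ?thesis by eventually_elim (use D(4) in auto)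
qed

subsection \<open>Integration along coordinate lines\<close>

lemma integrable_test_lborel:
  assumes "\<phi> \<in> test_functions U"
  shows "integrable lborel \<phi>"
proof -
  from assms obtain K where K: "compact K" "\<And>x. x \<notin> K \<Longrightarrow> \<phi> x = 0" by (rule test_functionsE) blast
  have "integrable lborel (\<lambda>x. indicator K x *\<^sub>R \<phi> x)"
    by (intro borel_integrable_compact K smooth_continuous test_functionsD[OF assms])
  also have "(\<lambda>x. indicator K x *\<^sub>R \<phi> x) = \<phi>" using K(2) by (force simp: indicator_def)
  finally show ?thesis .
qed

lemma borel_test: "\<phi> \<in> test_functions U \<Longrightarrow> \<phi> \<in> borel_measurable borel"
  using integrable_test_lborel by fastforce

lemma borel_line [measurable]: "(\<lambda>s. x + s *\<^sub>R v) \<in> borel_measurable borel"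
  for x v :: "'a::euclidean_space"
  by (intro borel_measurable_continuous_onI continuous_intros)

lemma test_line_support:
  fixes g :: "real^'n::finite \<Rightarrow> real"
  assumes g: "g \<in> test_functions U"
  obtains L where "0 \<le> L" "\<And>x s. x \<in> ball x0 1 \<Longrightarrow> L < \<bar>s\<bar> \<Longrightarrow> g (x + s *\<^sub>R axis i 1) = 0"
    "\<And>x s j. x \<in> ball x0 1 \<Longrightarrow> L < \<bar>s\<bar> \<Longrightarrow> partial_deriv j g (x + s *\<^sub>R axis i 1) = 0"
proof -
  from g obtain K where K: "compact K" "\<And>x. x \<notin> K \<Longrightarrow> g x = 0" by (rule test_functionsE) blast
  obtain R where R: "R > 0" "\<And>x. x \<in> K \<Longrightarrow> norm x \<le> R"
    using compact_imp_bounded[OF K(1)] bounded_pos by blast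
  have out: "x + s *\<^sub>R axis i 1 \<notin> K" if x: "x \<in> ball x0 1" and s: "R + norm x0 + 1 < \<bar>s\<bar>" for x s
  proof -
    have "norm x \<le> norm x0 + 1" using x norm_triangle_ineq2[of x x0] by (simp add: dist_norm norm_minus_commute)
    moreover have "\<bar>s\<bar> - norm x \<le> norm (x + s *\<^sub>R axis i 1)"
      using norm_triangle_ineq2[of "s *\<^sub>R axis i 1" "- x"] by (simp add: norm_axis_1 add.commute)
    ultimately show ?thesis using s R(2) by force
  qed
  show thesis
  proof
    show "0 \<le> R + norm x0 + 1" using R(1) by simp
    fix x s assume xs: "x \<in> ball x0 1" "R + norm x0 + 1 < \<bar>s\<bar>"
    show "g (x + s *\<^sub>R axis i 1) = 0" by (rule K(2)[OF out[OF xs]])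
    show "partial_deriv j g (x + s *\<^sub>R axis i 1) = 0" for j
      by (rule partial_deriv_zero_outside[OF compact_imp_closed[OF K(1)] K(2) out[OF xs]])
  qed
qed

lemma integrable_line:
  fixes g :: "real^'n::finite \<Rightarrow> real"
  assumes "g \<in> test_functions U"
  shows "integrable lborel (\<lambda>s. g (x + s *\<^sub>R axis i 1))"
proof -
  obtain L where L: "0 \<le> L" "\<And>s. L < \<bar>s\<bar> \<Longrightarrow> g (x + s *\<^sub>R axis i 1) = 0"
    using test_line_support[OF assms, of x i] by (metis centre_in_ball zero_less_one)
  have "integrable lborel (\<lambda>s. indicator {-L..L} s *\<^sub>R g (x + s *\<^sub>R axis i 1))"
    by (intro borel_integrable_compact continuous_on_line test_functionsD(1)[OF assms]) simp
  also have "(\<lambda>s. indicator {-L..L} s *\<^sub>R g (x + s *\<^sub>R axis i 1)) = (\<lambda>s. g (x + s *\<^sub>R axis i 1))"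
    using L(2) by (force simp: indicator_def)
  finally show ?thesis .
qed

text \<open>For \<open>S = {..0}\<close> this is the antiderivative in direction \<open>i\<close>
  that starts from minus infinity, for \<open>S = UNIV\<close> the integral over the whole line. The
  parameter lets one set of regularity lemmas serve both.\<close>

definition line_int :: "real set \<Rightarrow> 'n::finite \<Rightarrow> (real^'n \<Rightarrow> real) \<Rightarrow> real^'n \<Rightarrow> real" where
  "line_int S i g x = (LINT s|lborel. indicator S s * g (x + s *\<^sub>R axis i 1))"

text \<open>The lines through points near \<open>x0\<close> leave the support of \<open>g\<close>
  within a common distance. Near \<open>x0\<close> the unbounded integral is therefore one over a
  fixed compact interval, where differentiation under the integral sign is available.\<close>

lemma line_int_local:
  fixes g :: "real^'n::finite \<Rightarrow> real"
  assumes g: "g \<in> test_functions U" and S: "S = {..0} \<or> S = UNIV"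
  obtains c d where "c \<le> d" "S = {..0} \<Longrightarrow> d = 0"
    "\<And>x. x \<in> ball x0 1 \<Longrightarrow> line_int S i g x = integral {c..d} (\<lambda>s. g (x + s *\<^sub>R axis i 1))"
    "\<And>x j. x \<in> ball x0 1 \<Longrightarrow> line_int S i (partial_deriv j g) x = integral {c..d} (\<lambda>s. partial_deriv j g (x + s *\<^sub>R axis i 1))"
    "\<And>x. x \<in> ball x0 1 \<Longrightarrow> g (x + c *\<^sub>R axis i 1) = 0"
proof -
  obtain L where L: "0 \<le> L" "\<And>x s. x \<in> ball x0 1 \<Longrightarrow> L < \<bar>s\<bar> \<Longrightarrow> g (x + s *\<^sub>R axis i 1) = 0"
    "\<And>x s j. x \<in> ball x0 1 \<Longrightarrow> L < \<bar>s\<bar> \<Longrightarrow> partial_deriv j g (x + s *\<^sub>R axis i 1) = 0"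
    using test_line_support[OF g, of x0 i] by metis
  define d where "d = (if S = {..0} then 0 else L + 1)"
  have sub: "{- (L + 1)..d} \<subseteq> S" "\<And>s. s \<in> S \<Longrightarrow> s \<notin> {- (L + 1)..d} \<Longrightarrow> L < \<bar>s\<bar>"
    using L(1) S by (auto simp: d_def split: if_splits)
  have eq: "line_int S i h x = integral {- (L + 1)..d} (\<lambda>s. h (x + s *\<^sub>R axis i 1))"
    if h: "h \<in> test_functions U" "\<And>s. L < \<bar>s\<bar> \<Longrightarrow> h (x + s *\<^sub>R axis i 1) = 0" for h x
  proof -
    have "line_int S i h x = (LINT s:{- (L + 1)..d}|lborel. h (x + s *\<^sub>R axis i 1))"
      unfolding line_int_def set_lebesgue_integral_def
      by (intro Bochner_Integration.integral_cong refl) (use sub h(2) in \<open>force simp: indicator_def\<close>)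
    also have "\<dots> = integral {- (L + 1)..d} (\<lambda>s. h (x + s *\<^sub>R axis i 1))"
    proof (rule set_borel_integral_eq_integral)
      show "set_integrable lborel {- (L + 1)..d} (\<lambda>s. h (x + s *\<^sub>R axis i 1))"
        unfolding set_integrable_def using integrable_line[OF h(1), of x i] by (intro integrable_mult_indicator) auto
    qed
    finally show ?thesis .
  qed
  show thesis
  proof
    show "- (L + 1) \<le> d" "S = {..0} \<Longrightarrow> d = 0" using L(1) by (auto simp: d_def)
    show "g (x + (- (L + 1)) *\<^sub>R axis i 1) = 0" if "x \<in> ball x0 1" for x
      using L(1) that by (intro L) auto
    show "line_int S i g x = integral {- (L + 1)..d} (\<lambda>s. g (x + s *\<^sub>R axis i 1))" if "x \<in> ball x0 1" for x
      by (intro eq g L(2) that)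
    show "line_int S i (partial_deriv j g) x = integral {- (L + 1)..d} (\<lambda>s. partial_deriv j g (x + s *\<^sub>R axis i 1))"
      if "x \<in> ball x0 1" for x j
      by (intro eq test_partial_deriv g L(3) that)
  qed
qed

lemma
  fixes g :: "real^'n::finite \<Rightarrow> real"
  assumes g: "g \<in> test_functions U" and S: "S = {..0} \<or> S = UNIV"
  shows differentiable_line_int: "line_int S i g differentiable (at x)"
    and partial_deriv_line_int: "partial_deriv j (line_int S i g) x = line_int S i (partial_deriv j g) x"
    and partial_deriv_line_int_half: "S = {..0} \<Longrightarrow> partial_deriv i (line_int S i g) x = g x"
proof -
  have sg: "smooth g" using g by (rule test_functionsD)
  obtain c d where cd: "c \<le> d" "S = {..0} \<Longrightarrow> d = 0"
    "\<And>y. y \<in> ball x 1 \<Longrightarrow> line_int S i g y = integral {c..d} (\<lambda>s. g (y + s *\<^sub>R axis i 1))"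
    "\<And>y j. y \<in> ball x 1 \<Longrightarrow> line_int S i (partial_deriv j g) y = integral {c..d} (\<lambda>s. partial_deriv j g (y + s *\<^sub>R axis i 1))"
    "\<And>y. y \<in> ball x 1 \<Longrightarrow> g (y + c *\<^sub>R axis i 1) = 0"
    using line_int_local[OF g S, of x i] by blast
  have d: "(line_int S i g has_derivative f') (at x)"
    if "((\<lambda>x. integral {c..d} (\<lambda>s. g (x + s *\<^sub>R axis i 1))) has_derivative f') (at x)" for f'
    using that by (rule has_derivative_transform_within_open[of _ _ _ _ "ball x 1"]) (auto simp: cd(3))
  have D: "((\<lambda>x. integral {c..d} (\<lambda>s. g (x + s *\<^sub>R axis i 1))) has_derivative
      (\<lambda>h. \<Sum>j\<in>UNIV. h $ j * partial_deriv j (\<lambda>x. integral {c..d} (\<lambda>s. g (x + s *\<^sub>R axis i 1))) x)) (at x)"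
    by (intro has_derivative_partial_deriv differentiable_line_integral sg)
  from d[OF D] show "line_int S i g differentiable (at x)" using differentiable_def by blast
  have p: "partial_deriv j (line_int S i g) x = integral {c..d} (\<lambda>s. partial_deriv j g (x + s *\<^sub>R axis i 1))" for j
    using partial_deriv_eqI[OF d[OF D], of j] partial_deriv_eqI[OF D, of j]
    by (simp add: partial_deriv_line_integral[OF sg])
  \<comment> \<open>The fundamental theorem leaves the two end values: at the upper end
    \<open>d = 0\<close> it is \<open>g x\<close>, and at the lower end \<open>c\<close> the line is
    outside the support.\<close>
  then show "partial_deriv i (line_int S i g) x = g x" if "S = {..0}"
    using cd(1,2,5) that by (simp add: line_integral_partial_deriv[OF sg])
  show "partial_deriv j (line_int S i g) x = line_int S i (partial_deriv j g) x"
    using p cd(4) by simp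
qed

lemma smooth_line_int:
  assumes g: "g \<in> test_functions U" and S: "S = {..0} \<or> S = UNIV"
  shows "smooth (line_int S i g)"
proof (rule smooth_coinduct[where P = "\<lambda>f. \<exists>g\<in>test_functions U. f = line_int S i g"])
  show "f differentiable at x" if "\<exists>g\<in>test_functions U. f = line_int S i g" for f x
    using that differentiable_line_int[OF _ S] by blast
  show "\<exists>g\<in>test_functions U. partial_deriv j f = line_int S i g" if "\<exists>g\<in>test_functions U. f = line_int S i g" for f j
    using that partial_deriv_line_int[OF _ S] test_partial_deriv by blast
qed (use g in blast)

lemma line_int_shift: "line_int UNIV i g (x + t *\<^sub>R axis i 1) = line_int UNIV i g x"
  using lborel_integral_real_affine[of 1 "\<lambda>s. g (x + s *\<^sub>R axis i 1)" t]
  by (simp add: line_int_def scaleR_add_left add.assoc)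

text \<open>If the integrand is not integrable, the Bochner integral has the default value 0 and the
  bound is trivial, so it holds for every \<open>g\<close>.\<close>

lemma line_int_bound:
  "ennreal \<bar>line_int S i g x\<bar> \<le> (\<integral>\<^sup>+s. ennreal \<bar>g (x + s *\<^sub>R axis i 1)\<bar> \<partial>lborel)"
proof -
  have "ennreal \<bar>line_int S i g x\<bar> \<le> (\<integral>\<^sup>+s. ennreal (norm (indicator S s * g (x + s *\<^sub>R axis i 1))) \<partial>lborel)"
  proof (cases "integrable lborel (\<lambda>s. indicator S s * g (x + s *\<^sub>R axis i 1))")
    case True then show ?thesis using integral_norm_bound_ennreal[OF True] by (simp add: line_int_def)
  next
    case False then show ?thesis by (simp add: line_int_def not_integrable_integral_eq)
  qed
  also have "\<dots> \<le> (\<integral>\<^sup>+s. ennreal \<bar>g (x + s *\<^sub>R axis i 1)\<bar> \<partial>lborel)"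
    by (intro nn_integral_mono) (auto simp: indicator_def)
  finally show ?thesis .
qed

text \<open>Swapping the integrals and translating in \<open>x\<close> avoids a decomposition of Lebesgue measure
  into coordinates.\<close>

lemma nn_integral_box_lines:
  fixes f :: "real^'n::finite \<Rightarrow> ennreal"
  assumes f[measurable]: "f \<in> borel_measurable borel" and ab: "\<And>j. a $ j < b $ j"
  shows "(\<integral>\<^sup>+x. indicator (box a b) x * (\<integral>\<^sup>+s. f (x + s *\<^sub>R axis i 1) \<partial>lborel) \<partial>lborel)
    \<le> ennreal (b $ i - a $ i) * (\<integral>\<^sup>+x. f x \<partial>lborel)"
proof -
  let ?e = "axis i 1 :: real^'n"
  have [measurable]: "(\<lambda>p. fst p + snd p *\<^sub>R ?e) \<in> borel_measurable (lborel \<Otimes>\<^sub>M lborel)"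
    "(\<lambda>p. snd p + fst p *\<^sub>R ?e) \<in> borel_measurable (lborel \<Otimes>\<^sub>M lborel)"
    "(\<lambda>p. fst p - snd p *\<^sub>R ?e) \<in> borel_measurable (lborel \<Otimes>\<^sub>M lborel)"
    "(\<lambda>p. snd p - fst p *\<^sub>R ?e) \<in> borel_measurable (lborel \<Otimes>\<^sub>M lborel)" by measurable
  have "(\<integral>\<^sup>+x. indicator (box a b) x * (\<integral>\<^sup>+s. f (x + s *\<^sub>R ?e) \<partial>lborel) \<partial>lborel) =
      (\<integral>\<^sup>+x. \<integral>\<^sup>+s. indicator (box a b) x * f (x + s *\<^sub>R ?e) \<partial>lborel \<partial>lborel)"
    by (intro nn_integral_cong nn_integral_cmult[symmetric]) measurable
  also have "\<dots> = (\<integral>\<^sup>+s. \<integral>\<^sup>+x. indicator (box a b) x * f (x + s *\<^sub>R ?e) \<partial>lborel \<partial>lborel)"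
    by (intro lborel_pair.Fubini') measurable
  also have "\<dots> = (\<integral>\<^sup>+s. \<integral>\<^sup>+x. indicator (box a b) (x - s *\<^sub>R ?e) * f x \<partial>lborel \<partial>lborel)"
  proof (rule nn_integral_cong)
    fix s :: real
    have "(\<integral>\<^sup>+x. indicator (box a b) (x - s *\<^sub>R ?e) * f x \<partial>lborel) =
        (\<integral>\<^sup>+x. indicator (box a b) (x - s *\<^sub>R ?e) * f x \<partial>distr lborel borel ((+) (s *\<^sub>R ?e)))"
      by (simp add: lborel_distr_plus)
    also have "\<dots> = (\<integral>\<^sup>+x. indicator (box a b) x * f (x + s *\<^sub>R ?e) \<partial>lborel)"
      by (subst nn_integral_distr) (simp_all add: add.commute)
    finally show "(\<integral>\<^sup>+x. indicator (box a b) x * f (x + s *\<^sub>R ?e) \<partial>lborel) =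
        (\<integral>\<^sup>+x. indicator (box a b) (x - s *\<^sub>R ?e) * f x \<partial>lborel)" by simp
  qed
  also have "\<dots> = (\<integral>\<^sup>+x. \<integral>\<^sup>+s. indicator (box a b) (x - s *\<^sub>R ?e) * f x \<partial>lborel \<partial>lborel)"
    by (intro lborel_pair.Fubini'[symmetric]) measurable
  also have "\<dots> \<le> (\<integral>\<^sup>+x. ennreal (b $ i - a $ i) * f x \<partial>lborel)"
  proof (rule nn_integral_mono)
    fix x
    \<comment> \<open>For fixed \<open>x\<close> the shifted point lies in the box only for
      \<open>s\<close> in an interval of length \<open>b $ i - a $ i\<close>, read off from
      coordinate \<open>i\<close>.\<close>
    have "(\<integral>\<^sup>+s. indicator (box a b) (x - s *\<^sub>R ?e) * f x \<partial>lborel) \<le> (\<integral>\<^sup>+s. indicator {x $ i - b $ i..x $ i - a $ i} s * f x \<partial>lborel)"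
      by (intro nn_integral_mono mult_right_mono)
         (auto simp: indicator_def mem_box_cart axis_def dest!: spec[of _ i])
    also have "\<dots> = ennreal (b $ i - a $ i) * f x"
      using ab[of i] by (simp add: nn_integral_multc)
    finally show "(\<integral>\<^sup>+s. indicator (box a b) (x - s *\<^sub>R ?e) * f x \<partial>lborel) \<le> ennreal (b $ i - a $ i) * f x" .
  qed
  also have "\<dots> = ennreal (b $ i - a $ i) * (\<integral>\<^sup>+x. f x \<partial>lborel)" by (intro nn_integral_cmult) measurable
  finally show ?thesis .
qed

subsection \<open>Poincare inequality on a box by duality\<close>

abbreviation sqnorm :: "(real^'n::finite) set \<Rightarrow> (real^'n \<Rightarrow> 'b::real_normed_vector) \<Rightarrow> real" where
  "sqnorm U f \<equiv> (LINT x|lebesgue_on U. (norm (f x))\<^sup>2)"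

lemma test_integral_lebesgue_on:
  fixes f :: "real^'n::finite \<Rightarrow> real"
  assumes U: "U \<in> sets lebesgue" and f: "f \<in> borel_measurable borel" and 0: "\<And>x. x \<notin> U \<Longrightarrow> f x = 0"
  shows "(LINT x|lebesgue_on U. f x) = (LINT x|lborel. f x)"
proof -
  have "(LINT x|lebesgue_on U. f x) = (LINT x|lebesgue. indicator U x *\<^sub>R f x)"
    using U by (intro integral_restrict_space) auto
  also have "\<dots> = (LINT x|lebesgue. f x)"
    by (intro Bochner_Integration.integral_cong refl) (use 0 in \<open>auto simp: indicator_def\<close>)
  also have "\<dots> = (LINT x|lborel. f x)" using f by (intro integral_completion) simp
  finally show ?thesis .
qed

lemma ennreal_sqnorm_test:
  assumes U: "U \<in> sets lebesgue" and \<phi>: "\<phi> \<in> test_functions U"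
  shows "ennreal (sqnorm U \<phi>) = (\<integral>\<^sup>+x. (ennreal \<bar>\<phi> x\<bar>)\<^sup>2 \<partial>lborel)"
proof -
  have sq: "(\<lambda>x. \<phi> x * \<phi> x) \<in> test_functions U" by (intro test_mult \<phi> test_functionsD(1)[OF \<phi>])
  have "sqnorm U \<phi> = (LINT x|lborel. \<phi> x * \<phi> x)"
    using test_functionsD(2)[OF \<phi>] borel_test[OF sq]
    by (subst test_integral_lebesgue_on[OF U]) (auto simp: power2_eq_square)
  then have "ennreal (sqnorm U \<phi>) = (\<integral>\<^sup>+x. ennreal (\<phi> x * \<phi> x) \<partial>lborel)"
    using nn_integral_eq_integral[OF integrable_test_lborel[OF sq]] by simp
  also have "\<dots> = (\<integral>\<^sup>+x. (ennreal \<bar>\<phi> x\<bar>)\<^sup>2 \<partial>lborel)"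
    by (simp add: power2_eq_square ennreal_mult[symmetric])
  finally show ?thesis .
qed

text \<open>The side length enters twice: once by Cauchy-Schwarz on a line, whose intersection with
  the support of \<open>\<psi>\<close> has at most that length, and once by integrating the line
  integrals over the box.\<close>

lemma sqnorm_le_of_line_bound:
  fixes \<psi> h :: "real^'n::finite \<Rightarrow> real"
  assumes ab: "\<And>j. a $ j < b $ j" and \<psi>: "\<psi> \<in> test_functions (box a b)" and h: "h \<in> test_functions (box a b)"
    and c: "0 \<le> c"
    and le: "\<And>x. x \<in> box a b \<Longrightarrow> ennreal \<bar>h x\<bar> \<le> ennreal c * (\<integral>\<^sup>+s. ennreal \<bar>\<psi> (x + s *\<^sub>R axis i 1)\<bar> \<partial>lborel)"
  shows "sqnorm (box a b) h \<le> (c * (b $ i - a $ i))\<^sup>2 * sqnorm (box a b) \<psi>"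
proof -
  let ?e = "axis i 1 :: real^'n" and ?L = "b $ i - a $ i"
  note [measurable] = borel_test[OF \<psi>]
  have cs: "(\<integral>\<^sup>+s. ennreal \<bar>\<psi> (x + s *\<^sub>R ?e)\<bar> \<partial>lborel)\<^sup>2 \<le> ennreal ?L * (\<integral>\<^sup>+s. (ennreal \<bar>\<psi> (x + s *\<^sub>R ?e)\<bar>)\<^sup>2 \<partial>lborel)" for x
  proof -
    let ?I = "{a $ i - x $ i..b $ i - x $ i}"
    have "(\<integral>\<^sup>+s. ennreal \<bar>\<psi> (x + s *\<^sub>R ?e)\<bar> \<partial>lborel) = (\<integral>\<^sup>+s. indicator ?I s * ennreal \<bar>\<psi> (x + s *\<^sub>R ?e)\<bar> \<partial>lborel)"
    proof (rule nn_integral_cong)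
      fix s
      have "\<psi> (x + s *\<^sub>R ?e) = 0" if "s \<notin> ?I"
        using that by (intro test_functionsD(2)[OF \<psi>]) (auto simp: mem_box_cart axis_def dest!: spec[of _ i])
      then show "ennreal \<bar>\<psi> (x + s *\<^sub>R ?e)\<bar> = indicator ?I s * ennreal \<bar>\<psi> (x + s *\<^sub>R ?e)\<bar>"
        by (auto simp: indicator_def)
    qed
    also have "(\<dots>)\<^sup>2 \<le> (\<integral>\<^sup>+s. (indicator ?I s)\<^sup>2 \<partial>lborel) * (\<integral>\<^sup>+s. (ennreal \<bar>\<psi> (x + s *\<^sub>R ?e)\<bar>)\<^sup>2 \<partial>lborel)"
      by (intro Cauchy_Schwarz_nn_integral) measurable
    also have "(\<integral>\<^sup>+s. (indicator ?I s)\<^sup>2 \<partial>lborel) = (\<integral>\<^sup>+s. indicator ?I s \<partial>lborel)"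
      by (intro nn_integral_cong) (auto simp: indicator_def)
    also have "\<dots> = ennreal ?L" using ab[of i] by simp
    finally show ?thesis .
  qed
  have "ennreal (sqnorm (box a b) h) = (\<integral>\<^sup>+x. (ennreal \<bar>h x\<bar>)\<^sup>2 \<partial>lborel)"
    by (rule ennreal_sqnorm_test[OF _ h]) simp
  also have "\<dots> \<le> (\<integral>\<^sup>+x. ennreal (c\<^sup>2 * ?L) * (indicator (box a b) x * (\<integral>\<^sup>+s. (ennreal \<bar>\<psi> (x + s *\<^sub>R ?e)\<bar>)\<^sup>2 \<partial>lborel)) \<partial>lborel)"
  proof (rule nn_integral_mono)
    fix x
    show "(ennreal \<bar>h x\<bar>)\<^sup>2 \<le> ennreal (c\<^sup>2 * ?L) * (indicator (box a b) x * (\<integral>\<^sup>+s. (ennreal \<bar>\<psi> (x + s *\<^sub>R ?e)\<bar>)\<^sup>2 \<partial>lborel))"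
    proof (cases "x \<in> box a b")
      case True
      have "(ennreal \<bar>h x\<bar>)\<^sup>2 \<le> (ennreal c * (\<integral>\<^sup>+s. ennreal \<bar>\<psi> (x + s *\<^sub>R ?e)\<bar> \<partial>lborel))\<^sup>2"
        by (intro power_mono le True) simp
      also have "\<dots> = (ennreal c)\<^sup>2 * (\<integral>\<^sup>+s. ennreal \<bar>\<psi> (x + s *\<^sub>R ?e)\<bar> \<partial>lborel)\<^sup>2" by (rule power_mult_distrib)
      also have "\<dots> \<le> (ennreal c)\<^sup>2 * (ennreal ?L * (\<integral>\<^sup>+s. (ennreal \<bar>\<psi> (x + s *\<^sub>R ?e)\<bar>)\<^sup>2 \<partial>lborel))"
        by (intro mult_left_mono cs) simp
      also have "\<dots> = ennreal (c\<^sup>2 * ?L) * (\<integral>\<^sup>+s. (ennreal \<bar>\<psi> (x + s *\<^sub>R ?e)\<bar>)\<^sup>2 \<partial>lborel)"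
        using c ab[of i] by (simp add: ennreal_mult ennreal_power mult.assoc)
      finally show ?thesis using True by simp
    qed (simp add: test_functionsD(2)[OF h])
  qed
  also have "\<dots> = ennreal (c\<^sup>2 * ?L) * (\<integral>\<^sup>+x. indicator (box a b) x * (\<integral>\<^sup>+s. (ennreal \<bar>\<psi> (x + s *\<^sub>R ?e)\<bar>)\<^sup>2 \<partial>lborel) \<partial>lborel)"
    by (intro nn_integral_cmult) measurable
  also have "\<dots> \<le> ennreal (c\<^sup>2 * ?L) * (ennreal ?L * (\<integral>\<^sup>+x. (ennreal \<bar>\<psi> x\<bar>)\<^sup>2 \<partial>lborel))"
    by (intro mult_left_mono nn_integral_box_lines ab) simp_all
  also have "\<dots> = ennreal (c\<^sup>2 * ?L) * (ennreal ?L * ennreal (sqnorm (box a b) \<psi>))"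
    by (subst ennreal_sqnorm_test[OF _ \<psi>]) simp_all
  also have "\<dots> = ennreal (c\<^sup>2 * ?L * (?L * sqnorm (box a b) \<psi>))"
    using ab[of i] c by (simp only: ennreal_mult[symmetric] zero_le_power2 mult_nonneg_nonneg less_imp_le diff_ge_0_iff_ge
        Bochner_Integration.integral_nonneg)
  also have "c\<^sup>2 * ?L * (?L * sqnorm (box a b) \<psi>) = (c * ?L)\<^sup>2 * sqnorm (box a b) \<psi>"
    by (simp only: power_mult_distrib power2_eq_square[of ?L] mult_ac)
  finally show ?thesis by (subst (asm) ennreal_le_iff) simp_all
qed

text \<open>Strict positivity between \<open>l\<close> and \<open>u\<close> allows the integral to
  be normalised to 1, and later shows that the product of the profiles has a nonzero
  integral.\<close>

lemma bump_profile:
  fixes l u :: real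
  assumes "l < u"
  obtains \<eta> B where "\<And>i::'n::finite. smooth (\<lambda>x::real^'n. \<eta> (x $ i))" "\<And>y. 0 \<le> \<eta> y" "\<And>y. \<eta> y \<le> B"
    "\<And>y. y \<notin> {l..u} \<Longrightarrow> \<eta> y = 0" "integrable lborel \<eta>" "(LINT y|lborel. \<eta> y) = 1" "\<And>y. l < y \<Longrightarrow> y < u \<Longrightarrow> 0 < \<eta> y"
proof -
  define g where "g y = flat 1 (y - l) * flat 1 (u - y)" for y
  define Z where "Z = (LINT y|lborel. g y)"
  have sm: "smooth (\<lambda>x::real^'n. g (x $ i))" for i
    using smooth_mult[OF smooth_flat_coord[of 1 i "- l"] smooth_flat_coord[of "-1" i u]] by (simp add: g_def)
  have cont: "continuous_on S g" for S
  proof -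
    have "continuous_on UNIV (flat 1)" by (simp add: continuous_at_imp_continuous_on isCont_flat)
    then have "continuous_on S (\<lambda>y. flat 1 (y - l))" "continuous_on S (\<lambda>y. flat 1 (u - y))"
      by (rule continuous_on_compose2; auto intro!: continuous_intros)+
    then show ?thesis unfolding g_def by (rule continuous_on_mult)
  qed
  have g: "0 \<le> g y" "g y \<le> 1" "y \<notin> {l..u} \<Longrightarrow> g y = 0" "l < y \<Longrightarrow> y < u \<Longrightarrow> 0 < g y" for y
    using flat_bounds(4)[of "y - l"] flat_bounds(4)[of "u - y"] by (auto simp: g_def flat_bounds mult_le_one)
  have "integrable lborel (\<lambda>y. indicator {l..u} y *\<^sub>R g y)" by (intro borel_integrable_compact cont) simp
  also have "(\<lambda>y. indicator {l..u} y *\<^sub>R g y) = g" using g(3) by (force simp: indicator_def)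
  finally have int: "integrable lborel g" .
  have "Z \<noteq> 0"
  proof
    assume "Z = 0"
    then have "AE y in lborel. g y = 0"
      unfolding Z_def using integral_nonneg_eq_0_iff_AE[OF int] g by simp
    then have "AE y in lborel. y \<notin> {l<..<u}" by eventually_elim (use g(4) in force)
    then have "emeasure lborel {l<..<u} = 0" by (subst (asm) AE_iff_measurable[of "{l<..<u}"]) auto
    then show False using assms by simp
  qed
  moreover have "0 \<le> Z" unfolding Z_def using g by (intro Bochner_Integration.integral_nonneg) auto
  ultimately have Z: "0 < Z" by simp
  show thesis
  proof (rule that[of "\<lambda>y. g y / Z" "1 / Z"])
    show "smooth (\<lambda>x::real^'n. g (x $ i) / Z)" for i
      using smooth_mult[OF smooth_const[of "1 / Z"] sm] by simp
    show "(LINT y|lborel. g y / Z) = 1" using Z by (simp add: Z_def)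
  qed (use g Z int in \<open>auto simp: divide_right_mono\<close>)
qed

text \<open>Since \<open>\<eta>\<close> has mass 1, the averaged function has the same integral as
  \<open>\<psi>\<close> over every line in direction \<open>i\<close>. The difference thus has total
  0 on each line, so its antiderivative vanishes again beyond the support and is a test function;
  this is the potential \<open>\<phi>\<close>.\<close>

lemma averaging_step:
  fixes a b :: "real^'n::finite"
  assumes ab: "\<And>j. a $ j < b $ j"
    and \<eta>: "smooth (\<lambda>x::real^'n. \<eta> (x $ i))" "\<And>y. 0 \<le> \<eta> y" "\<And>y. \<eta> y \<le> B"
      "\<And>y. y \<notin> {l..u} \<Longrightarrow> \<eta> y = 0" "integrable lborel \<eta>" "(LINT y|lborel. \<eta> y) = 1"
    and lu: "a $ i < l" "u < b $ i" "l < u"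
    and \<psi>: "\<psi> \<in> test_functions (box a b)"
  shows "(\<lambda>x. \<eta> (x $ i) * line_int UNIV i \<psi> x) \<in> test_functions (box a b)" (is "?E \<in> _")
    and "\<exists>\<phi>\<in>test_functions (box a b). (\<forall>x. partial_deriv i \<phi> x = \<psi> x - \<eta> (x $ i) * line_int UNIV i \<psi> x) \<and>
       sqnorm (box a b) \<phi> \<le> (2 * (b $ i - a $ i))\<^sup>2 * sqnorm (box a b) \<psi>"
    and "sqnorm (box a b) (\<lambda>x. \<eta> (x $ i) * line_int UNIV i \<psi> x) \<le> (B * (b $ i - a $ i))\<^sup>2 * sqnorm (box a b) \<psi>"
proof -
  let ?e = "axis i 1 :: real^'n"
  let ?J = "line_int UNIV i \<psi>"
  have B0: "0 \<le> B" using \<eta>(2,3) order_trans by blast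
  from \<psi> obtain K where K: "compact K" "K \<subseteq> box a b" "\<And>x. x \<notin> K \<Longrightarrow> \<psi> x = 0" by (rule test_functionsE) blast
  obtain c0 d0 where cd0: "\<And>j. a $ j < c0 $ j" "\<And>j. d0 $ j < b $ j" "K \<subseteq> cbox c0 d0"
    using compact_subset_box[OF ab K(1,2)] by metis
  \<comment> \<open>The box around the support is enlarged in direction \<open>i\<close> to contain
    \<open>{l..u}\<close>, because averaging spreads the support over that of
    \<open>\<eta>\<close>.\<close>
  define c where "c = (\<chi> j. if j = i then min l (c0 $ i) else c0 $ j)"
  define d where "d = (\<chi> j. if j = i then max u (d0 $ i) else d0 $ j)"
  have sub: "cbox c d \<subseteq> box a b"
    by (rule cbox_subset_box) (use cd0 lu in \<open>auto simp: c_def d_def\<close>)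
  have \<psi>0: "\<psi> x = 0" if "x \<notin> cbox c d" for x
  proof -
    have "cbox c0 d0 \<subseteq> cbox c d"
      by (auto simp: mem_box_cart c_def d_def min_le_iff_disj le_max_iff_disj)
    then show ?thesis using that cd0(3) K(3) by blast
  qed
  have coord: "(x + s *\<^sub>R ?e) $ j = (if j = i then x $ i + s else x $ j)" for x s j
    by (auto simp: axis_def)
  have off: "x + s *\<^sub>R ?e \<notin> cbox c d" if "j \<noteq> i" "x $ j \<notin> {c $ j..d $ j}" for x s j
  proof
    assume "x + s *\<^sub>R ?e \<in> cbox c d"
    then have "(x + s *\<^sub>R ?e) $ j \<in> {c $ j..d $ j}" by (simp add: mem_box_cart del: vector_add_component)
    then show False using that by (auto simp: axis_def)
  qed
  have J0: "?J x = 0" if "j \<noteq> i" "x $ j \<notin> {c $ j..d $ j}" for x j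
    unfolding line_int_def using \<psi>0[OF off[OF that]] by simp
  have E0: "?E x = 0" if x: "x \<notin> cbox c d" for x
  proof -
    obtain j where j: "x $ j \<notin> {c $ j..d $ j}" using x by (auto simp: mem_box_cart)
    show ?thesis
    proof (cases "j = i")
      case True
      then have "x $ i \<notin> {l..u}" using j by (auto simp: c_def d_def)
      then show ?thesis using \<eta>(4) by simp
    qed (use J0[OF _ j] in simp)
  qed
  show E: "?E \<in> test_functions (box a b)"
    by (rule test_functionsI[OF smooth_mult[OF \<eta>(1) smooth_line_int[OF \<psi>]] compact_cbox sub E0]) auto
  have JA: "ennreal \<bar>?J x\<bar> \<le> (\<integral>\<^sup>+s. ennreal \<bar>\<psi> (x + s *\<^sub>R ?e)\<bar> \<partial>lborel)" for x by (rule line_int_bound)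
  show "sqnorm (box a b) ?E \<le> (B * (b $ i - a $ i))\<^sup>2 * sqnorm (box a b) \<psi>"
  proof (rule sqnorm_le_of_line_bound[OF ab \<psi> E B0])
    fix x
    have "ennreal \<bar>?E x\<bar> \<le> ennreal (B * \<bar>?J x\<bar>)"
      using \<eta>(2,3) by (intro ennreal_leI) (auto simp: abs_mult intro!: mult_right_mono)
    also have "\<dots> = ennreal B * ennreal \<bar>?J x\<bar>" using B0 by (simp add: ennreal_mult)
    also have "\<dots> \<le> ennreal B * (\<integral>\<^sup>+s. ennreal \<bar>\<psi> (x + s *\<^sub>R ?e)\<bar> \<partial>lborel)" by (intro mult_left_mono JA) simp
    finally show "ennreal \<bar>?E x\<bar> \<le> ennreal B * (\<integral>\<^sup>+s. ennreal \<bar>\<psi> (x + s *\<^sub>R ?e)\<bar> \<partial>lborel)" .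
  qed
  define g where "g x = \<psi> x - ?E x" for x
  have g: "g \<in> test_functions (box a b)" unfolding g_def[abs_def] by (intro test_diff \<psi> E)
  have g0: "g x = 0" if "x \<notin> cbox c d" for x using that \<psi>0 E0 by (simp add: g_def)
  define \<phi> where "\<phi> = line_int {..0} i g"
  have \<eta>shift: "(\<integral>\<^sup>+s. ennreal (\<eta> (x $ i + s)) \<partial>lborel) = 1" "(LINT s|lborel. \<eta> (x $ i + s)) = 1"
     "integrable lborel (\<lambda>s. \<eta> (x $ i + s))" for x :: "real^'n"
  proof -
    show 1: "integrable lborel (\<lambda>s. \<eta> (x $ i + s))"
      using lborel_integrable_real_affine[OF \<eta>(5), of 1 "x $ i"] by simp
    show 2: "(LINT s|lborel. \<eta> (x $ i + s)) = 1"
      using lborel_integral_real_affine[of 1 \<eta> "x $ i"] \<eta>(6) by simp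
    show "(\<integral>\<^sup>+s. ennreal (\<eta> (x $ i + s)) \<partial>lborel) = 1"
      using nn_integral_eq_integral[OF 1] \<eta>(2) 2 by simp
  qed
  have Eline: "?E (x + s *\<^sub>R ?e) = \<eta> (x $ i + s) * ?J x" for x s
    by (simp add: line_int_shift coord)
  have tot: "line_int UNIV i g x = 0" for x
  proof -
    have "line_int UNIV i g x = (LINT s|lborel. \<psi> (x + s *\<^sub>R ?e) - \<eta> (x $ i + s) * ?J x)"
      by (simp add: line_int_def[of UNIV i g] g_def Eline[unfolded coord] line_int_shift coord)
    also have "\<dots> = ?J x - 1 * ?J x"
      using integrable_line[OF \<psi>, of x i] \<eta>shift(2,3)[of x]
      by (subst Bochner_Integration.integral_diff) (auto simp: line_int_def)
    finally show ?thesis by simp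
  qed
  \<comment> \<open>For \<open>x\<close> outside the box, the half line of integration can meet the
    support only when \<open>x\<close> lies beyond the upper face in direction \<open>i\<close>;
    then it picks up the integral over the whole line, which is 0 by \<open>tot\<close>.\<close>
  have \<phi>0: "\<phi> x = 0" if x: "x \<notin> cbox c d" for x
  proof -
    obtain j where j: "x $ j \<notin> {c $ j..d $ j}" using x by (auto simp: mem_box_cart)
    show ?thesis
    proof (cases "j = i \<and> d $ i < x $ i")
      case True
      have "g (x + s *\<^sub>R ?e) = 0" if "0 < s" for s
      proof (rule g0, rule notI)
        assume "x + s *\<^sub>R ?e \<in> cbox c d"
        then have "(x + s *\<^sub>R ?e) $ i \<in> {c $ i..d $ i}" by (simp add: mem_box_cart del: vector_add_component)
        then show False using that True by (auto simp: axis_def)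
      qed
      then have "\<phi> x = line_int UNIV i g x"
        unfolding \<phi>_def line_int_def by (intro Bochner_Integration.integral_cong) (auto simp: indicator_def not_le)
      then show ?thesis by (simp add: tot)
    next
      case False
      have "g (x + s *\<^sub>R ?e) = 0" if "s \<le> 0" for s
      proof (rule g0, rule notI)
        assume "x + s *\<^sub>R ?e \<in> cbox c d"
        then have "(x + s *\<^sub>R ?e) $ j \<in> {c $ j..d $ j}" by (simp add: mem_box_cart del: vector_add_component)
        then show False using that j False by (auto simp: axis_def split: if_splits)
      qed
      then have "(\<lambda>s. indicator {..0} s * g (x + s *\<^sub>R ?e)) = (\<lambda>s. 0)" by (auto simp: indicator_def)
      then show ?thesis unfolding \<phi>_def line_int_def by (simp only: Bochner_Integration.integral_zero)
    qed
  qed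
  have \<phi>: "\<phi> \<in> test_functions (box a b)"
    by (rule test_functionsI[OF _ compact_cbox sub \<phi>0]) (auto simp: \<phi>_def intro!: smooth_line_int[OF g])
  moreover have "partial_deriv i \<phi> x = g x" for x
    unfolding \<phi>_def by (rule partial_deriv_line_int_half[OF g]) auto
  \<comment> \<open>The 2 counts \<open>\<psi>\<close> and its average: along a line, each has an
    absolute integral of at most \<open>?A\<close>, the second one because \<open>\<eta>\<close> has
    mass 1.\<close>
  moreover have "sqnorm (box a b) \<phi> \<le> (2 * (b $ i - a $ i))\<^sup>2 * sqnorm (box a b) \<psi>"
  proof (rule sqnorm_le_of_line_bound[OF ab \<psi> \<phi>])
    fix x
    let ?A = "\<integral>\<^sup>+s. ennreal \<bar>\<psi> (x + s *\<^sub>R ?e)\<bar> \<partial>lborel"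
    note [measurable] = borel_test[OF \<psi>] borel_measurable_integrable[OF \<eta>shift(3)[of x]]
    have "ennreal \<bar>\<phi> x\<bar> \<le> (\<integral>\<^sup>+s. ennreal \<bar>g (x + s *\<^sub>R ?e)\<bar> \<partial>lborel)" unfolding \<phi>_def by (rule line_int_bound)
    also have "\<dots> \<le> (\<integral>\<^sup>+s. ennreal \<bar>\<psi> (x + s *\<^sub>R ?e)\<bar> + ennreal (\<eta> (x $ i + s)) * ennreal \<bar>?J x\<bar> \<partial>lborel)"
    proof (rule nn_integral_mono)
      fix s
      have "\<bar>g (x + s *\<^sub>R ?e)\<bar> \<le> \<bar>\<psi> (x + s *\<^sub>R ?e)\<bar> + \<eta> (x $ i + s) * \<bar>?J x\<bar>"
        unfolding g_def Eline using \<eta>(2)[of "x $ i + s"]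
        by (intro order_trans[OF abs_triangle_ineq4]) (simp add: abs_mult)
      then show "ennreal \<bar>g (x + s *\<^sub>R ?e)\<bar> \<le> ennreal \<bar>\<psi> (x + s *\<^sub>R ?e)\<bar> + ennreal (\<eta> (x $ i + s)) * ennreal \<bar>?J x\<bar>"
        using \<eta>(2) by (simp add: ennreal_mult[symmetric] ennreal_plus[symmetric] ennreal_leI del: ennreal_plus)
    qed
    also have "\<dots> = ?A + 1 * ennreal \<bar>?J x\<bar>"
      by (simp add: nn_integral_add nn_integral_multc \<eta>shift(1))
    also have "\<dots> \<le> ?A + ?A" using JA[of x] by (simp add: add_left_mono)
    also have "\<dots> = ennreal 2 * ?A" by (simp add: mult_2)
    finally show "ennreal \<bar>\<phi> x\<bar> \<le> ennreal 2 * ?A" .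
  qed simp
  ultimately show "\<exists>\<phi>\<in>test_functions (box a b). (\<forall>x. partial_deriv i \<phi> x = \<psi> x - ?E x) \<and>
       sqnorm (box a b) \<phi> \<le> (2 * (b $ i - a $ i))\<^sup>2 * sqnorm (box a b) \<psi>"
    by (auto simp: g_def)
qed

definition in_L2 :: "'a measure \<Rightarrow> ('a \<Rightarrow> 'b::{real_normed_vector,second_countable_topology}) \<Rightarrow> bool" where
  "in_L2 M f \<longleftrightarrow> f \<in> borel_measurable M \<and> integrable M (\<lambda>x. (norm (f x))\<^sup>2)"

lemma L2_Cauchy_Schwarz:
  fixes f g :: "'a \<Rightarrow> real"
  assumes f: "in_L2 M f" and g: "in_L2 M g"
  shows "\<bar>LINT x|M. f x * g x\<bar> \<le> sqrt (LINT x|M. (norm (f x))\<^sup>2) * sqrt (LINT x|M. (norm (g x))\<^sup>2)"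
proof -
  have [measurable]: "f \<in> borel_measurable M" "g \<in> borel_measurable M" using f g by (auto simp: in_L2_def)
  let ?F = "LINT x|M. (norm (f x))\<^sup>2" and ?G = "LINT x|M. (norm (g x))\<^sup>2"
  have sq: "(\<integral>\<^sup>+x. (ennreal \<bar>h x\<bar>)\<^sup>2 \<partial>M) = ennreal (LINT x|M. (norm (h x))\<^sup>2)" if "in_L2 M h" for h :: "'a \<Rightarrow> real"
    using that by (subst nn_integral_eq_integral[symmetric]) (auto simp: in_L2_def ennreal_power)
  have "ennreal \<bar>LINT x|M. f x * g x\<bar> \<le> (\<integral>\<^sup>+x. ennreal \<bar>f x * g x\<bar> \<partial>M)"
  proof (cases "integrable M (\<lambda>x. f x * g x)")
    case True then show ?thesis using integral_norm_bound_ennreal[OF True] by simp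
  next
    case False then show ?thesis by (simp add: not_integrable_integral_eq)
  qed
  also have "\<dots> = (\<integral>\<^sup>+x. ennreal \<bar>f x\<bar> * ennreal \<bar>g x\<bar> \<partial>M)" by (simp add: abs_mult ennreal_mult)
  finally have "(ennreal \<bar>LINT x|M. f x * g x\<bar>)\<^sup>2 \<le> (\<integral>\<^sup>+x. ennreal \<bar>f x\<bar> * ennreal \<bar>g x\<bar> \<partial>M)\<^sup>2"
    by (rule power_mono) simp
  also have "\<dots> \<le> (\<integral>\<^sup>+x. (ennreal \<bar>f x\<bar>)\<^sup>2 \<partial>M) * (\<integral>\<^sup>+x. (ennreal \<bar>g x\<bar>)\<^sup>2 \<partial>M)"
    by (rule Cauchy_Schwarz_nn_integral) measurable
  also have "\<dots> = ennreal (?F * ?G)" by (simp only: sq[OF f] sq[OF g] ennreal_mult Bochner_Integration.integral_nonneg zero_le_power2)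
  finally have "ennreal (\<bar>LINT x|M. f x * g x\<bar>\<^sup>2) \<le> ennreal (?F * ?G)" by (simp add: ennreal_power del: power2_abs)
  then have "\<bar>LINT x|M. f x * g x\<bar>\<^sup>2 \<le> ?F * ?G" by (subst (asm) ennreal_le_iff) simp_all
  then have "\<bar>LINT x|M. f x * g x\<bar> \<le> sqrt (?F * ?G)" by (rule real_le_rsqrt)
  then show ?thesis by (simp only: real_sqrt_mult)
qed

lemma in_L2_test:
  assumes U: "U \<in> sets lebesgue" and \<phi>: "\<phi> \<in> test_functions U" shows "in_L2 (lebesgue_on U) \<phi>"
proof -
  have sq: "(\<lambda>x. \<phi> x * \<phi> x) \<in> test_functions U" by (intro test_mult \<phi> test_functionsD(1)[OF \<phi>])
  have "integrable lebesgue (\<lambda>x. \<phi> x * \<phi> x)"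
    using integrable_test_lborel[OF sq] borel_test[OF sq]
    by (subst integrable_completion) simp_all
  then have "integrable lebesgue (\<lambda>x. indicator U x *\<^sub>R (\<phi> x * \<phi> x))"
    by (rule integrable_mult_indicator[OF U])
  then have "integrable (lebesgue_on U) (\<lambda>x. \<phi> x * \<phi> x)"
    using U by (subst integrable_restrict_space) auto
  then show ?thesis using test_measurable[OF \<phi> U] by (simp add: in_L2_def power2_eq_square)
qed

lemma in_L2_I_bound:
  assumes f: "f \<in> borel_measurable M" and h: "integrable M h" and le: "\<And>x. (norm (f x))\<^sup>2 \<le> h x"
  shows "in_L2 M f"
proof -
  note [measurable] = f
  have "integrable M (\<lambda>x. (norm (f x))\<^sup>2)"
  proof (rule Bochner_Integration.integrable_bound[OF h])
    show "AE x in M. norm ((norm (f x))\<^sup>2) \<le> norm (h x)"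
      using le by (intro AE_I2) (metis abs_ge_self abs_of_nonneg order_trans real_norm_def zero_le_power2)
  qed measurable
  with f show ?thesis by (simp add: in_L2_def)
qed

lemma in_L2_add:
  assumes f: "in_L2 M f" and g: "in_L2 M g"
  shows "in_L2 M (\<lambda>x. f x + g x)"
proof -
  have [measurable]: "f \<in> borel_measurable M" "g \<in> borel_measurable M" using f g by (auto simp: in_L2_def)
  have "(norm (f x + g x))\<^sup>2 \<le> 2 * (norm (f x))\<^sup>2 + 2 * (norm (g x))\<^sup>2" for x
  proof -
    have "(norm (f x + g x))\<^sup>2 \<le> (norm (f x) + norm (g x))\<^sup>2" by (intro power_mono norm_triangle_ineq) simp
    also have "\<dots> \<le> 2 * (norm (f x))\<^sup>2 + 2 * (norm (g x))\<^sup>2"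
      using zero_le_power2[of "norm (f x) - norm (g x)"] by (simp add: power2_sum power2_diff)
    finally show ?thesis .
  qed
  moreover have "integrable M (\<lambda>x. 2 * (norm (f x))\<^sup>2 + 2 * (norm (g x))\<^sup>2)"
    using f g by (intro Bochner_Integration.integrable_add integrable_mult_right) (simp_all add: in_L2_def)
  ultimately show ?thesis by (intro in_L2_I_bound) measurable
qed

lemma in_L2_scaleR: "in_L2 M f \<Longrightarrow> in_L2 M (\<lambda>x. c *\<^sub>R f x)"
  by (auto simp: in_L2_def power_mult_distrib)

lemma in_L2_integrable_mult:
  fixes f g :: "'a \<Rightarrow> real"
  assumes f: "in_L2 M f" and g: "in_L2 M g"
  shows "integrable M (\<lambda>x. f x * g x)"
proof -
  have [measurable]: "f \<in> borel_measurable M" "g \<in> borel_measurable M" using f g by (auto simp: in_L2_def)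
  have "\<bar>f x * g x\<bar> \<le> (norm (f x))\<^sup>2 + (norm (g x))\<^sup>2" for x
  proof -
    have "0 \<le> (\<bar>f x\<bar> - \<bar>g x\<bar>)\<^sup>2" by simp
    then have "2 * (\<bar>f x\<bar> * \<bar>g x\<bar>) \<le> (norm (f x))\<^sup>2 + (norm (g x))\<^sup>2" by (simp add: power2_diff)
    moreover have "0 \<le> \<bar>f x\<bar> * \<bar>g x\<bar>" by simp
    ultimately show ?thesis by (simp only: abs_mult)
  qed
  then have le: "AE x in M. norm (f x * g x) \<le> norm ((norm (f x))\<^sup>2 + (norm (g x))\<^sup>2)" by simp
  have int: "integrable M (\<lambda>x. (norm (f x))\<^sup>2 + (norm (g x))\<^sup>2)"
    using f g by (intro Bochner_Integration.integrable_add) (simp_all add: in_L2_def)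
  show ?thesis by (rule Bochner_Integration.integrable_bound[OF int _ le]) measurable
qed

text \<open>Averaging in the directions of \<open>J\<close> against the profiles \<open>\<eta> j\<close> changes a test function by a
  divergence whose potentials are controlled in \<open>L\<^sup>2\<close>.\<close>

lemma averaging:
  fixes a b :: "real^'n::finite" and \<eta> :: "'n \<Rightarrow> real \<Rightarrow> real"
  assumes ab: "\<And>j. a $ j < b $ j"
    and \<eta>: "\<And>j. smooth (\<lambda>x::real^'n. \<eta> j (x $ j))" "\<And>j y. 0 \<le> \<eta> j y" "\<And>j y. \<eta> j y \<le> B j"
      "\<And>j y. y \<notin> {l j..u j} \<Longrightarrow> \<eta> j y = 0" "\<And>j. integrable lborel (\<eta> j)" "\<And>j. (LINT y|lborel. \<eta> j y) = 1"
    and lu: "\<And>j. a $ j < l j" "\<And>j. u j < b $ j" "\<And>j. l j < u j"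
    and J: "finite (J::'n set)"
  shows "\<exists>C\<ge>0. \<forall>\<psi>\<in>test_functions (box a b). \<exists>\<psi>'\<in>test_functions (box a b). \<exists>r \<Phi>.
     (\<forall>x. \<psi>' x = (\<Prod>j\<in>J. \<eta> j (x $ j)) * r x) \<and> (\<forall>j\<in>J. \<forall>x s. r (x + s *\<^sub>R axis j 1) = r x) \<and>
     sqnorm (box a b) \<psi>' \<le> C * sqnorm (box a b) \<psi> \<and>
     (\<forall>j\<in>J. \<Phi> j \<in> test_functions (box a b) \<and> sqnorm (box a b) (\<Phi> j) \<le> C * sqnorm (box a b) \<psi>) \<and>
     (\<forall>x. \<psi> x - \<psi>' x = (\<Sum>j\<in>J. partial_deriv j (\<Phi> j) x))"
  using J
proof (induction J)
  case empty
  show ?case by (intro exI[of _ 1]) auto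
next
  case (insert i J)
  let ?T = "test_functions (box a b)" and ?N = "sqnorm (box a b) :: (real^'n \<Rightarrow> real) \<Rightarrow> real"
  obtain C where C: "0 \<le> C" and IH: "\<And>\<psi>. \<psi> \<in> ?T \<Longrightarrow> \<exists>\<psi>'\<in>?T. \<exists>r \<Phi>.
     (\<forall>x. \<psi>' x = (\<Prod>j\<in>J. \<eta> j (x $ j)) * r x) \<and> (\<forall>j\<in>J. \<forall>x s. r (x + s *\<^sub>R axis j 1) = r x) \<and>
     ?N \<psi>' \<le> C * ?N \<psi> \<and>
     (\<forall>j\<in>J. \<Phi> j \<in> ?T \<and> ?N (\<Phi> j) \<le> C * ?N \<psi>) \<and>
     (\<forall>x. \<psi> x - \<psi>' x = (\<Sum>j\<in>J. partial_deriv j (\<Phi> j) x))"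
    using insert.IH by blast
  define A1 A2 where "A1 = (B i * (b $ i - a $ i))\<^sup>2" and "A2 = (2 * (b $ i - a $ i))\<^sup>2"
  \<comment> \<open>One constant for three bounds: \<open>C\<close> for the old potentials,
    \<open>A1 * C\<close> for the new average and \<open>A2 * C\<close> for the new potential, the
    last two passing through the bound for the previous average \<open>\<psi>'\<close>.\<close>
  define C' where "C' = C + A1 * C + A2 * C"
  have A: "0 \<le> A1" "0 \<le> A2" by (auto simp: A1_def A2_def)
  have C': "0 \<le> C'" "C \<le> C'" "A1 * C \<le> C'" "A2 * C \<le> C'" using C A by (auto simp: C'_def)
  show ?case
  proof (intro exI[of _ C'] conjI C' ballI)
    fix \<psi> assume \<psi>: "\<psi> \<in> ?T"
    have N0: "0 \<le> ?N \<psi>" by simp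
    have up: "y \<le> C' * ?N \<psi>" if "y \<le> D * ?N \<psi>" "D \<le> C'" for y D
      using that N0 by (meson mult_right_mono order_trans)
    obtain \<psi>' r \<Phi> where \<psi>': "\<psi>' \<in> ?T" "\<And>x. \<psi>' x = (\<Prod>j\<in>J. \<eta> j (x $ j)) * r x" "\<And>j x s. j \<in> J \<Longrightarrow> r (x + s *\<^sub>R axis j 1) = r x"
     "?N \<psi>' \<le> C * ?N \<psi>" "\<And>j. j \<in> J \<Longrightarrow> \<Phi> j \<in> ?T \<and> ?N (\<Phi> j) \<le> C * ?N \<psi>"
     "\<And>x. \<psi> x - \<psi>' x = (\<Sum>j\<in>J. partial_deriv j (\<Phi> j) x)"
      using IH[OF \<psi>] by blast
    note step = averaging_step[OF ab, of "\<eta> i" i "B i" "l i" "u i" \<psi>', OF \<eta>(1,2,3,4,5,6) lu \<psi>'(1)]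
    define \<psi>'' where "\<psi>'' x = \<eta> i (x $ i) * line_int UNIV i \<psi>' x" for x
    obtain \<phi> where \<phi>: "\<phi> \<in> ?T" "\<And>x. partial_deriv i \<phi> x = \<psi>' x - \<psi>'' x" "?N \<phi> \<le> A2 * ?N \<psi>'"
      using step(2) unfolding \<psi>''_def A2_def by blast
    have \<psi>'': "\<psi>'' \<in> ?T" "?N \<psi>'' \<le> A1 * ?N \<psi>'"
      using step(1,3) unfolding \<psi>''_def[abs_def] A1_def by auto
    \<comment> \<open>The profiles of the directions in \<open>J\<close> do not involve coordinate
      \<open>i\<close>, so integrating \<open>\<psi>'\<close> along direction \<open>i\<close>
      integrates only \<open>r\<close>. Invariance of \<open>r\<close> in the earlier directions
      survives because translations commute.\<close>
    define r' where "r' = line_int UNIV i r"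
    have rep: "\<psi>'' x = (\<Prod>j\<in>insert i J. \<eta> j (x $ j)) * r' x" for x
    proof -
      have "(\<Prod>j\<in>J. \<eta> j ((x + s *\<^sub>R axis i 1) $ j)) = (\<Prod>j\<in>J. \<eta> j (x $ j))" for s
        using insert.hyps by (intro prod.cong) (auto simp: axis_def)
      then have "line_int UNIV i \<psi>' x = (\<Prod>j\<in>J. \<eta> j (x $ j)) * r' x"
        by (simp add: line_int_def r'_def \<psi>'(2) del: vector_add_component)
      then show ?thesis using insert.hyps by (simp add: \<psi>''_def)
    qed
    have inv: "r' (x + s *\<^sub>R axis j 1) = r' x" if "j \<in> insert i J" for j x s
    proof (cases "j = i")
      case True then show ?thesis by (simp add: r'_def line_int_shift)
    next
      case False
      then have "r (x + s *\<^sub>R axis j 1 + t *\<^sub>R axis i 1) = r (x + t *\<^sub>R axis i 1)" for t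
        using \<psi>'(3)[of j "x + t *\<^sub>R axis i 1" s] that by (simp add: add_ac)
      then show ?thesis by (simp add: r'_def line_int_def)
    qed
    show "\<exists>\<psi>'\<in>?T. \<exists>r \<Phi>. (\<forall>x. \<psi>' x = (\<Prod>j\<in>insert i J. \<eta> j (x $ j)) * r x) \<and>
     (\<forall>j\<in>insert i J. \<forall>x s. r (x + s *\<^sub>R axis j 1) = r x) \<and>
     ?N \<psi>' \<le> C' * ?N \<psi> \<and>
     (\<forall>j\<in>insert i J. \<Phi> j \<in> ?T \<and> ?N (\<Phi> j) \<le> C' * ?N \<psi>) \<and>
     (\<forall>x. \<psi> x - \<psi>' x = (\<Sum>j\<in>insert i J. partial_deriv j (\<Phi> j) x))"
    proof (intro bexI[OF _ \<psi>''(1)] exI[of _ r'] exI[of _ "\<Phi>(i := \<phi>)"] conjI allI ballI rep inv)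
      have "?N \<psi>'' \<le> A1 * (C * ?N \<psi>)" using \<psi>''(2) \<psi>'(4) A by (meson mult_left_mono order_trans)
      then show "?N \<psi>'' \<le> C' * ?N \<psi>" using up[of _ "A1 * C"] C' by (simp add: mult.assoc)
      have "?N \<phi> \<le> A2 * (C * ?N \<psi>)" using \<phi>(3) \<psi>'(4) A by (meson mult_left_mono order_trans)
      then have "?N \<phi> \<le> C' * ?N \<psi>" using up[of _ "A2 * C"] C' by (simp add: mult.assoc)
      then show "?N ((\<Phi>(i := \<phi>)) j) \<le> C' * ?N \<psi>" if "j \<in> insert i J" for j
        using that \<psi>'(5)[of j] up[of _ C] C' by auto
      show "(\<Phi>(i := \<phi>)) j \<in> ?T" if "j \<in> insert i J" for j using that \<psi>'(5)[of j] \<phi>(1) by auto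
      show "\<psi> x - \<psi>'' x = (\<Sum>j\<in>insert i J. partial_deriv j ((\<Phi>(i := \<phi>)) j) x)" for x
      proof -
        have "(\<Sum>j\<in>J. partial_deriv j ((\<Phi>(i := \<phi>)) j) x) = (\<Sum>j\<in>J. partial_deriv j (\<Phi> j) x)"
          using insert.hyps by (intro sum.cong) auto
        then show ?thesis using insert.hyps \<psi>'(6)[of x] \<phi>(2)[of x] by simp
      qed
    qed auto
  qed
qed

text \<open>Walk from 0 to \<open>x\<close> along the axes, one coordinate at a time.\<close>

lemma invariant_const:
  fixes r :: "real^'n::finite \<Rightarrow> real"
  assumes "\<And>j x s. r (x + s *\<^sub>R axis j 1) = r x"
  shows "r x = r 0"
proof -
  have "r (y + (\<Sum>j\<in>J. x $ j *\<^sub>R axis j 1)) = r y" if "finite J" for J and y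
    using that by (induction J arbitrary: y) (auto simp: assms add.assoc[symmetric])
  from this[of UNIV 0] show ?thesis
    using basis_expansion[of x] by (simp add: scalar_mult_eq_scaleR)
qed

text \<open>The weight \<open>\<eta>\<close> is returned to the caller so that the means of all
  derivatives of \<open>v\<close> can be rewritten as integrals of \<open>v\<close> against
  derivatives of \<open>\<eta>\<close>. Its nonzero integral supplies the diagonal of the system
  that determines the polynomial.\<close>

theorem poincare_box:
  fixes a b :: "real^'n::finite"
  assumes ab: "\<And>j. a $ j < b $ j"
  obtains \<eta> :: "real^'n \<Rightarrow> real" and C where "\<eta> \<in> test_functions (box a b)" "(LINT x|lebesgue_on (box a b). \<eta> x) \<noteq> 0" "0 \<le> C"
    "\<And>u g. in_L2 (lebesgue_on (box a b)) u \<Longrightarrow> (\<And>j. in_L2 (lebesgue_on (box a b)) (g j)) \<Longrightarrow>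
       (\<And>j \<phi>. \<phi> \<in> test_functions (box a b) \<Longrightarrow>
         (LINT x|lebesgue_on (box a b). partial_deriv j \<phi> x * u x) = - (LINT x|lebesgue_on (box a b). \<phi> x * g j x)) \<Longrightarrow>
       (LINT x|lebesgue_on (box a b). \<eta> x * u x) = 0 \<Longrightarrow>
       sqnorm (box a b) u \<le> C * (\<Sum>j\<in>UNIV. sqnorm (box a b) (g j :: real^'n \<Rightarrow> real))"
proof -
  let ?U = "box a b" and ?M = "lebesgue_on (box a b)"
  have U: "?U \<in> sets lebesgue" by simp
  define l where "l j = (2 * a $ j + b $ j) / 3" for j
  define u where "u j = (a $ j + 2 * b $ j) / 3" for j
  have lu: "a $ j < l j" "u j < b $ j" "l j < u j" for j using ab[of j] by (auto simp: l_def u_def)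
  have "\<exists>h B. smooth (\<lambda>x::real^'n. h (x $ j)) \<and> (\<forall>y. 0 \<le> h y) \<and> (\<forall>y. h y \<le> B) \<and>
    (\<forall>y. y \<notin> {l j..u j} \<longrightarrow> h y = 0) \<and> integrable lborel h \<and> (LINT y|lborel. h y) = 1 \<and> (\<forall>y. l j < y \<longrightarrow> y < u j \<longrightarrow> 0 < h y)" for j
    by (rule bump_profile[OF lu(3)[of j], where 'n = 'n]) blast
  then obtain \<eta> B where \<eta>: "\<And>j. smooth (\<lambda>x::real^'n. \<eta> j (x $ j))" "\<And>j y. 0 \<le> \<eta> j y" "\<And>j y. \<eta> j y \<le> B j"
      "\<And>j y. y \<notin> {l j..u j} \<Longrightarrow> \<eta> j y = 0" "\<And>j. integrable lborel (\<eta> j)" "\<And>j. (LINT y|lborel. \<eta> j y) = 1"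
      "\<And>j y. l j < y \<Longrightarrow> y < u j \<Longrightarrow> 0 < \<eta> j y" by metis
  define H where "H x = (\<Prod>j\<in>UNIV. \<eta> j (x $ j))" for x :: "real^'n"
  have H: "H \<in> test_functions ?U"
  proof (rule test_functionsI)
    show "smooth H" unfolding H_def[abs_def] by (intro smooth_prod \<eta>)
    show "cbox (\<chi> j. l j) (\<chi> j. u j) \<subseteq> box a b" by (rule cbox_subset_box) (simp_all add: lu)
    show "H x = 0" if "x \<notin> cbox (\<chi> j. l j) (\<chi> j. u j)" for x
    proof -
      obtain j where "x $ j \<notin> {l j..u j}" using \<open>x \<notin> _\<close> by (auto simp: mem_box_cart)
      then have "\<eta> j (x $ j) = 0" by (rule \<eta>(4))
      then show ?thesis unfolding H_def by (intro prod_zero) auto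
    qed
  qed simp
  obtain C where C: "0 \<le> C" and av: "\<And>\<psi>. \<psi> \<in> test_functions ?U \<Longrightarrow> \<exists>\<psi>'\<in>test_functions ?U. \<exists>r \<Phi>.
     (\<forall>x. \<psi>' x = (\<Prod>j\<in>UNIV. \<eta> j (x $ j)) * r x) \<and> (\<forall>j\<in>UNIV. \<forall>x s. r (x + s *\<^sub>R axis j 1) = r x) \<and>
     sqnorm ?U \<psi>' \<le> C * sqnorm ?U \<psi> \<and>
     (\<forall>j\<in>UNIV. \<Phi> j \<in> test_functions ?U \<and> sqnorm ?U (\<Phi> j) \<le> C * sqnorm ?U \<psi>) \<and>
     (\<forall>x. \<psi> x - \<psi>' x = (\<Sum>j\<in>UNIV. partial_deriv j (\<Phi> j) x))"
    using averaging[OF ab \<eta>(1-6) lu finite[of UNIV]] by blast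
  show thesis
  proof (rule that[OF H])
    have pos: "0 \<le> H x" for x unfolding H_def by (intro prod_nonneg) (auto simp: \<eta>)
    show "(LINT x|?M. H x) \<noteq> 0"
    proof
      assume "(LINT x|?M. H x) = 0"
      then have "(LINT x|lborel. H x) = 0"
        using test_integral_lebesgue_on[OF U borel_test[OF H] test_functionsD(2)[OF H]] by simp
      then have "AE x in lborel. H x = 0"
        using integral_nonneg_eq_0_iff_AE[OF integrable_test_lborel[OF H]] pos by simp
      moreover have "H x \<noteq> 0" if "x \<in> box (\<chi> j. l j) (\<chi> j. u j)" for x
      proof -
        have "\<eta> j (x $ j) \<noteq> 0" for j using that \<eta>(7)[of j "x $ j"] by (simp add: mem_box_cart)
        then show ?thesis by (simp add: H_def)
      qed
      ultimately have "AE x in lborel. x \<notin> box (\<chi> j. l j) (\<chi> j. u j)" by (auto elim!: eventually_mono)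
      then have "emeasure lborel (box (\<chi> j. l j) (\<chi> j. u j)) = 0"
        by (subst (asm) AE_iff_measurable[of "box (\<chi> j. l j) (\<chi> j. u j)"]) auto
      then have "box (\<chi> j. l j) (\<chi> j. u j) \<in> null_sets lborel" by auto
      then have "negligible (box (\<chi> j. l j) (\<chi> j. u j))"
        by (simp add: negligible_iff_null_sets null_sets_completionI)
      moreover have "(\<chi> j. (l j + u j) / 2) \<in> box (\<chi> j. l j) (\<chi> j. u j)"
        using lu(3) by (auto simp: mem_box_cart field_simps)
      ultimately show False using open_not_negligible[OF open_box] by blast
    qed
    show "0 \<le> C * real CARD('n)" using C by simp
    fix w :: "real^'n \<Rightarrow> real" and g
    assume w: "in_L2 ?M w" and g: "\<And>j. in_L2 ?M (g j)"
      and weak: "\<And>j \<phi>. \<phi> \<in> test_functions ?U \<Longrightarrow> (LINT x|?M. partial_deriv j \<phi> x * w x) = - (LINT x|?M. \<phi> x * g j x)"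
      and mean: "(LINT x|?M. H x * w x) = 0"
    define S where "S = (\<Sum>j\<in>UNIV. sqrt (sqnorm ?U (g j)))"
    have "sqnorm ?U w \<le> (sqrt C * S)\<^sup>2"
      unfolding real_norm_def power2_abs
    proof (rule L2_duality[OF ab])
      show "w \<in> borel_measurable ?M" "integrable ?M (\<lambda>x. (w x)\<^sup>2)" using w by (auto simp: in_L2_def)
      show "0 \<le> sqrt C * S" using C by (auto simp: S_def sum_nonneg)
      fix \<psi> assume \<psi>: "\<psi> \<in> test_functions ?U"
      obtain \<psi>' r \<Phi> where \<psi>': "\<psi>' \<in> test_functions ?U" "\<And>x. \<psi>' x = H x * r x" "\<And>j x s. r (x + s *\<^sub>R axis j 1) = r x"
        "\<And>j. \<Phi> j \<in> test_functions ?U" "\<And>j. sqnorm ?U (\<Phi> j) \<le> C * sqnorm ?U \<psi>"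
        "\<And>x. \<psi> x - \<psi>' x = (\<Sum>j\<in>UNIV. partial_deriv j (\<Phi> j) x)"
        using av[OF \<psi>] unfolding H_def by blast
      \<comment> \<open>Once every direction has been averaged, \<open>r\<close> is constant and
        \<open>\<psi>'\<close> is a multiple of \<open>H\<close>, against which \<open>w\<close>
        integrates to 0. Only the divergence part of \<open>\<psi>\<close> remains.\<close>
      have r: "\<psi>' x = r 0 * H x" for x using invariant_const[of r x] \<psi>'(2,3) by simp
      note I = in_L2_integrable_mult[OF in_L2_test[OF U] w]
      have "(LINT x|?M. \<psi> x * w x) = (LINT x|?M. r 0 * (H x * w x) + (\<Sum>j\<in>UNIV. partial_deriv j (\<Phi> j) x * w x))"
      proof (intro Bochner_Integration.integral_cong refl)
        fix x
        have "\<psi> x = r 0 * H x + (\<Sum>j\<in>UNIV. partial_deriv j (\<Phi> j) x)" using \<psi>'(6)[of x] r[of x] by simp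
        then show "\<psi> x * w x = r 0 * (H x * w x) + (\<Sum>j\<in>UNIV. partial_deriv j (\<Phi> j) x * w x)"
          by (simp add: distrib_right sum_distrib_right)
      qed
      also have "\<dots> = r 0 * (LINT x|?M. H x * w x) + (\<Sum>j\<in>UNIV. LINT x|?M. partial_deriv j (\<Phi> j) x * w x)"
        using I[OF H] I[OF test_partial_deriv[OF \<psi>'(4)]] by simp
      also have "\<dots> = - (\<Sum>j\<in>UNIV. LINT x|?M. \<Phi> j x * g j x)"
        by (simp add: mean weak[OF \<psi>'(4)] sum_negf)
      finally have "\<bar>LINT x|?M. \<psi> x * w x\<bar> \<le> (\<Sum>j\<in>UNIV. \<bar>LINT x|?M. \<Phi> j x * g j x\<bar>)" by (simp add: sum_abs)
      also have "\<dots> \<le> (\<Sum>j\<in>UNIV. sqrt (C * sqnorm ?U \<psi>) * sqrt (sqnorm ?U (g j)))"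
      proof (rule sum_mono)
        fix j
        have "\<bar>LINT x|?M. \<Phi> j x * g j x\<bar> \<le> sqrt (sqnorm ?U (\<Phi> j)) * sqrt (sqnorm ?U (g j))"
          by (rule L2_Cauchy_Schwarz[OF in_L2_test[OF U \<psi>'(4)] g])
        also have "\<dots> \<le> sqrt (C * sqnorm ?U \<psi>) * sqrt (sqnorm ?U (g j))"
          by (intro mult_right_mono real_sqrt_le_mono \<psi>'(5)) simp
        finally show "\<bar>LINT x|?M. \<Phi> j x * g j x\<bar> \<le> sqrt (C * sqnorm ?U \<psi>) * sqrt (sqnorm ?U (g j))" .
      qed
      also have "\<dots> = sqrt C * S * sqrt (LINT x|?M. (\<psi> x)\<^sup>2)"
        by (simp add: S_def real_sqrt_mult sum_distrib_left sum_distrib_right mult_ac)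
      finally show "\<bar>LINT x|?M. \<psi> x * w x\<bar> \<le> sqrt C * S * sqrt (LINT x|?M. (\<psi> x)\<^sup>2)" .
    qed
    also have "\<dots> = C * S\<^sup>2" using C by (simp add: power_mult_distrib)
    \<comment> \<open>\<open>CARD('n)\<close> is the price for replacing the square of a sum of
      norms by a sum of squares.\<close>
    also have "\<dots> \<le> C * ((\<Sum>j\<in>UNIV. (sqrt (sqnorm ?U (g j)))\<^sup>2) * real CARD('n))"
      unfolding S_def by (intro mult_left_mono C sum_squared_le_sum_of_squares)
    also have "\<dots> = C * real CARD('n) * (\<Sum>j\<in>UNIV. sqnorm ?U (g j))" by simp
    finally show "sqnorm ?U w \<le> C * real CARD('n) * (\<Sum>j\<in>UNIV. sqnorm ?U (g j))" .
  qed
qed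

subsection \<open>Affine change of variables\<close>

lemma vimage_eq_image_inverse: "(\<And>x. g (f x) = x) \<Longrightarrow> (\<And>x. f (g x) = x) \<Longrightarrow> f -` E = g ` E"
  by (auto intro: rev_image_eqI)

lemma affine_map_inverse:
  assumes "invertible B"
  obtains B' b' where "invertible B'" "B ** B' = mat 1" "B' ** B = mat 1"
    "\<And>x. affine_map B' b' (affine_map B b x) = x" "\<And>x. affine_map B b (affine_map B' b' x) = x"
proof -
  obtain B' where B': "B ** B' = mat 1" "B' ** B = mat 1" using assms unfolding invertible_def by blast
  show thesis
    by (rule that[of B' "- (B' *v b)"])
       (use B' in \<open>auto simp: invertible_def affine_map_def matrix_vector_right_distrib matrix_vector_mul_assoc
          vec.neg matrix_vector_mult_diff_distrib\<close>)
qed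

lemma continuous_affine_map: "continuous_on S (affine_map B b)"
  by (meson continuous_at_imp_continuous_on has_derivative_affine_map has_derivative_continuous)

lemma borel_affine_map [measurable]: "affine_map B b \<in> borel_measurable borel"
  by (intro borel_measurable_continuous_onI continuous_affine_map)

lemma affine_map_differentiable_on: "affine_map B b differentiable_on S"
  unfolding differentiable_on_def
  by (rule ballI, rule differentiable_at_withinI, rule differentiableI[OF has_derivative_affine_map])

lemma nn_integral_lborel_translate:
  fixes f :: "'a::euclidean_space \<Rightarrow> ennreal"
  assumes "f \<in> borel_measurable borel"
  shows "(\<integral>\<^sup>+x. f (v + x) \<partial>lborel) = (\<integral>\<^sup>+x. f x \<partial>lborel)"
  using nn_integral_distr[of "(+) v" lborel borel f] assms by (simp add: lborel_distr_plus)

lemma nn_integral_lborel_reflect: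
  fixes f :: "'a::euclidean_space \<Rightarrow> ennreal"
  assumes "f \<in> borel_measurable borel"
  shows "(\<integral>\<^sup>+x. f (v - x) \<partial>lborel) = (\<integral>\<^sup>+x. f x \<partial>lborel)"
proof -
  have "distr lborel borel (\<lambda>x. v + (-1) *\<^sub>R x) = lborel"
    using lborel_affine[of "-1" v] by (simp add: density_1)
  then have "(\<integral>\<^sup>+x. f x \<partial>lborel) = (\<integral>\<^sup>+x. f x \<partial>distr lborel borel (\<lambda>x. v - x))" by simp
  also have "\<dots> = (\<integral>\<^sup>+x. f (v - x) \<partial>lborel)"
    using assms by (subst nn_integral_distr) simp_all
  finally show ?thesis by simp
qed

text \<open>Uniqueness of Haar measure: integrate \<open>f (A x) * indicator Q (A x + y)\<close> in both orders.
  The determinant formula of the library needs a well-ordered index type; only the existence of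
  the constant matters here.\<close>

lemma nn_integral_affine:
  fixes B :: "real^'n::finite^'n"
  assumes "invertible B"
  obtains c where "0 < c" "\<And>f. f \<in> borel_measurable borel \<Longrightarrow>
    (\<integral>\<^sup>+x. f (affine_map B b x) \<partial>lborel) = ennreal c * (\<integral>\<^sup>+x. f x \<partial>lborel)"
proof -
  obtain B' b' where B': "B ** B' = mat 1" "\<And>x. affine_map B' b' (affine_map B b x) = x" "\<And>x. affine_map B b (affine_map B' b' x) = x"
    using affine_map_inverse[OF assms] by metis
  let ?A = "affine_map B b"
  have shift: "?A (- (B' *v y) + x) = ?A x - y" for x y
    using B'(1) by (simp add: affine_map_def matrix_vector_right_distrib matrix_vector_mul_assoc matrix_vector_mult_diff_distrib vec.neg
        flip: scalar_mult_eq_scaleR)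
  define Q where "Q = box 0 (1::real^'n)"
  have Q[measurable]: "Q \<in> sets borel" by (simp add: Q_def)
  have lQ: "emeasure lborel Q = 1" unfolding Q_def
    by (subst emeasure_lborel_box) (auto simp: Basis_vec_def inner_axis intro!: prod.neutral)
  let ?I = "indicator Q :: real^'n \<Rightarrow> ennreal"
  define C where "C = (\<integral>\<^sup>+x. ?I (?A x) \<partial>lborel)"
  have meas[measurable]: "(\<lambda>p. ?A (fst p) + snd p) \<in> borel_measurable (lborel \<Otimes>\<^sub>M lborel)"
    "(\<lambda>p. ?A (snd p) + fst p) \<in> borel_measurable (lborel \<Otimes>\<^sub>M lborel)"
    "(\<lambda>p. ?A (fst p) - snd p) \<in> borel_measurable (lborel \<Otimes>\<^sub>M lborel)"
    "(\<lambda>p. ?A (snd p) - fst p) \<in> borel_measurable (lborel \<Otimes>\<^sub>M lborel)"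
    "(\<lambda>p. ?A (fst p)) \<in> borel_measurable (lborel \<Otimes>\<^sub>M lborel)"
    "(\<lambda>p. ?A (snd p)) \<in> borel_measurable (lborel \<Otimes>\<^sub>M lborel)" by measurable
  have main: "(\<integral>\<^sup>+x. f (?A x) \<partial>lborel) = C * (\<integral>\<^sup>+x. f x \<partial>lborel)" if f[measurable]: "f \<in> borel_measurable borel" for f
  proof -
    \<comment> \<open>Insert a factor 1: the inner integral in \<open>y\<close> is the measure of a
      translate of the unit cube \<open>Q\<close>.\<close>
    have "(\<integral>\<^sup>+x. f (?A x) \<partial>lborel) = (\<integral>\<^sup>+x. f (?A x) * (\<integral>\<^sup>+y. ?I (?A x + y) \<partial>lborel) \<partial>lborel)"
      by (simp add: nn_integral_lborel_translate lQ)
    also have "\<dots> = (\<integral>\<^sup>+x. \<integral>\<^sup>+y. f (?A x) * ?I (?A x + y) \<partial>lborel \<partial>lborel)"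
      by (intro nn_integral_cong nn_integral_cmult[symmetric]) measurable
    also have "\<dots> = (\<integral>\<^sup>+y. \<integral>\<^sup>+x. f (?A x) * ?I (?A x + y) \<partial>lborel \<partial>lborel)"
      by (intro lborel_pair.Fubini') measurable
    also have "\<dots> = (\<integral>\<^sup>+y. \<integral>\<^sup>+x. f (?A x - y) * ?I (?A x) \<partial>lborel \<partial>lborel)"
    proof (rule nn_integral_cong)
      fix y
      show "(\<integral>\<^sup>+x. f (?A x) * ?I (?A x + y) \<partial>lborel) = (\<integral>\<^sup>+x. f (?A x - y) * ?I (?A x) \<partial>lborel)"
        using nn_integral_lborel_translate[of "\<lambda>x. f (?A x) * ?I (?A x + y)" "- (B' *v y)"]
        by (simp only: shift) simp
    qed
    also have "\<dots> = (\<integral>\<^sup>+x. \<integral>\<^sup>+y. f (?A x - y) * ?I (?A x) \<partial>lborel \<partial>lborel)"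
      by (intro lborel_pair.Fubini'[symmetric]) measurable
    also have "\<dots> = (\<integral>\<^sup>+x. (\<integral>\<^sup>+y. f y \<partial>lborel) * ?I (?A x) \<partial>lborel)"
    proof (rule nn_integral_cong)
      fix x
      have "(\<integral>\<^sup>+y. f (?A x - y) * ?I (?A x) \<partial>lborel) = (\<integral>\<^sup>+y. f (?A x - y) \<partial>lborel) * ?I (?A x)"
        by (intro nn_integral_multc) measurable
      then show "(\<integral>\<^sup>+y. f (?A x - y) * ?I (?A x) \<partial>lborel) = (\<integral>\<^sup>+y. f y \<partial>lborel) * ?I (?A x)"
        by (simp add: nn_integral_lborel_reflect)
    qed
    also have "\<dots> = C * (\<integral>\<^sup>+x. f x \<partial>lborel)"
      unfolding C_def by (subst nn_integral_cmult) (auto simp: mult.commute)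
    finally show ?thesis .
  qed
  \<comment> \<open>\<open>C\<close> is the measure of the preimage of the open unit cube. That set
    is bounded, open and nonempty, so \<open>C\<close> is finite and positive.\<close>
  have vim: "?A -` Q = affine_map B' b' ` Q" by (rule vimage_eq_image_inverse[OF B'(2,3)])
  have "C = emeasure lborel (?A -` Q)"
    unfolding C_def by (subst nn_integral_indicator[symmetric]) (auto simp: indicator_def intro!: nn_integral_cong measurable_sets_borel[OF borel_affine_map])
  moreover have "bounded (?A -` Q)"
  proof (rule bounded_subset)
    show "bounded (affine_map B' b' ` cbox 0 1)"
      by (intro compact_imp_bounded compact_continuous_image continuous_affine_map compact_cbox)
    show "?A -` Q \<subseteq> affine_map B' b' ` cbox 0 1" unfolding vim by (intro image_mono) (simp add: Q_def box_subset_cbox)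
  qed
  moreover have "emeasure lborel (?A -` Q) \<noteq> 0"
  proof
    assume "emeasure lborel (?A -` Q) = 0"
    then have "negligible (?A -` Q)"
      by (simp add: negligible_iff_null_sets null_sets_completionI null_sets_def measurable_sets_borel[OF borel_affine_map])
    moreover have "open (?A -` Q)" unfolding Q_def by (intro open_vimage open_box continuous_affine_map)
    moreover have "affine_map B' b' (\<chi> j. 1/2) \<in> ?A -` Q" by (simp add: B'(3) Q_def mem_box_cart)
    ultimately show False using open_not_negligible by blast
  qed
  ultimately have "0 < C" "C < top" using emeasure_bounded_finite by (auto simp: zero_less_iff_neq_zero)
  then have "0 < enn2real C" "ennreal (enn2real C) = C" by (auto simp: enn2real_positive_iff)
  then show thesis using that[of "enn2real C"] main by simp
qed

text \<open>The number \<open>c\<close> is 1 / \<bar>det B\<bar>. It is kept as an abstract constant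
  because it cancels between the pullback of \<open>F\<close> and the return of the error.\<close>

definition affine_scaling :: "real^'n^'n \<Rightarrow> real^'n::finite \<Rightarrow> real \<Rightarrow> bool" where
  "affine_scaling B b c \<longleftrightarrow> invertible B \<and> 0 < c \<and> affine_map B b \<in> lebesgue \<rightarrow>\<^sub>M lebesgue \<and>
     distr lebesgue lebesgue (affine_map B b) = density lebesgue (\<lambda>_. ennreal c)"

text \<open>A Lebesgue set is a Borel set up to a null set. On Borel sets the scaling is the
  integral formula for indicators; preimages of null sets are images under the inverse map, which is
  differentiable and hence preserves null sets.\<close>

lemma ex_affine_scaling:
  fixes B :: "real^'n::finite^'n"
  assumes B: "invertible B"
  obtains c where "affine_scaling B b c"
proof -
  let ?A = "affine_map B b"
  obtain B' b' where B': "\<And>x. affine_map B' b' (?A x) = x" "\<And>x. ?A (affine_map B' b' x) = x"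
    using affine_map_inverse[OF B] by metis
  have vim: "?A -` E = affine_map B' b' ` E" for E by (rule vimage_eq_image_inverse[OF B'])
  have meas: "?A \<in> lebesgue \<rightarrow>\<^sub>M lebesgue"
    by (rule measurableI) (auto simp: vim intro!: differentiable_image_in_sets_lebesgue affine_map_differentiable_on)
  obtain c where c: "0 < c" "\<And>f. f \<in> borel_measurable borel \<Longrightarrow> (\<integral>\<^sup>+x. f (?A x) \<partial>lborel) = ennreal c * (\<integral>\<^sup>+x. f x \<partial>lborel)"
    using nn_integral_affine[OF B] by blast
  have cb: "emeasure lborel (?A -` S) = ennreal c * emeasure lborel S" if S: "S \<in> sets borel" for S
  proof -
    have "emeasure lborel (?A -` S) = (\<integral>\<^sup>+x. indicator S (?A x) \<partial>lborel)"
      using S by (subst nn_integral_indicator[symmetric]) (auto simp: indicator_def intro!: nn_integral_cong measurable_sets_borel[OF borel_affine_map])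
    then show ?thesis using c(2)[of "indicator S"] S by simp
  qed
  have "distr lebesgue lebesgue ?A = density lebesgue (\<lambda>_. ennreal c)"
  proof (rule measure_eqI)
    fix E assume "E \<in> sets (distr lebesgue lebesgue ?A)"
    then have E: "E \<in> sets lebesgue" by simp
    define S N where "S = main_part lborel E" and "N = null_part lborel E"
    have EE: "E = S \<union> N" using main_part_null_part_Un[OF E] by (simp add: S_def N_def)
    have S: "S \<in> sets borel" using main_part_sets[OF E] by (simp add: S_def)
    obtain N' where N': "N' \<in> null_sets lborel" "N \<subseteq> N'" using null_part[OF E] unfolding N_def by blast
    have "negligible N" using N' by (meson negligible_iff_null_sets negligible_subset null_sets_completionI)
    then have N: "N \<in> null_sets lebesgue" "?A -` N \<in> null_sets lebesgue"
      using negligible_differentiable_image_negligible[OF _ _ affine_map_differentiable_on, of N B' b']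
      by (auto simp: vim negligible_iff_null_sets)
    have AS: "?A -` S \<in> sets borel" using measurable_sets_borel[OF borel_affine_map S] by simp
    have "emeasure (distr lebesgue lebesgue ?A) E = emeasure lebesgue (?A -` S \<union> ?A -` N)"
      using E by (simp add: emeasure_distr[OF meas] EE[symmetric] flip: vimage_Un)
    also have "\<dots> = emeasure lborel (?A -` S)"
      using N AS by (subst emeasure_Un_null_set) auto
    also have "\<dots> = ennreal c * emeasure lborel S" by (rule cb[OF S])
    also have "emeasure lborel S = emeasure lebesgue (S \<union> N)"
      using N S by (subst emeasure_Un_null_set) auto
    also have "ennreal c * \<dots> = emeasure (density lebesgue (\<lambda>_. ennreal c)) E"
      using E by (simp add: EE[symmetric] emeasure_density_const)
    finally show "emeasure (distr lebesgue lebesgue ?A) E = emeasure (density lebesgue (\<lambda>_. ennreal c)) E" .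
  qed simp
  with B c(1) meas show thesis using that by (simp add: affine_scaling_def)
qed

lemma
  fixes B :: "real^'n::finite^'n" and f :: "real^'n \<Rightarrow> 'a::euclidean_space"
  assumes A: "affine_scaling B b c" and V: "V \<in> sets lebesgue"
    and f: "f \<in> borel_measurable (lebesgue_on (affine_map B b ` V))"
  shows borel_measurable_affine: "(\<lambda>x. f (affine_map B b x)) \<in> borel_measurable (lebesgue_on V)"
    and integrable_affine: "integrable (lebesgue_on (affine_map B b ` V)) f \<Longrightarrow> integrable (lebesgue_on V) (\<lambda>x. f (affine_map B b x))"
    and integral_affine: "(LINT x|lebesgue_on V. f (affine_map B b x)) = c *\<^sub>R (LINT x|lebesgue_on (affine_map B b ` V). f x)"
proof -
  let ?A = "affine_map B b"
  have B: "invertible B" and c: "0 < c" "?A \<in> lebesgue \<rightarrow>\<^sub>M lebesgue" "distr lebesgue lebesgue ?A = density lebesgue (\<lambda>_. ennreal c)"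
    using A by (auto simp: affine_scaling_def)
  obtain B' b' where B': "\<And>x. affine_map B' b' (?A x) = x" using affine_map_inverse[OF B] by metis
  have inj: "?A x \<in> ?A ` V \<longleftrightarrow> x \<in> V" for x
    by (rule inj_image_mem_iff, rule inj_on_inverseI[of _ "affine_map B' b'"], rule B')
  have AV: "?A ` V \<in> sets lebesgue"
    by (intro differentiable_image_in_sets_lebesgue affine_map_differentiable_on V) simp
  \<comment> \<open>Extension by zero reduces the formulas to the whole space; by injectivity the
    indicator of the image becomes that of \<open>V\<close> after composition.\<close>
  define g where "g x = indicator (?A ` V) x *\<^sub>R f x" for x
  have gm: "g \<in> borel_measurable lebesgue"
    using f AV unfolding g_def by (subst (asm) borel_measurable_restrict_space_iff) auto
  have gA: "g (?A x) = indicator V x *\<^sub>R f (?A x)" for x by (simp add: g_def indicator_def inj)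
  have gAm: "(\<lambda>x. g (?A x)) \<in> borel_measurable lebesgue" using c(2) gm by (rule measurable_compose)
  show "(\<lambda>x. f (?A x)) \<in> borel_measurable (lebesgue_on V)"
    using gAm V by (subst borel_measurable_restrict_space_iff) (auto simp: gA)
  show "integrable (lebesgue_on V) (\<lambda>x. f (?A x))" if "integrable (lebesgue_on (?A ` V)) f"
  proof -
    have "integrable lebesgue g" using that AV by (subst (asm) integrable_restrict_space) (auto simp: g_def[abs_def])
    then have "integrable (density lebesgue (\<lambda>_. ennreal c)) g"
      using c(1) gm by (subst integrable_density) auto
    then have "integrable lebesgue (\<lambda>x. g (?A x))"
      unfolding c(3)[symmetric] by (rule integrable_distr[OF c(2)])
    then show ?thesis using V by (subst integrable_restrict_space) (auto simp: gA)
  qed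
  have "(LINT x|lebesgue_on V. f (?A x)) = (LINT x|lebesgue. g (?A x))"
    using V by (subst integral_restrict_space) (auto simp: gA)
  also have "\<dots> = integral\<^sup>L (distr lebesgue lebesgue ?A) g" by (rule integral_distr[OF c(2) gm, symmetric])
  also have "\<dots> = (LINT x|lebesgue. c *\<^sub>R g x)" unfolding c(3) using c(1) gm by (subst integral_density) auto
  also have "\<dots> = c *\<^sub>R (LINT x|lebesgue. g x)" by (rule integral_scaleR_right)
  also have "(LINT x|lebesgue. g x) = (LINT x|lebesgue_on (?A ` V). f x)"
    using AV by (subst integral_restrict_space) (auto simp: g_def[abs_def])
  finally show "(LINT x|lebesgue_on V. f (?A x)) = c *\<^sub>R (LINT x|lebesgue_on (?A ` V). f x)" .
qed

subsection \<open>Square integrable weak derivatives\<close>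

lemma L2_on_iff: "U \<in> sets lebesgue \<Longrightarrow> L2_on U F \<longleftrightarrow> in_L2 (lebesgue_on U) F"
  by (simp add: L2_on_def in_L2_def set_borel_measurable_def set_integrable_def
      borel_measurable_restrict_space_iff integrable_restrict_space)

lemma set_lebesgue_integral_eq:
  fixes f :: "real^'n \<Rightarrow> 'b::{banach, second_countable_topology}"
  shows "U \<in> sets lebesgue \<Longrightarrow> (LINT x:U|lebesgue. f x) = (LINT x|lebesgue_on U. f x)"
  by (simp add: set_lebesgue_integral_def integral_restrict_space)

lemma L2_norm_on_sq: "U \<in> sets lebesgue \<Longrightarrow> (L2_norm_on U F)\<^sup>2 = sqnorm U F"
  by (simp add: L2_norm_on_def set_lebesgue_integral_eq)

lemma in_L2_integrable_scaleR:
  fixes f :: "'a \<Rightarrow> real" and g :: "'a \<Rightarrow> 'b::{banach, second_countable_topology}"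
  assumes f: "in_L2 M f" and g: "in_L2 M g"
  shows "integrable M (\<lambda>x. f x *\<^sub>R g x)"
proof -
  have [measurable]: "f \<in> borel_measurable M" "g \<in> borel_measurable M" using f g by (auto simp: in_L2_def)
  have "integrable M (\<lambda>x. f x * norm (g x))"
    using f g by (intro in_L2_integrable_mult) (auto simp: in_L2_def)
  then show ?thesis by (rule Bochner_Integration.integrable_bound) (auto intro!: AE_I2)
qed

lemma in_L2_bounded_linear:
  assumes "in_L2 M f" "bounded_linear T" "\<And>x. norm (T x) \<le> K * norm x"
  shows "in_L2 M (\<lambda>x. T (f x))"
proof (rule in_L2_I_bound)
  show "(\<lambda>x. T (f x)) \<in> borel_measurable M"
    using assms(1) borel_measurable_continuous_onI[OF linear_continuous_on[OF assms(2)]]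
    by (auto simp: in_L2_def)
  show "integrable M (\<lambda>x. K\<^sup>2 * (norm (f x))\<^sup>2)" using assms(1) by (simp add: in_L2_def)
  show "(norm (T (f x)))\<^sup>2 \<le> K\<^sup>2 * (norm (f x))\<^sup>2" for x
    using power_mono[OF assms(3)[of "f x"], of 2] by (simp add: power_mult_distrib)
qed

lemma in_L2_inner: "in_L2 M f \<Longrightarrow> e \<in> Basis \<Longrightarrow> in_L2 M (\<lambda>x. f x \<bullet> e)"
  for f :: "'a \<Rightarrow> 'b::euclidean_space"
  by (rule in_L2_bounded_linear[of _ _ "\<lambda>x. x \<bullet> e" 1])
     (auto simp: bounded_linear_inner_left Basis_le_norm)

lemma in_L2_zero: "in_L2 M (\<lambda>x. 0)" by (simp add: in_L2_def)

lemma in_L2_sum: "(\<And>i. i \<in> I \<Longrightarrow> in_L2 M (f i)) \<Longrightarrow> in_L2 M (\<lambda>x. \<Sum>i\<in>I. f i x)"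
  for f :: "'i \<Rightarrow> 'a \<Rightarrow> 'b::{real_normed_vector, second_countable_topology}"
  by (induction I rule: infinite_finite_induct) (auto intro: in_L2_add simp: in_L2_zero)

text \<open>Unlike \<open>weak_deriv\<close> this is a relation without a choice of representative,
  so sums, linear maps and affine pullbacks act on it directly. Square integrability is built in and
  makes all pairings converge.\<close>

definition L2_deriv :: "(real^'n::finite) set \<Rightarrow> 'n list \<Rightarrow> (real^'n \<Rightarrow> 'a::euclidean_space) \<Rightarrow> (real^'n \<Rightarrow> 'a) \<Rightarrow> bool" where
  "L2_deriv U js F G \<longleftrightarrow> in_L2 (lebesgue_on U) F \<and> in_L2 (lebesgue_on U) G \<and>
     (\<forall>\<phi>\<in>test_functions U. (LINT x|lebesgue_on U. partial_derivs js \<phi> x *\<^sub>R F x) =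
        (-1) ^ length js *\<^sub>R (LINT x|lebesgue_on U. \<phi> x *\<^sub>R G x))"

lemma L2_derivD:
  assumes "L2_deriv U js F G"
  shows "in_L2 (lebesgue_on U) F" "in_L2 (lebesgue_on U) G"
    "\<phi> \<in> test_functions U \<Longrightarrow> (LINT x|lebesgue_on U. partial_derivs js \<phi> x *\<^sub>R F x) =
        (-1) ^ length js *\<^sub>R (LINT x|lebesgue_on U. \<phi> x *\<^sub>R G x)"
  using assms by (auto simp: L2_deriv_def)

lemma test_scaleR_integrable:
  fixes F :: "real^'n::finite \<Rightarrow> 'a::euclidean_space"
  assumes "\<phi> \<in> test_functions U" "in_L2 (lebesgue_on U) F" "U \<in> sets lebesgue"
  shows "integrable (lebesgue_on U) (\<lambda>x. \<phi> x *\<^sub>R F x)"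
  by (intro in_L2_integrable_scaleR in_L2_test assms)

lemma L2_deriv_add:
  assumes U: "U \<in> sets lebesgue" and 1: "L2_deriv U js F G" and 2: "L2_deriv U js F' G'"
  shows "L2_deriv U js (\<lambda>x. F x + F' x) (\<lambda>x. G x + G' x)"
  using L2_derivD[OF 1] L2_derivD[OF 2] U
  by (auto simp: L2_deriv_def scaleR_add_right test_scaleR_integrable test_partial_derivs intro!: in_L2_add)

lemma L2_deriv_linear:
  fixes T :: "'a::euclidean_space \<Rightarrow> 'b::euclidean_space"
  assumes U: "U \<in> sets lebesgue" and 1: "L2_deriv U js F G" and T: "bounded_linear T"
  shows "L2_deriv U js (\<lambda>x. T (F x)) (\<lambda>x. T (G x))"
proof -
  obtain K where K: "\<And>x. norm (T x) \<le> K * norm x"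
    using bounded_linear.bounded[OF T] by (auto simp: mult.commute)
  interpret T: bounded_linear T by (rule T)
  have int: "(LINT x|lebesgue_on U. \<phi> x *\<^sub>R T (H x)) = T (LINT x|lebesgue_on U. \<phi> x *\<^sub>R H x)"
    if "\<phi> \<in> test_functions U" "in_L2 (lebesgue_on U) H" for \<phi> H
    using integral_bounded_linear[OF T test_scaleR_integrable[OF that U]] by (simp add: T.scaleR)
  show ?thesis
    unfolding L2_deriv_def
  proof (intro conjI ballI)
    fix \<phi> assume \<phi>: "\<phi> \<in> test_functions U"
    show "(LINT x|lebesgue_on U. partial_derivs js \<phi> x *\<^sub>R T (F x)) = (-1) ^ length js *\<^sub>R (LINT x|lebesgue_on U. \<phi> x *\<^sub>R T (G x))"
      unfolding int[OF test_partial_derivs[OF \<phi>] L2_derivD(1)[OF 1]] int[OF \<phi> L2_derivD(2)[OF 1]] L2_derivD(3)[OF 1 \<phi>]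
      by (rule T.scaleR)
  qed (rule in_L2_bounded_linear[OF L2_derivD(1)[OF 1] T K] in_L2_bounded_linear[OF L2_derivD(2)[OF 1] T K])+
qed

lemma L2_deriv_scaleR: "U \<in> sets lebesgue \<Longrightarrow> L2_deriv U js F G \<Longrightarrow> L2_deriv U js (\<lambda>x. c *\<^sub>R F x) (\<lambda>x. c *\<^sub>R G x)"
  by (rule L2_deriv_linear) (auto intro: bounded_linear_scaleR_right)

lemma L2_deriv_diff:
  assumes U: "U \<in> sets lebesgue" and 1: "L2_deriv U js F G" and 2: "L2_deriv U js F' G'"
  shows "L2_deriv U js (\<lambda>x. F x - F' x) (\<lambda>x. G x - G' x)"
  using L2_deriv_add[OF U 1 L2_deriv_scaleR[OF U 2, of "-1"]] by simp

lemma L2_deriv_zero: "L2_deriv U js (\<lambda>x. 0) (\<lambda>x. 0)"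
  by (simp add: L2_deriv_def in_L2_def)

lemma L2_deriv_sum:
  assumes "U \<in> sets lebesgue" "\<And>i. i \<in> I \<Longrightarrow> L2_deriv U js (F i) (G i)"
  shows "L2_deriv U js (\<lambda>x. \<Sum>i\<in>I. F i x) (\<lambda>x. \<Sum>i\<in>I. G i x)"
  using assms(2) by (induction I rule: infinite_finite_induct) (auto intro: L2_deriv_add[OF assms(1)] L2_deriv_zero)

text \<open>Testing the derivative along \<open>js\<close> with
  \<open>partial_deriv j \<phi>\<close> produces the pairing for \<open>j # js\<close>, and the
  common sign cancels. In this way the Poincare inequality applies to a derivative of
  \<open>v\<close>, with the derivatives of the next order as its gradient.\<close>

lemma L2_deriv_step:
  assumes U: "U \<in> sets lebesgue" and 1: "L2_deriv U js F G" and 2: "L2_deriv U (j # js) F H"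
  shows "L2_deriv U [j] G H"
  unfolding L2_deriv_def
proof (intro conjI ballI)
  fix \<phi> assume \<phi>: "\<phi> \<in> test_functions U"
  have "(-1) ^ length js *\<^sub>R (LINT x|lebesgue_on U. partial_deriv j \<phi> x *\<^sub>R G x) =
      (LINT x|lebesgue_on U. partial_derivs js (partial_deriv j \<phi>) x *\<^sub>R F x)"
    by (rule L2_derivD(3)[OF 1 test_partial_deriv[OF \<phi>], symmetric])
  also have "\<dots> = (-1) ^ length (j # js) *\<^sub>R (LINT x|lebesgue_on U. \<phi> x *\<^sub>R H x)"
    using L2_derivD(3)[OF 2 \<phi>] by (simp add: partial_derivs_commute1 test_functionsD(1)[OF \<phi>])
  finally have "(-1) ^ length js *\<^sub>R (LINT x|lebesgue_on U. partial_deriv j \<phi> x *\<^sub>R G x) =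
      (-1) ^ length js *\<^sub>R (- (LINT x|lebesgue_on U. \<phi> x *\<^sub>R H x))" by simp
  then have "(LINT x|lebesgue_on U. partial_deriv j \<phi> x *\<^sub>R G x) = - (LINT x|lebesgue_on U. \<phi> x *\<^sub>R H x)"
    unfolding scaleR_cancel_left by simp
  then show "(LINT x|lebesgue_on U. partial_derivs [j] \<phi> x *\<^sub>R G x) =
      (-1) ^ length [j] *\<^sub>R (LINT x|lebesgue_on U. \<phi> x *\<^sub>R H x)" by simp
qed (rule L2_derivD(2)[OF 1] L2_derivD(2)[OF 2])+

lemma in_L2_locally_integrable:
  fixes F :: "real^'n::finite \<Rightarrow> 'a::{real_normed_field, euclidean_space}"
  assumes "U \<in> sets lebesgue" "in_L2 (lebesgue_on U) F"
  shows "locally_integrable U F"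
  unfolding locally_integrable_def
proof (intro allI impI)
  fix K assume K: "compact K \<and> K \<subseteq> U"
  then have Ks: "K \<in> sets lebesgue" by (simp add: compact_imp_closed)
  let ?M = "lebesgue_on U"
  have KM: "K \<in> sets ?M" using K Ks assms(1) by (auto simp: sets_restrict_space_iff)
  have fin: "emeasure ?M K < \<infinity>"
    using K Ks assms(1) emeasure_compact_finite[of K]
    by (subst emeasure_restrict_space) (auto simp: compact_imp_closed)
  have "in_L2 ?M (indicat_real K)"
    using KM fin Int_absorb2[of K U] K by (auto simp: in_L2_def power2_eq_square indicator_inter_arith[symmetric] integrable_indicator_iff)
  then have "integrable ?M (\<lambda>x. indicat_real K x *\<^sub>R F x)" by (intro in_L2_integrable_scaleR assms)
  then have "integrable lebesgue (\<lambda>x. indicat_real U x *\<^sub>R indicat_real K x *\<^sub>R F x)"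
    using assms(1) by (subst (asm) integrable_restrict_space) auto
  also have "(\<lambda>x. indicat_real U x *\<^sub>R indicat_real K x *\<^sub>R F x) = (\<lambda>x. indicat_real K x *\<^sub>R F x)"
    using K by (auto simp: indicator_def fun_eq_iff)
  finally show "set_integrable lebesgue K F" by (simp add: set_integrable_def)
qed

lemma L2_deriv_iff:
  fixes F G :: "real^'n::finite \<Rightarrow> 'a::{real_normed_field, euclidean_space}"
  assumes U: "U \<in> sets lebesgue"
  shows "L2_deriv U js F G \<longleftrightarrow> in_L2 (lebesgue_on U) F \<and> in_L2 (lebesgue_on U) G \<and> has_weak_deriv U (count_list js) F G"
  using U by (auto simp: L2_deriv_def has_weak_deriv_def in_L2_locally_integrable set_lebesgue_integral_eq
      mixed_partial_count_list test_functionsD(1) morder_count_list)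

lemma locally_integrable_test:
  fixes F :: "real^'n::finite \<Rightarrow> 'a::{real_normed_field, euclidean_space}"
  assumes F: "locally_integrable U F" and \<phi>: "\<phi> \<in> test_functions U"
  shows "set_integrable lebesgue U (\<lambda>x. \<phi> x *\<^sub>R F x)"
proof -
  from \<phi> obtain K where K: "compact K" "K \<subseteq> U" "\<And>x. x \<notin> K \<Longrightarrow> \<phi> x = 0" by (rule test_functionsE) blast
  have Ks: "K \<in> sets lebesgue" using K(1) by (simp add: compact_imp_closed)
  have "integrable (lebesgue_on K) F"
    using F K Ks by (auto simp: locally_integrable_def set_integrable_def integrable_restrict_space)
  from integrable_test_mult[OF \<phi> this Ks] Ks
  have "integrable lebesgue (\<lambda>x. indicator K x *\<^sub>R \<phi> x *\<^sub>R F x)" by (subst (asm) integrable_restrict_space) auto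
  also have "(\<lambda>x. indicator K x *\<^sub>R \<phi> x *\<^sub>R F x) = (\<lambda>x. indicator U x *\<^sub>R \<phi> x *\<^sub>R F x)"
    using K by (force simp: indicator_def fun_eq_iff)
  finally show ?thesis by (simp add: set_integrable_def)
qed

lemma has_weak_deriv_unique:
  fixes F :: "real^'n::finite \<Rightarrow> 'a::{real_normed_field, euclidean_space}"
  assumes U: "open U" and 1: "has_weak_deriv U \<alpha> F G" and 2: "has_weak_deriv U \<alpha> F H"
  shows "AE x in lebesgue. x \<in> U \<longrightarrow> G x = H x"
proof -
  have li: "locally_integrable U G" "locally_integrable U H" using 1 2 by (auto simp: has_weak_deriv_def)
  have "AE x in lebesgue. x \<in> U \<longrightarrow> G x - H x = 0"
  proof (rule weak_zero_ae[OF U])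
    show "locally_integrable U (\<lambda>x. G x - H x)"
      using li by (auto simp: locally_integrable_def intro: set_integral_diff)
    fix \<phi> assume \<phi>: "\<phi> \<in> test_functions U"
    have "(LINT x:U|lebesgue. mixed_partial \<alpha> \<phi> x *\<^sub>R F x) = (-1) ^ morder \<alpha> *\<^sub>R (LINT x:U|lebesgue. \<phi> x *\<^sub>R G x)"
      using 1 \<phi> unfolding has_weak_deriv_def by blast
    moreover have "(LINT x:U|lebesgue. mixed_partial \<alpha> \<phi> x *\<^sub>R F x) = (-1) ^ morder \<alpha> *\<^sub>R (LINT x:U|lebesgue. \<phi> x *\<^sub>R H x)"
      using 2 \<phi> unfolding has_weak_deriv_def by blast
    ultimately have "(-1::real) ^ morder \<alpha> *\<^sub>R (LINT x:U|lebesgue. \<phi> x *\<^sub>R G x) = (-1) ^ morder \<alpha> *\<^sub>R (LINT x:U|lebesgue. \<phi> x *\<^sub>R H x)"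
      by (rule trans[OF sym])
    then have "(LINT x:U|lebesgue. \<phi> x *\<^sub>R G x) = (LINT x:U|lebesgue. \<phi> x *\<^sub>R H x)"
      unfolding scaleR_cancel_left by simp
    then show "(LINT x:U|lebesgue. \<phi> x *\<^sub>R (G x - H x)) = 0"
      using locally_integrable_test[OF li(1) \<phi>] locally_integrable_test[OF li(2) \<phi>]
      by (simp add: scaleR_diff_right set_integral_diff)
  qed
  then show ?thesis by eventually_elim simp
qed

text \<open>Measurability is assumed of \<open>F\<close> only; \<open>G\<close> inherits it because
  altering a function on a null set preserves Lebesgue measurability.\<close>

lemma in_L2_AE_cong:
  fixes F G :: "real^'n::finite \<Rightarrow> 'a::euclidean_space"
  assumes U: "U \<in> sets lebesgue" and F: "in_L2 (lebesgue_on U) F" and eq: "AE x in lebesgue. x \<in> U \<longrightarrow> F x = G x"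
  shows "in_L2 (lebesgue_on U) G" "sqnorm U F = sqnorm U G"
    "\<phi> \<in> test_functions U \<Longrightarrow> (LINT x|lebesgue_on U. \<phi> x *\<^sub>R F x) = (LINT x|lebesgue_on U. \<phi> x *\<^sub>R G x)"
proof -
  have ae: "AE x in lebesgue_on U. F x = G x" using U eq by (simp add: AE_restrict_space_iff)
  obtain N where N: "negligible N" "\<And>x. x \<in> U \<Longrightarrow> x \<notin> N \<Longrightarrow> F x = G x"
  proof (rule AE_E3[OF eq])
    fix N assume *: "\<And>x. x \<in> space lebesgue - N \<Longrightarrow> x \<in> U \<longrightarrow> F x = G x" "N \<in> null_sets lebesgue"
      and that: "\<And>N. negligible N \<Longrightarrow> (\<And>x. x \<in> U \<Longrightarrow> x \<notin> N \<Longrightarrow> F x = G x) \<Longrightarrow> thesis"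
    show thesis by (rule that[of N]) (use * in \<open>auto simp: negligible_iff_null_sets\<close>)
  qed
  have [measurable]: "F \<in> borel_measurable (lebesgue_on U)" using F by (simp add: in_L2_def)
  then have "F measurable_on U" using U by (simp add: measurable_on_iff_borel_measurable)
  then have "G measurable_on U" by (rule measurable_on_spike[OF _ N(1)]) (use N(2) in auto)
  then have G[measurable]: "G \<in> borel_measurable (lebesgue_on U)" using U by (simp add: measurable_on_iff_borel_measurable)
  have "integrable (lebesgue_on U) (\<lambda>x. (norm (G x))\<^sup>2)"
    using F ae unfolding in_L2_def by (subst integrable_cong_AE[of _ _ "\<lambda>x. (norm (F x))\<^sup>2"]) auto
  with G show "in_L2 (lebesgue_on U) G" by (simp add: in_L2_def)
  show "sqnorm U F = sqnorm U G" using ae by (intro integral_cong_AE) auto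
  show "(LINT x|lebesgue_on U. \<phi> x *\<^sub>R F x) = (LINT x|lebesgue_on U. \<phi> x *\<^sub>R G x)" if "\<phi> \<in> test_functions U"
  proof -
    have [measurable]: "\<phi> \<in> borel_measurable (lebesgue_on U)" using that U by (rule test_measurable)
    show ?thesis using ae by (intro integral_cong_AE) auto
  qed
qed

lemma L2_deriv_AE_cong:
  assumes U: "U \<in> sets lebesgue" and F: "L2_deriv U js F G" and eq: "AE x in lebesgue. x \<in> U \<longrightarrow> F x = F' x"
  shows "L2_deriv U js F' G"
  using L2_derivD[OF F] in_L2_AE_cong[OF U L2_derivD(1)[OF F] eq] by (auto simp: L2_deriv_def test_partial_derivs)

text \<open>Integration by parts: the difference quotients of a test function have mean zero.\<close>

lemma integral_partial_deriv_zero: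
  assumes \<psi>: "\<psi> \<in> test_functions (UNIV::(real^'n::finite) set)"
  shows "(LINT x|lborel. partial_deriv j \<psi> x) = 0"
proof -
  let ?e = "axis j 1 :: real^'n"
  let ?q = "\<lambda>n x. (real n + 1) * (\<psi> (x + (1 / (real n + 1)) *\<^sub>R ?e) - \<psi> x)"
  have sm: "smooth \<psi>" using \<psi> by (rule test_functionsD)
  have d: "partial_deriv j \<psi> \<in> test_functions UNIV" using \<psi> by (rule test_partial_deriv)
  obtain Bd where B: "0 \<le> Bd" "\<And>x. \<bar>partial_deriv j \<psi> x\<bar> \<le> Bd" using test_bounded[OF d] by blast
  from \<psi> obtain K where K: "compact K" "\<And>x. x \<notin> K \<Longrightarrow> \<psi> x = 0" by (rule test_functionsE) blast
  obtain R where R: "R > 0" "\<And>x. x \<in> K \<Longrightarrow> norm x \<le> R"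
    using compact_imp_bounded[OF K(1)] bounded_pos by blast
  have le1: "norm ((1 / (real n + 1)) *\<^sub>R ?e) \<le> 1" for n by simp
  have [measurable]: "\<psi> \<in> borel_measurable borel" "partial_deriv j \<psi> \<in> borel_measurable borel"
    using borel_test[OF \<psi>] borel_test[OF d] by auto
  have "(\<lambda>n. LINT x|lborel. ?q n x) \<longlonglongrightarrow> (LINT x|lborel. partial_deriv j \<psi> x)"
  \<comment> \<open>The steps have length at most 1, so all difference quotients vanish outside the
    ball of radius \<open>R + 1\<close>; inside it they are averages of the derivative and thus
    bounded by \<open>Bd\<close>.\<close>
  proof (rule integral_dominated_convergence[where w = "\<lambda>x. indicator (cball 0 (R + 1)) x *\<^sub>R Bd"])
    show "integrable lborel (\<lambda>x. indicator (cball 0 (R + 1)) x *\<^sub>R Bd)"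
      by (intro borel_integrable_compact) auto
    show "AE x in lborel. norm (?q n x) \<le> indicator (cball 0 (R + 1)) x *\<^sub>R Bd" for n
    proof (rule AE_I2)
      fix x
      show "norm (?q n x) \<le> indicator (cball 0 (R + 1)) x *\<^sub>R Bd"
      proof (cases "x \<in> cball 0 (R + 1)")
        case True
        have "\<psi> (x + (1 / (real n + 1)) *\<^sub>R ?e) - \<psi> x = integral {0..1 / (real n + 1)} (\<lambda>s. partial_deriv j \<psi> (x + s *\<^sub>R ?e))"
          using line_integral_partial_deriv[OF sm, of 0 "1 / (real n + 1)" j x] by simp
        also have "norm \<dots> \<le> Bd * (1 / (real n + 1) - 0)"
          using B by (intro integral_bound continuous_on_line smooth_partial_deriv sm) auto
        finally have "\<bar>\<psi> (x + (1 / (real n + 1)) *\<^sub>R ?e) - \<psi> x\<bar> * (real n + 1) \<le> Bd"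
          by (simp add: pos_le_divide_eq)
        then show ?thesis using True by (simp add: abs_mult mult.commute)
      next
        case False
        then have n: "R + 1 < norm x" by (simp add: dist_norm)
        have "norm x - 1 \<le> norm (x + (1 / (real n + 1)) *\<^sub>R ?e)"
          using norm_triangle_ineq2[of x "- ((1 / (real n + 1)) *\<^sub>R ?e)"] le1[of n] unfolding norm_minus_cancel diff_minus_eq_add by linarith
        then have "\<psi> (x + (1 / (real n + 1)) *\<^sub>R ?e) = 0" "\<psi> x = 0"
          using n R K(2) by (force intro: K(2))+
        then show ?thesis using B(1) by simp
      qed
    qed
    show "AE x in lborel. (\<lambda>n. ?q n x) \<longlonglongrightarrow> partial_deriv j \<psi> x"
    proof (rule AE_I2)
      fix x
      have "((\<lambda>s. \<psi> (x + s *\<^sub>R ?e)) has_real_derivative partial_deriv j \<psi> x) (at 0)"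
        using has_vector_derivative_line[OF sm, of x j 0 UNIV] by (simp add: has_real_derivative_iff_has_vector_derivative)
      then have l: "((\<lambda>h. (\<psi> (x + h *\<^sub>R ?e) - \<psi> x) / h) \<longlongrightarrow> partial_deriv j \<psi> x) (at 0)"
        by (simp add: DERIV_def)
      have "filterlim (\<lambda>n. 1 / (real n + 1)) (at 0) sequentially"
        using LIMSEQ_inverse_real_of_nat by (auto simp: filterlim_at inverse_eq_divide add.commute)
      from filterlim_compose[OF l this] show "(\<lambda>n. ?q n x) \<longlonglongrightarrow> partial_deriv j \<psi> x"
        by (simp add: mult.commute)
    qed
  qed measurable
  moreover have "(LINT x|lborel. ?q n x) = 0" for n
  proof -
    have i: "integrable lborel \<psi>" by (rule integrable_test_lborel[OF \<psi>])
    have t: "integrable lborel (\<lambda>x. \<psi> (x + v))" "(LINT x|lborel. \<psi> (x + v)) = (LINT x|lborel. \<psi> x)" for v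
      using integrable_distr_eq[of "(+) v" lborel borel \<psi>] integral_distr[of "(+) v" lborel borel \<psi>] i
      by (simp_all add: lborel_distr_plus add.commute)
    show ?thesis using i t by simp
  qed
  ultimately show ?thesis by (simp add: LIMSEQ_const_iff)
qed

text \<open>The product of a test function with a smooth function is a test function, so its
  derivative integrates to 0 and the product rule gives integration by parts, one letter at a time.
  Boundedness of \<open>U\<close> makes smooth functions square integrable.\<close>

lemma L2_deriv_smooth:
  fixes f :: "real^'n::finite \<Rightarrow> real"
  assumes f: "smooth f" and U: "open U" "bounded U"
  shows "L2_deriv U js f (partial_derivs js f)"
proof -
  have Us: "U \<in> sets lebesgue" using U(1) by simp
  have L2: "in_L2 (lebesgue_on U) g" if g: "smooth g" for g
  proof -
    have "integrable lborel (\<lambda>x. indicat_real (closure U) x *\<^sub>R (norm (g x))\<^sup>2)"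
      using U(2) by (intro borel_integrable_compact continuous_intros smooth_continuous g) (simp add: compact_closure)
    then have "integrable lebesgue (\<lambda>x. indicat_real (closure U) x *\<^sub>R (norm (g x))\<^sup>2)"
      by (subst integrable_completion) auto
    then have "set_integrable lebesgue (closure U) (\<lambda>x. (norm (g x))\<^sup>2)" by (simp add: set_integrable_def)
    then have "set_integrable lebesgue U (\<lambda>x. (norm (g x))\<^sup>2)"
      by (rule set_integrable_subset) (use Us closure_subset in auto)
    then have "integrable (lebesgue_on U) (\<lambda>x. (norm (g x))\<^sup>2)"
      using Us by (simp add: set_integrable_def integrable_restrict_space)
    then show ?thesis using continuous_imp_measurable_on_sets_lebesgue[OF smooth_continuous[OF g] Us] by (simp add: in_L2_def)
  qed
  have parts: "(LINT x|lebesgue_on U. partial_deriv j \<phi> x * g x) = - (LINT x|lebesgue_on U. \<phi> x * partial_deriv j g x)"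
    if \<phi>: "\<phi> \<in> test_functions U" and g: "smooth g" for \<phi> g j
  proof -
    have gp: "(\<lambda>x. g x * \<phi> x) \<in> test_functions U" by (rule test_mult[OF \<phi> g])
    have I: "integrable (lebesgue_on U) (\<lambda>x. \<phi> x * h x)" if "\<phi> \<in> test_functions U" "smooth h" for \<phi> h
      using in_L2_integrable_mult[OF in_L2_test[OF Us that(1)] L2[OF that(2)]] .
    have "0 = (LINT x|lborel. partial_deriv j (\<lambda>x. g x * \<phi> x) x)"
      using integral_partial_deriv_zero test_functions_mono[OF subset_UNIV] gp by (metis subsetD)
    also have "\<dots> = (LINT x|lebesgue_on U. partial_deriv j (\<lambda>x. g x * \<phi> x) x)"
      using test_partial_deriv[OF gp, of j]
      by (intro test_integral_lebesgue_on[symmetric] Us borel_test test_functionsD(2)[of _ U]) auto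
    also have "\<dots> = (LINT x|lebesgue_on U. partial_deriv j \<phi> x * g x + \<phi> x * partial_deriv j g x)"
      by (simp add: partial_deriv_mult smooth_differentiable g test_functionsD(1)[OF \<phi>] mult.commute add.commute)
    also have "\<dots> = (LINT x|lebesgue_on U. partial_deriv j \<phi> x * g x) + (LINT x|lebesgue_on U. \<phi> x * partial_deriv j g x)"
      by (intro Bochner_Integration.integral_add I test_partial_deriv \<phi> g smooth_partial_deriv)
    finally show ?thesis by simp
  qed
  have "(LINT x|lebesgue_on U. partial_derivs js \<phi> x * f x) = (-1) ^ length js * (LINT x|lebesgue_on U. \<phi> x * partial_derivs js f x)"
    if "\<phi> \<in> test_functions U" for \<phi>
    using that
  proof (induction js arbitrary: \<phi>)
    case (Cons j js)
    have "(LINT x|lebesgue_on U. partial_derivs (j # js) \<phi> x * f x) = (LINT x|lebesgue_on U. partial_derivs js (partial_deriv j \<phi>) x * f x)"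
      by (simp add: partial_derivs_commute1 test_functionsD(1)[OF Cons.prems])
    also have "\<dots> = (-1) ^ length js * (LINT x|lebesgue_on U. partial_deriv j \<phi> x * partial_derivs js f x)"
      by (rule Cons.IH[OF test_partial_deriv[OF Cons.prems]])
    finally show ?case using parts[OF Cons.prems smooth_partial_derivs[OF f]] by simp
  qed simp
  then show ?thesis by (simp add: L2_deriv_def L2 f smooth_partial_derivs)
qed

lemma in_L2_affine:
  fixes F :: "real^'n::finite \<Rightarrow> 'a::euclidean_space"
  assumes A: "affine_scaling B b c" and V: "V \<in> sets lebesgue" and F: "in_L2 (lebesgue_on (affine_map B b ` V)) F"
  shows "in_L2 (lebesgue_on V) (\<lambda>x. F (affine_map B b x))" "sqnorm V (\<lambda>x. F (affine_map B b x)) = c * sqnorm (affine_map B b ` V) F"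
proof -
  have m: "F \<in> borel_measurable (lebesgue_on (affine_map B b ` V))" and
    i: "integrable (lebesgue_on (affine_map B b ` V)) (\<lambda>x. (norm (F x))\<^sup>2)" using F by (auto simp: in_L2_def)
  show "in_L2 (lebesgue_on V) (\<lambda>x. F (affine_map B b x))"
    using borel_measurable_affine[OF A V m] integrable_affine[OF A V borel_measurable_integrable[OF i] i] by (simp add: in_L2_def)
  show "sqnorm V (\<lambda>x. F (affine_map B b x)) = c * sqnorm (affine_map B b ` V) F"
    using integral_affine[OF A V borel_measurable_integrable[OF i]] by simp
qed

lemma test_affine_inverse:
  assumes \<phi>: "\<phi> \<in> test_functions V" and inv: "\<And>x. affine_map B' b' (affine_map B b x) = x"
    "\<And>x. affine_map B b (affine_map B' b' x) = x"
  shows "(\<phi> \<circ> affine_map B' b') \<in> test_functions (affine_map B b ` V)"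
proof -
  from \<phi> obtain K where K: "compact K" "K \<subseteq> V" "\<And>x. x \<notin> K \<Longrightarrow> \<phi> x = 0" by (rule test_functionsE) blast
  show ?thesis
  proof (rule test_functionsI)
    show "smooth (\<phi> \<circ> affine_map B' b')" by (rule smooth_affine[OF test_functionsD(1)[OF \<phi>]])
    show "compact (affine_map B b ` K)" by (rule compact_continuous_image[OF continuous_affine_map K(1)])
    show "affine_map B b ` K \<subseteq> affine_map B b ` V" using K(2) by (rule image_mono)
    show "(\<phi> \<circ> affine_map B' b') x = 0" if "x \<notin> affine_map B b ` K" for x
      unfolding o_apply using that inv(2)[of x] by (intro K(3)) (metis imageI)
  qed
qed

text \<open>The chain rule falls on the test function: \<open>\<phi>\<close> is a test function
  \<open>\<phi>'\<close> on the image composed with the map, and there the rule is classical. The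
  factor \<open>c\<close> enters with the change of variables to the image and leaves with the
  change back.\<close>

lemma L2_deriv_affine:
  fixes F :: "real^'n::finite \<Rightarrow> 'a::euclidean_space"
  assumes A: "affine_scaling B b c" and V: "V \<in> sets lebesgue"
    and F: "\<And>is. length is = length js \<Longrightarrow> L2_deriv (affine_map B b ` V) is F (G is)"
  shows "L2_deriv V js (\<lambda>x. F (affine_map B b x)) (\<lambda>x. \<Sum>is | length is = length js. matrix_coeff B is js *\<^sub>R G is (affine_map B b x))"
  unfolding L2_deriv_def
proof (intro conjI ballI)
  let ?A = "affine_map B b" and ?S = "{is. length is = length js}"
  have FL: "in_L2 (lebesgue_on (?A ` V)) F" using L2_derivD(1)[OF F[OF refl]] .
  have AV: "?A ` V \<in> sets lebesgue"
    by (intro differentiable_image_in_sets_lebesgue affine_map_differentiable_on V) simp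
  show "in_L2 (lebesgue_on V) (\<lambda>x. F (?A x))" by (rule in_L2_affine(1)[OF A V FL])
  have GL: "in_L2 (lebesgue_on V) (\<lambda>x. G is (?A x))" if "is \<in> ?S" for "is"
    using that by (intro in_L2_affine(1)[OF A V] L2_derivD(2)[OF F]) simp
  then show "in_L2 (lebesgue_on V) (\<lambda>x. \<Sum>is\<in>?S. matrix_coeff B is js *\<^sub>R G is (?A x))"
    by (intro in_L2_sum in_L2_scaleR)
  have B: "invertible B" using A by (simp add: affine_scaling_def)
  obtain B' b' where inv: "\<And>x. affine_map B' b' (?A x) = x" "\<And>x. ?A (affine_map B' b' x) = x"
    using affine_map_inverse[OF B] by metis
  fix \<phi> assume \<phi>: "\<phi> \<in> test_functions V"
  define \<phi>' where "\<phi>' = \<phi> \<circ> affine_map B' b'"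
  have \<phi>': "\<phi>' \<in> test_functions (?A ` V)" unfolding \<phi>'_def by (rule test_affine_inverse[OF \<phi> inv])
  have \<phi>A: "\<phi> = \<phi>' \<circ> ?A" by (auto simp: \<phi>'_def inv)
  have cv: "(LINT x|lebesgue_on V. h (?A x) *\<^sub>R H (?A x)) = c *\<^sub>R (LINT x|lebesgue_on (?A ` V). h x *\<^sub>R H x)"
    if "h \<in> test_functions (?A ` V)" "in_L2 (lebesgue_on (?A ` V)) H" for h and H :: "real^'n \<Rightarrow> 'a"
    using integral_affine[OF A V borel_measurable_integrable[OF test_scaleR_integrable[OF that AV]]] .
  have int: "integrable (lebesgue_on V) (\<lambda>x. h (?A x) *\<^sub>R H (?A x))"
    if "h \<in> test_functions (?A ` V)" "in_L2 (lebesgue_on (?A ` V)) H" for h and H :: "real^'n \<Rightarrow> 'a"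
    using integrable_affine[OF A V borel_measurable_integrable[OF test_scaleR_integrable[OF that AV]] test_scaleR_integrable[OF that AV]] .
  have GL': "in_L2 (lebesgue_on (?A ` V)) (G is)" if "is \<in> ?S" for "is" using that by (intro L2_derivD(2)[OF F]) simp
  have "(LINT x|lebesgue_on V. partial_derivs js \<phi> x *\<^sub>R F (?A x)) =
      (LINT x|lebesgue_on V. (\<Sum>is\<in>?S. matrix_coeff B is js *\<^sub>R (partial_derivs is \<phi>' (?A x) *\<^sub>R F (?A x))))"
    unfolding \<phi>A partial_derivs_affine[OF test_functionsD(1)[OF \<phi>']] by (simp add: scaleR_sum_left)
  also have "\<dots> = (\<Sum>is\<in>?S. matrix_coeff B is js *\<^sub>R (LINT x|lebesgue_on V. partial_derivs is \<phi>' (?A x) *\<^sub>R F (?A x)))"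
    by (subst Bochner_Integration.integral_sum)
       (intro integrable_scaleR_right int[OF test_partial_derivs[OF \<phi>'] FL], simp only: integral_scaleR_right)
  also have "\<dots> = (\<Sum>is\<in>?S. matrix_coeff B is js *\<^sub>R c *\<^sub>R (LINT x|lebesgue_on (?A ` V). partial_derivs is \<phi>' x *\<^sub>R F x))"
    by (simp only: cv[OF test_partial_derivs[OF \<phi>'] FL])
  also have "\<dots> = (\<Sum>is\<in>?S. (-1) ^ length js *\<^sub>R matrix_coeff B is js *\<^sub>R c *\<^sub>R (LINT x|lebesgue_on (?A ` V). \<phi>' x *\<^sub>R G is x))"
    by (intro sum.cong refl) (simp add: L2_derivD(3)[OF F \<phi>'] mult_ac)
  also have "\<dots> = (\<Sum>is\<in>?S. (-1) ^ length js *\<^sub>R matrix_coeff B is js *\<^sub>R (LINT x|lebesgue_on V. \<phi>' (?A x) *\<^sub>R G is (?A x)))"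
    by (intro sum.cong refl) (simp only: cv[OF \<phi>' GL'])
  also have "\<dots> = (-1) ^ length js *\<^sub>R (LINT x|lebesgue_on V. (\<Sum>is\<in>?S. matrix_coeff B is js *\<^sub>R (\<phi>' (?A x) *\<^sub>R G is (?A x))))"
    by (subst Bochner_Integration.integral_sum)
       (intro integrable_scaleR_right int[OF \<phi>' GL'], assumption, simp only: integral_scaleR_right scaleR_sum_right)
  also have "\<dots> = (-1) ^ length js *\<^sub>R (LINT x|lebesgue_on V. \<phi> x *\<^sub>R (\<Sum>is\<in>?S. matrix_coeff B is js *\<^sub>R G is (?A x)))"
    by (simp add: \<phi>A scaleR_sum_right mult.commute)
  finally show "(LINT x|lebesgue_on V. partial_derivs js \<phi> x *\<^sub>R F (?A x)) =
    (-1) ^ length js *\<^sub>R (LINT x|lebesgue_on V. \<phi> x *\<^sub>R (\<Sum>is\<in>?S. matrix_coeff B is js *\<^sub>R G is (?A x)))" .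
qed

subsection \<open>Monomials\<close>

definition multi_power :: "('n::finite) multi_index \<Rightarrow> real^'n \<Rightarrow> real" where
  "multi_power \<alpha> x = (\<Prod>j\<in>UNIV. (x $ j) ^ \<alpha> j)"

lemma smooth_multi_power: "smooth (multi_power \<alpha>)"
  unfolding multi_power_def[abs_def]
  by (intro smooth_prod smooth_power smooth_linear bounded_linear_vec_nth)

text \<open>For \<open>\<alpha> i = 0\<close> the truncated exponent \<open>\<alpha> i - 1\<close>
  is harmless, since the factor in front is 0.\<close>

lemma partial_deriv_multi_power:
  fixes \<alpha> :: "'n::finite multi_index"
  shows "partial_deriv i (multi_power \<alpha>) = (\<lambda>x. real (\<alpha> i) * multi_power (\<alpha>(i := \<alpha> i - 1)) x)"
proof
  fix x :: "real^'n"
  let ?P = "\<Prod>j\<in>UNIV - {i}. (x $ j) ^ \<alpha> j"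
  have *: "(\<lambda>s. multi_power \<alpha> (x + s *\<^sub>R axis i 1)) = (\<lambda>s. (x $ i + s) ^ \<alpha> i * ?P)"
  proof
    fix s
    have "multi_power \<alpha> (x + s *\<^sub>R axis i 1) = ((x + s *\<^sub>R axis i 1) $ i) ^ \<alpha> i * (\<Prod>j\<in>UNIV - {i}. ((x + s *\<^sub>R axis i 1) $ j) ^ \<alpha> j)"
      unfolding multi_power_def by (rule prod.remove) auto
    also have "(\<Prod>j\<in>UNIV - {i}. ((x + s *\<^sub>R axis i 1) $ j) ^ \<alpha> j) = ?P"
      by (intro prod.cong) (auto simp: axis_def)
    finally show "multi_power \<alpha> (x + s *\<^sub>R axis i 1) = (x $ i + s) ^ \<alpha> i * ?P" by simp
  qed
  have "((\<lambda>s. multi_power \<alpha> (x + s *\<^sub>R axis i 1)) has_real_derivative partial_deriv i (multi_power \<alpha>) x) (at 0)"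
    using has_vector_derivative_line[OF smooth_multi_power, of \<alpha> x i 0 UNIV]
    by (simp add: has_real_derivative_iff_has_vector_derivative)
  moreover have "((\<lambda>s. (x $ i + s) ^ \<alpha> i * ?P) has_real_derivative (real (\<alpha> i) * (x $ i) ^ (\<alpha> i - 1) * ?P)) (at 0)"
    by (auto intro!: derivative_eq_intros)
  ultimately have "partial_deriv i (multi_power \<alpha>) x = real (\<alpha> i) * (x $ i) ^ (\<alpha> i - 1) * ?P"
    unfolding * by (rule DERIV_unique)
  also have "\<dots> = real (\<alpha> i) * multi_power (\<alpha>(i := \<alpha> i - 1)) x"
    unfolding multi_power_def by (subst prod.remove[of UNIV i]) (auto simp: mult.assoc)
  finally show "partial_deriv i (multi_power \<alpha>) x = real (\<alpha> i) * multi_power (\<alpha>(i := \<alpha> i - 1)) x" .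
qed

lemma partial_derivs_cmult:
  "smooth f \<Longrightarrow> partial_derivs js (\<lambda>x. c * f x) = (\<lambda>x. c * partial_derivs js f x)"
proof (induction js)
  case (Cons j js)
  have "partial_deriv j (\<lambda>x. c * partial_derivs js f x) = (\<lambda>x. c * partial_deriv j (partial_derivs js f) x)"
    using Cons.prems by (intro ext partial_deriv_cmult smooth_differentiable smooth_partial_derivs)
  then show ?case using Cons by simp
qed simp

text \<open>Words at least as long as the degree differentiate a monomial to a constant, which makes
  the matrix of moments triangular. The induction runs from the end of the word because its last
  letter acts on the monomial first.\<close>

lemma partial_derivs_multi_power:
  "morder \<alpha> \<le> length js \<Longrightarrow>
   partial_derivs js (multi_power \<alpha>) = (\<lambda>x. if count_list js = \<alpha> then \<Prod>j\<in>UNIV. fact (\<alpha> j) else 0)"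
proof (induction js arbitrary: \<alpha> rule: rev_induct)
  case Nil
  then have "\<alpha> = (\<lambda>_. 0)" by (auto simp: morder_def)
  then show ?case by (simp add: multi_power_def fun_eq_iff)
next
  case (snoc i js)
  let ?\<alpha>' = "\<alpha>(i := \<alpha> i - 1)"
  have eq: "partial_derivs (js @ [i]) (multi_power \<alpha>) = (\<lambda>x. real (\<alpha> i) * partial_derivs js (multi_power ?\<alpha>') x)"
    by (simp add: partial_deriv_multi_power partial_derivs_cmult smooth_multi_power)
  show ?case
  proof (cases "\<alpha> i = 0")
    case True
    then have "count_list (js @ [i]) i \<noteq> \<alpha> i" by simp
    then have "count_list (js @ [i]) \<noteq> \<alpha>" by metis
    then show ?thesis unfolding eq by (simp only: True if_False of_nat_0 mult_zero_left)
  next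
    case False
    have "morder \<alpha> = \<alpha> i + (\<Sum>j\<in>UNIV - {i}. \<alpha> j)" "morder ?\<alpha>' = (\<alpha> i - 1) + (\<Sum>j\<in>UNIV - {i}. \<alpha> j)"
      unfolding morder_def by (subst sum.remove[of UNIV i]; simp)+
    then have "morder ?\<alpha>' \<le> length js" using snoc.prems False by simp
    note IH = snoc.IH[OF this]
    have c: "count_list (js @ [i]) = \<alpha> \<longleftrightarrow> count_list js = ?\<alpha>'"
      using False by (auto simp: fun_eq_iff split: if_splits)
    have "(\<Prod>j\<in>UNIV. fact (\<alpha> j)) = fact (\<alpha> i) * (\<Prod>j\<in>UNIV - {i}. fact (\<alpha> j) :: real)"
      by (rule prod.remove) auto
    moreover have "(\<Prod>j\<in>UNIV. fact (?\<alpha>' j)) = fact (\<alpha> i - 1) * (\<Prod>j\<in>UNIV - {i}. fact (\<alpha> j) :: real)"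
      by (subst prod.remove[of UNIV i]) auto
    moreover have "fact (\<alpha> i) = real (\<alpha> i) * fact (\<alpha> i - 1)" using False by (simp add: fact_reduce)
    ultimately have "(\<Prod>j\<in>UNIV. fact (\<alpha> j)) = real (\<alpha> i) * (\<Prod>j\<in>UNIV. fact (?\<alpha>' j))"
      by (simp only: mult.assoc)
    then show ?thesis unfolding eq IH c by (simp only:) (rule ext, simp)
  qed
qed

text \<open>Back substitution from the highest order down. Within one order the matrix is diagonal,
  so the coefficients \<open>d\<close> of order \<open>k\<close> can be read off; their contribution
  is moved to the right side of the equations of lower order, whence the generalisation over
  \<open>M\<close>.\<close>

lemma triangular_system:
  fixes E :: "('n::finite) multi_index \<Rightarrow> 'n multi_index \<Rightarrow> real" and M :: "'n multi_index \<Rightarrow> 'a::real_vector"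
  assumes E0: "\<And>\<alpha> \<beta>. morder \<alpha> \<le> morder \<beta> \<Longrightarrow> \<beta> \<noteq> \<alpha> \<Longrightarrow> E \<beta> \<alpha> = 0" and E1: "\<And>\<alpha>. E \<alpha> \<alpha> \<noteq> 0"
  shows "\<exists>c. \<forall>\<beta>. morder \<beta> < k \<longrightarrow> (\<Sum>\<alpha> | morder \<alpha> < k. E \<beta> \<alpha> *\<^sub>R c \<alpha>) = M \<beta>"
proof (induction k arbitrary: M)
  case (Suc k)
  define d where "d \<alpha> = (1 / E \<alpha> \<alpha>) *\<^sub>R M \<alpha>" for \<alpha>
  have fin: "finite {\<alpha>::'n multi_index. morder \<alpha> < k}"
    by (rule finite_subset[OF _ finite_multi_index[of k]]) auto
  obtain c where c: "\<And>\<beta>. morder \<beta> < k \<Longrightarrow>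
      (\<Sum>\<alpha> | morder \<alpha> < k. E \<beta> \<alpha> *\<^sub>R c \<alpha>) = M \<beta> - (\<Sum>\<alpha> | morder \<alpha> = k. E \<beta> \<alpha> *\<^sub>R d \<alpha>)"
    using Suc[of "\<lambda>\<beta>. M \<beta> - (\<Sum>\<alpha> | morder \<alpha> = k. E \<beta> \<alpha> *\<^sub>R d \<alpha>)"] by auto
  define e where "e \<alpha> = (if morder \<alpha> < k then c \<alpha> else d \<alpha>)" for \<alpha>
  show ?case
  proof (intro exI[of _ e] allI impI)
    fix \<beta> :: "'n multi_index" assume \<beta>: "morder \<beta> < Suc k"
    have "{\<alpha>::'n multi_index. morder \<alpha> < Suc k} = {\<alpha>. morder \<alpha> < k} \<union> {\<alpha>. morder \<alpha> = k}" by auto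
    then have "(\<Sum>\<alpha> | morder \<alpha> < Suc k. E \<beta> \<alpha> *\<^sub>R e \<alpha>) =
        (\<Sum>\<alpha> | morder \<alpha> < k. E \<beta> \<alpha> *\<^sub>R e \<alpha>) + (\<Sum>\<alpha> | morder \<alpha> = k. E \<beta> \<alpha> *\<^sub>R e \<alpha>)"
      using fin finite_multi_index_eq[where 'n = 'n, of k] by (simp only:, subst sum.union_disjoint) auto
    also have "(\<Sum>\<alpha> | morder \<alpha> < k. E \<beta> \<alpha> *\<^sub>R e \<alpha>) = (\<Sum>\<alpha> | morder \<alpha> < k. E \<beta> \<alpha> *\<^sub>R c \<alpha>)"
      by (intro sum.cong) (auto simp: e_def)
    also have "(\<Sum>\<alpha> | morder \<alpha> = k. E \<beta> \<alpha> *\<^sub>R e \<alpha>) = (\<Sum>\<alpha> | morder \<alpha> = k. E \<beta> \<alpha> *\<^sub>R d \<alpha>)"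
      by (intro sum.cong) (auto simp: e_def)
    finally have eq: "(\<Sum>\<alpha> | morder \<alpha> < Suc k. E \<beta> \<alpha> *\<^sub>R e \<alpha>) =
        (\<Sum>\<alpha> | morder \<alpha> < k. E \<beta> \<alpha> *\<^sub>R c \<alpha>) + (\<Sum>\<alpha> | morder \<alpha> = k. E \<beta> \<alpha> *\<^sub>R d \<alpha>)" .
    show "(\<Sum>\<alpha> | morder \<alpha> < Suc k. E \<beta> \<alpha> *\<^sub>R e \<alpha>) = M \<beta>"
    proof (cases "morder \<beta> < k")
      case True then show ?thesis using c eq by simp
    next
      case False
      then have \<beta>k: "morder \<beta> = k" using \<beta> by simp
      have "(\<Sum>\<alpha> | morder \<alpha> < k. E \<beta> \<alpha> *\<^sub>R c \<alpha>) = 0"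
        using \<beta>k by (intro sum.neutral) (auto intro!: E0)
      moreover have "(\<Sum>\<alpha> | morder \<alpha> = k. E \<beta> \<alpha> *\<^sub>R d \<alpha>) = (\<Sum>\<alpha>\<in>{\<beta>}. E \<beta> \<alpha> *\<^sub>R d \<alpha>)"
        using \<beta>k finite_multi_index_eq[where 'n = 'n, of k] by (intro sum.mono_neutral_right) (auto intro!: E0)
      ultimately show ?thesis using eq E1[of \<beta>] by (simp add: d_def)
    qed
  qed
qed simp

subsection \<open>The Bramble--Hilbert lemma on a box\<close>

lemma sqnorm_sum_Basis:
  fixes w :: "real^'n::finite \<Rightarrow> 'a::euclidean_space"
  assumes "in_L2 (lebesgue_on U) w"
  shows "sqnorm U w = (\<Sum>e\<in>Basis. sqnorm U (\<lambda>x. w x \<bullet> e))"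
proof -
  have "(norm y)\<^sup>2 = (\<Sum>e\<in>Basis. (norm (y \<bullet> e))\<^sup>2)" for y :: 'a
    unfolding power2_norm_eq_inner[of y] euclidean_inner[of y y] by (simp add: power2_eq_square)
  then have "sqnorm U w = (LINT x|lebesgue_on U. (\<Sum>e\<in>Basis. (norm (w x \<bullet> e))\<^sup>2))"
    by (simp only:)
  also have "\<dots> = (\<Sum>e\<in>Basis. sqnorm U (\<lambda>x. w x \<bullet> e))"
    using in_L2_inner[OF assms] by (intro Bochner_Integration.integral_sum) (simp add: in_L2_def)
  finally show ?thesis .
qed

text \<open>The real case applies to each coordinate \<open>w x \<bullet> e\<close>. Squared norms
  add up over \<open>Basis\<close>, so the constant is kept.\<close>

lemma poincare_box_euclidean:
  fixes a b :: "real^'n::finite"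
  assumes ab: "\<And>j. a $ j < b $ j"
  obtains \<eta> :: "real^'n \<Rightarrow> real" and C where "\<eta> \<in> test_functions (box a b)" "(LINT x|lebesgue_on (box a b). \<eta> x) \<noteq> 0" "0 \<le> C"
    "\<And>w g. (\<And>j. L2_deriv (box a b) [j] w (g j)) \<Longrightarrow> (LINT x|lebesgue_on (box a b). \<eta> x *\<^sub>R w x) = 0 \<Longrightarrow>
       sqnorm (box a b) w \<le> C * (\<Sum>j\<in>UNIV. sqnorm (box a b) (g j :: real^'n \<Rightarrow> 'a::euclidean_space))"
proof -
  let ?U = "box a b" and ?M = "lebesgue_on (box a b)"
  have U: "?U \<in> sets lebesgue" by simp
  obtain \<eta> :: "real^'n \<Rightarrow> real" and C where \<eta>: "\<eta> \<in> test_functions ?U" "(LINT x|?M. \<eta> x) \<noteq> 0" "0 \<le> C"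
    and P: "\<And>u g. in_L2 ?M u \<Longrightarrow> (\<And>j. in_L2 ?M (g j)) \<Longrightarrow>
       (\<And>j \<phi>. \<phi> \<in> test_functions ?U \<Longrightarrow> (LINT x|?M. partial_deriv j \<phi> x * u x) = - (LINT x|?M. \<phi> x * g j x)) \<Longrightarrow>
       (LINT x|?M. \<eta> x * u x) = 0 \<Longrightarrow> sqnorm ?U u \<le> C * (\<Sum>j\<in>UNIV. sqnorm ?U (g j))"
  proof (rule poincare_box[OF ab], goal_cases)
    case (1 \<eta> C)
    show ?case by (rule 1(1)) (fact 1)+
  qed
  show thesis
  proof (rule that[OF \<eta>])
    fix w :: "real^'n \<Rightarrow> 'a" and g
    assume w: "\<And>j. L2_deriv ?U [j] w (g j)" and mean: "(LINT x|?M. \<eta> x *\<^sub>R w x) = 0"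
    have wL: "in_L2 ?M w" and gL: "in_L2 ?M (g j)" for j using L2_derivD(1,2)[OF w] by auto
    have "sqnorm ?U (\<lambda>x. w x \<bullet> e) \<le> C * (\<Sum>j\<in>UNIV. sqnorm ?U (\<lambda>x. g j x \<bullet> e))" if e: "e \<in> Basis" for e
    proof (rule P)
      have we: "L2_deriv ?U [j] (\<lambda>x. w x \<bullet> e) (\<lambda>x. g j x \<bullet> e)" for j
        by (rule L2_deriv_linear[OF U w bounded_linear_inner_left])
      show "in_L2 ?M (\<lambda>x. w x \<bullet> e)" "in_L2 ?M (\<lambda>x. g j x \<bullet> e)" for j using L2_derivD(1,2)[OF we] by auto
      show "(LINT x|?M. partial_deriv j \<phi> x * (w x \<bullet> e)) = - (LINT x|?M. \<phi> x * (g j x \<bullet> e))"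
        if "\<phi> \<in> test_functions ?U" for j \<phi> using L2_derivD(3)[OF we that, of j] by simp
      have "(LINT x|?M. (\<eta> x *\<^sub>R w x) \<bullet> e) = (LINT x|?M. \<eta> x *\<^sub>R w x) \<bullet> e"
        by (intro integral_inner_left test_scaleR_integrable \<eta> wL U)
      then show "(LINT x|?M. \<eta> x * (w x \<bullet> e)) = 0" by (simp add: mean)
    qed
    then have "sqnorm ?U w \<le> (\<Sum>e\<in>Basis. C * (\<Sum>j\<in>UNIV. sqnorm ?U (\<lambda>x. g j x \<bullet> e)))"
      unfolding sqnorm_sum_Basis[OF wL] by (rule sum_mono)
    also have "\<dots> = C * (\<Sum>j\<in>UNIV. \<Sum>e\<in>Basis. sqnorm ?U (\<lambda>x. g j x \<bullet> e))"
      by (simp only: sum_distrib_left[symmetric] sum.swap[of _ UNIV Basis])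
    also have "\<dots> = C * (\<Sum>j\<in>UNIV. sqnorm ?U (g j))" by (simp only: sqnorm_sum_Basis[OF gL])
    finally show "sqnorm ?U w \<le> C * (\<Sum>j\<in>UNIV. sqnorm ?U (g j))" .
  qed
qed

theorem bramble_hilbert:
  fixes a b :: "real^'n::finite"
  assumes ab: "\<And>j. a $ j < b $ j"
  obtains C where "0 \<le> C"
    "\<And>v V. (\<And>js. length js \<le> k + 1 \<Longrightarrow> L2_deriv (box a b) js v (V js)) \<Longrightarrow>
      \<exists>p Dp. (\<forall>S. p \<in> poly_space k S) \<and> (\<forall>js. L2_deriv (box a b) js p (Dp js)) \<and>
        (\<forall>js. length js \<le> k + 1 \<longrightarrow> sqnorm (box a b) (\<lambda>x. V js x - Dp js x) \<le>
           C * (\<Sum>is | length is = k + 1. sqnorm (box a b) (V is :: real^'n \<Rightarrow> 'a::{real_normed_field, euclidean_space})))"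
proof -
  let ?U = "box a b" and ?M = "lebesgue_on (box a b)"
  have U: "?U \<in> sets lebesgue" by simp
  obtain \<eta> :: "real^'n \<Rightarrow> real" and C where \<eta>: "\<eta> \<in> test_functions ?U" "(LINT x|?M. \<eta> x) \<noteq> 0" and C: "0 \<le> C"
    and P: "\<And>w g. (\<And>j. L2_deriv ?U [j] w (g j)) \<Longrightarrow> (LINT x|?M. \<eta> x *\<^sub>R w x) = 0 \<Longrightarrow>
       sqnorm ?U w \<le> C * (\<Sum>j\<in>UNIV. sqnorm ?U (g j :: real^'n \<Rightarrow> 'a))"
  proof (rule poincare_box_euclidean[OF ab, where 'a = 'a], goal_cases)
    case (1 \<eta> C)
    show ?case by (rule 1(1)) (fact 1)+
  qed
  \<comment> \<open>Being at least 1, \<open>D\<close> has increasing powers, so the single bound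
    \<open>D ^ (k + 1)\<close> serves all orders.\<close>
  define D where "D = max 1 C"
  have D: "1 \<le> D" "C \<le> D" by (auto simp: D_def)
  show thesis
  proof (rule that[of "D ^ (k + 1)"])
    show "0 \<le> D ^ (k + 1)" using D by simp
    fix v and V :: "'n list \<Rightarrow> real^'n \<Rightarrow> 'a"
    assume V: "\<And>js. length js \<le> k + 1 \<Longrightarrow> L2_deriv ?U js v (V js)"
    \<comment> \<open>The weighted means that the derivatives of \<open>p\<close> have to match.
      Shifting the derivative onto \<open>\<eta>\<close> makes them depend on the multi-index alone,
      whichever function \<open>V js\<close> represents the derivative; this allows one equation per
      multi-index.\<close>
    define Mo :: "'n multi_index \<Rightarrow> 'a" where "Mo \<beta> = (-1) ^ morder \<beta> *\<^sub>R (LINT x|?M. mixed_partial \<beta> \<eta> x *\<^sub>R v x)" for \<beta>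
    define E where "E \<beta> \<alpha> = (LINT x|?M. \<eta> x * mixed_partial \<beta> (multi_power \<alpha>) x)" for \<beta> \<alpha> :: "'n multi_index"
    have Elist: "E (count_list js) \<alpha> = (LINT x|?M. \<eta> x * partial_derivs js (multi_power \<alpha>) x)" for js \<alpha>
      by (simp add: E_def mixed_partial_count_list smooth_multi_power)
    have E: "E \<beta> \<alpha> = (if \<beta> = \<alpha> then (LINT x|?M. \<eta> x) * (\<Prod>j\<in>UNIV. fact (\<alpha> j)) else 0)" if "morder \<alpha> \<le> morder \<beta>" for \<alpha> \<beta>
    proof -
      obtain js where js: "\<beta> = count_list js" "length js = morder \<beta>" by (rule ex_list_multi_index)
      then show ?thesis using that by (simp add: js(1) Elist partial_derivs_multi_power morder_count_list)
    qed
    have "E \<beta> \<alpha> = 0" if "morder \<alpha> \<le> morder \<beta>" "\<beta> \<noteq> \<alpha>" for \<alpha> \<beta> using that by (simp add: E)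
    moreover have "E \<alpha> \<alpha> \<noteq> 0" for \<alpha> using \<eta>(2) by (simp add: E)
    ultimately obtain c where c: "\<And>\<beta>. morder \<beta> < k + 1 \<Longrightarrow> (\<Sum>\<alpha> | morder \<alpha> < k + 1. E \<beta> \<alpha> *\<^sub>R c \<alpha>) = Mo \<beta>"
      using triangular_system[of E "k + 1" Mo] by blast
    let ?I = "{\<alpha>::'n multi_index. morder \<alpha> < k + 1}"
    have I: "finite ?I" by (rule finite_subset[OF _ finite_multi_index[of k]]) auto
    define p where "p x = (\<Sum>\<alpha>\<in>?I. multi_power \<alpha> x *\<^sub>R c \<alpha>)" for x
    define Dp where "Dp js x = (\<Sum>\<alpha>\<in>?I. partial_derivs js (multi_power \<alpha>) x *\<^sub>R c \<alpha>)" for js x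
    define W where "W js x = V js x - Dp js x" for js x
    have p: "L2_deriv ?U js p (Dp js)" for js
      unfolding p_def[abs_def] Dp_def[abs_def]
      by (intro L2_deriv_sum U L2_deriv_linear[OF U L2_deriv_smooth[OF smooth_multi_power open_box bounded_box]] bounded_linear_scaleR_left)
    have W: "L2_deriv ?U js (\<lambda>x. v x - p x) (W js)" if "length js \<le> k + 1" for js
      unfolding W_def[abs_def] by (intro L2_deriv_diff U V that p)
    have mean: "(LINT x|?M. \<eta> x *\<^sub>R W js x) = 0" if js: "length js \<le> k" for js
    proof -
      have VL: "in_L2 ?M (V js)" using js by (intro L2_derivD(2)[OF V]) simp
      have "(LINT x|?M. \<eta> x *\<^sub>R V js x) = Mo (count_list js)"
        using L2_derivD(3)[OF V \<eta>(1), of js] js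
        by (simp add: Mo_def morder_count_list mixed_partial_count_list test_functionsD(1)[OF \<eta>(1)] power_mult_distrib[symmetric])
      moreover have "(LINT x|?M. \<eta> x *\<^sub>R Dp js x) = (\<Sum>\<alpha>\<in>?I. E (count_list js) \<alpha> *\<^sub>R c \<alpha>)"
      proof -
        have int: "integrable ?M (\<lambda>x. \<eta> x * partial_derivs js (multi_power \<alpha>) x)" for \<alpha>
          by (intro in_L2_integrable_mult in_L2_test[OF U \<eta>(1)] L2_derivD(2)[OF L2_deriv_smooth[OF smooth_multi_power open_box bounded_box]])
        have "(LINT x|?M. \<eta> x *\<^sub>R Dp js x) = (LINT x|?M. (\<Sum>\<alpha>\<in>?I. (\<eta> x * partial_derivs js (multi_power \<alpha>) x) *\<^sub>R c \<alpha>))"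
          by (simp add: Dp_def scaleR_sum_right)
        also have "\<dots> = (\<Sum>\<alpha>\<in>?I. LINT x|?M. (\<eta> x * partial_derivs js (multi_power \<alpha>) x) *\<^sub>R c \<alpha>)"
          by (intro Bochner_Integration.integral_sum integrable_scaleR_left int)
        also have "\<dots> = (\<Sum>\<alpha>\<in>?I. E (count_list js) \<alpha> *\<^sub>R c \<alpha>)"
          by (intro sum.cong refl) (simp only: Elist integral_scaleR_left[OF int])
        finally show ?thesis .
      qed
      moreover have "(\<Sum>\<alpha>\<in>?I. E (count_list js) \<alpha> *\<^sub>R c \<alpha>) = Mo (count_list js)"
        using js by (intro c) (simp add: morder_count_list)
      moreover have "(LINT x|?M. \<eta> x *\<^sub>R W js x) = (LINT x|?M. \<eta> x *\<^sub>R V js x) - (LINT x|?M. \<eta> x *\<^sub>R Dp js x)"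
        unfolding W_def scaleR_diff_right
        by (intro Bochner_Integration.integral_diff test_scaleR_integrable U \<eta> VL L2_derivD(2)[OF p])
      ultimately show ?thesis by simp
    qed
    define T where "T l = (\<Sum>js | length js = l. sqnorm ?U (W js))" for l
    have T0: "0 \<le> T l" for l unfolding T_def by (intro sum_nonneg) simp
    \<comment> \<open>The gradient of a derivative of order \<open>l\<close> consists of the
      derivatives whose word has one more letter in front. The means vanish for words up to length
      \<open>k\<close>, so the iteration ends at order \<open>k + 1\<close>.\<close>
    have Tstep: "T l \<le> D * T (Suc l)" if l: "l \<le> k" for l
    proof -
      have "T l \<le> (\<Sum>js | length js = l. C * (\<Sum>j\<in>UNIV. sqnorm ?U (W (j # js))))"
        unfolding T_def
      proof (rule sum_mono)
        fix js :: "'n list" assume "js \<in> {js. length js = l}"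
        then have js: "length js = l" by simp
        show "sqnorm ?U (W js) \<le> C * (\<Sum>j\<in>UNIV. sqnorm ?U (W (j # js)))"
        proof (rule P)
          show "L2_deriv ?U [j] (W js) (W (j # js))" for j using js l by (intro L2_deriv_step[OF U W W]) auto
        qed (use js l in \<open>simp add: mean\<close>)
      qed
      also have "\<dots> = C * T (Suc l)"
        unfolding T_def sum_lists_Suc by (subst sum.swap) (simp only: sum_distrib_left[symmetric])
      also have "\<dots> \<le> D * T (Suc l)" by (intro mult_right_mono D T0)
      finally show ?thesis .
    qed
    have T: "T l \<le> D ^ (k + 1 - l) * T (k + 1)" if "l \<le> k + 1" for l
      using that
    proof (induction l rule: inc_induct)
      case (step l)
      have "T l \<le> D * T (Suc l)" using step.hyps by (intro Tstep) simp
      also have "\<dots> \<le> D * (D ^ (k + 1 - Suc l) * T (k + 1))" using D step.IH by (intro mult_left_mono) auto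
      also have "\<dots> = D ^ Suc (k + 1 - Suc l) * T (k + 1)" by simp
      also have "Suc (k + 1 - Suc l) = k + 1 - l" using step.hyps by simp
      finally show ?case .
    qed simp
    \<comment> \<open>Derivatives of order \<open>k + 1\<close> annihilate \<open>p\<close>, so the
      last term of the iteration involves \<open>v\<close> alone.\<close>
    have top: "T (k + 1) = (\<Sum>is | length is = k + 1. sqnorm ?U (V is))"
      unfolding T_def
    proof (rule sum.cong[OF refl])
      fix js :: "'n list" assume "js \<in> {js. length js = k + 1}"
      then have "Dp js x = 0" for x
        unfolding Dp_def by (intro sum.neutral) (auto simp: partial_derivs_multi_power morder_count_list)
      then show "sqnorm ?U (W js) = sqnorm ?U (V js)" by (simp add: W_def)
    qed
    show "\<exists>p Dp. (\<forall>S. p \<in> poly_space k S) \<and> (\<forall>js. L2_deriv ?U js p (Dp js)) \<and>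
        (\<forall>js. length js \<le> k + 1 \<longrightarrow> sqnorm ?U (\<lambda>x. V js x - Dp js x) \<le> D ^ (k + 1) * (\<Sum>is | length is = k + 1. sqnorm ?U (V is)))"
    proof (intro exI[of _ p] exI[of _ Dp] conjI allI impI p)
      show "p \<in> poly_space k S" for S
        unfolding poly_space_def p_def multi_power_def by (auto simp: less_Suc_eq_le intro!: exI[of _ c])
      fix js :: "'n list" assume js: "length js \<le> k + 1"
      have "sqnorm ?U (W js) \<le> T (length js)"
        unfolding T_def by (rule member_le_sum) (auto simp: finite_lists_length)
      also have "\<dots> \<le> D ^ (k + 1 - length js) * T (k + 1)" by (rule T[OF js])
      also have "\<dots> \<le> D ^ (k + 1) * T (k + 1)" by (intro mult_right_mono power_increasing T0 D) simp
      finally show "sqnorm ?U (\<lambda>x. V js x - Dp js x) \<le> D ^ (k + 1) * (\<Sum>is | length is = k + 1. sqnorm ?U (V is))"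
        unfolding W_def[abs_def] top .
    qed
  qed
qed

subsection \<open>Sobolev norms\<close>

text \<open>By uniqueness almost everywhere, the derivative chosen by \<open>weak_deriv\<close> may
  be exchanged for any explicit one when norms are computed. All passages between Sobolev norms and
  \<open>L2_deriv\<close> rest on this.\<close>

lemma weak_deriv_L2_deriv:
  fixes F :: "real^'n::finite \<Rightarrow> 'a::{real_normed_field, euclidean_space}"
  assumes U: "open U" and G: "L2_deriv U js F G"
  shows "L2_deriv U js F (weak_deriv U (count_list js) F)" "sqnorm U (weak_deriv U (count_list js) F) = sqnorm U G"
proof -
  have Us: "U \<in> sets lebesgue" using U by simp
  let ?W = "weak_deriv U (count_list js) F"
  have 1: "has_weak_deriv U (count_list js) F G" using G L2_deriv_iff[OF Us] by blast
  then have 2: "has_weak_deriv U (count_list js) F ?W" unfolding weak_deriv_def by (rule someI[of "has_weak_deriv U (count_list js) F"])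
  note c = in_L2_AE_cong[OF Us L2_derivD(2)[OF G] has_weak_deriv_unique[OF U 1 2]]
  show "L2_deriv U js F ?W" using c(1) L2_derivD(1)[OF G] 2 L2_deriv_iff[OF Us] by blast
  show "sqnorm U ?W = sqnorm U G" by (rule c(2)[symmetric])
qed

lemma sobolev_imp_L2_deriv:
  fixes F :: "real^'n::finite \<Rightarrow> 'a::{real_normed_field, euclidean_space}"
  assumes F: "F \<in> sobolev p S" and js: "length js \<le> p"
  shows "L2_deriv (interior S) js F (weak_deriv (interior S) (count_list js) F)"
proof -
  have Us: "interior S \<in> sets lebesgue" by simp
  have "\<exists>G. has_weak_deriv (interior S) (count_list js) F G \<and> L2_on (interior S) G"
    using F js morder_count_list[of js] by (simp add: sobolev_def)
  then obtain G where "has_weak_deriv (interior S) (count_list js) F G" "L2_on (interior S) G" by blast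
  then have "L2_deriv (interior S) js F G"
    using F by (auto simp: L2_deriv_iff[OF Us] L2_on_iff[OF Us, symmetric] sobolev_def)
  then show ?thesis by (rule weak_deriv_L2_deriv(1)[OF open_interior])
qed

lemma L2_deriv_imp_sobolev:
  fixes F :: "real^'n::finite \<Rightarrow> 'a::{real_normed_field, euclidean_space}"
  assumes G: "\<And>js. length js \<le> m \<Longrightarrow> L2_deriv (interior S) js F (G js)"
  shows "F \<in> sobolev m S"
proof -
  have Us: "interior S \<in> sets lebesgue" by simp
  have "\<exists>H. has_weak_deriv (interior S) \<alpha> F H \<and> L2_on (interior S) H" if \<alpha>: "morder \<alpha> \<le> m" for \<alpha>
  proof -
    obtain js where "\<alpha> = count_list js" "length js = morder \<alpha>" by (rule ex_list_multi_index)
    with G[of js] \<alpha> show ?thesis by (auto simp: L2_deriv_iff[OF Us] L2_on_iff[OF Us])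
  qed
  moreover have "L2_on (interior S) F" using L2_derivD(1)[OF G[of "[]"]] by (simp add: L2_on_iff[OF Us])
  ultimately show ?thesis by (simp add: sobolev_def)
qed

text \<open>Every multi-index is the count of some word, so bounds for words suffice; the
  cardinality is the number of terms in the norm.\<close>

lemma sobolev_norm_sq_le:
  fixes F :: "real^'n::finite \<Rightarrow> 'a::{real_normed_field, euclidean_space}" and q :: real
  assumes "\<And>js. length js \<le> m \<Longrightarrow> L2_deriv (interior S) js F (G js)" "\<And>js. length js \<le> m \<Longrightarrow> sqnorm (interior S) (G js) \<le> q"
  shows "(sobolev_norm m S F)\<^sup>2 \<le> card {\<alpha>::'n multi_index. morder \<alpha> \<le> m} * q"
proof -
  have Us: "interior S \<in> sets lebesgue" by simp
  have "sqnorm (interior S) (weak_deriv (interior S) \<alpha> F) \<le> q" if \<alpha>: "morder \<alpha> \<le> m" for \<alpha>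
  proof -
    obtain js where "\<alpha> = count_list js" "length js = morder \<alpha>" by (rule ex_list_multi_index)
    with weak_deriv_L2_deriv(2)[OF open_interior assms(1)[of js]] assms(2)[of js] \<alpha> show ?thesis by simp
  qed
  then have "(\<Sum>\<alpha> | morder \<alpha> \<le> m. sqnorm (interior S) (weak_deriv (interior S) \<alpha> F)) \<le> (\<Sum>\<alpha>::'n multi_index | morder \<alpha> \<le> m. q)"
    by (intro sum_mono) simp
  then show ?thesis by (simp add: sobolev_norm_def L2_norm_on_sq[OF Us] sum_nonneg)
qed

lemma sqnorm_le_sobolev_norm:
  fixes F :: "real^'n::finite \<Rightarrow> 'a::{real_normed_field, euclidean_space}"
  assumes js: "length js \<le> m"
  shows "sqnorm (interior S) (weak_deriv (interior S) (count_list js) F) \<le> (sobolev_norm m S F)\<^sup>2"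
proof -
  have Us: "interior S \<in> sets lebesgue" by simp
  have "sqnorm (interior S) (weak_deriv (interior S) (count_list js) F) \<le>
      (\<Sum>\<alpha> | morder \<alpha> \<le> m. sqnorm (interior S) (weak_deriv (interior S) \<alpha> F))"
    using js by (intro member_le_sum) (auto simp: finite_multi_index morder_count_list)
  then show ?thesis by (simp add: sobolev_norm_def L2_norm_on_sq[OF Us] sum_nonneg)
qed

lemma sqnorm_le_sobolev_seminorm:
  fixes F :: "real^'n::finite \<Rightarrow> 'a::{real_normed_field, euclidean_space}"
  assumes js: "length js = m"
  shows "sqnorm (interior S) (weak_deriv (interior S) (count_list js) F) \<le> (sobolev_seminorm m S F)\<^sup>2"
proof -
  have Us: "interior S \<in> sets lebesgue" by simp
  have "sqnorm (interior S) (weak_deriv (interior S) (count_list js) F) \<le>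
      (\<Sum>\<alpha> | morder \<alpha> = m. sqnorm (interior S) (weak_deriv (interior S) \<alpha> F))"
    using js by (intro member_le_sum) (auto simp: finite_multi_index_eq morder_count_list)
  then show ?thesis by (simp add: sobolev_seminorm_def L2_norm_on_sq[OF Us] sum_nonneg)
qed

lemma sobolev_seminorm_sq_le:
  fixes F :: "real^'n::finite \<Rightarrow> 'a::{real_normed_field, euclidean_space}" and q :: real
  assumes "\<And>js. length js = m \<Longrightarrow> L2_deriv (interior S) js F (G js)" "\<And>js. length js = m \<Longrightarrow> sqnorm (interior S) (G js) \<le> q"
  shows "(sobolev_seminorm m S F)\<^sup>2 \<le> card {\<alpha>::'n multi_index. morder \<alpha> = m} * q"
proof -
  have Us: "interior S \<in> sets lebesgue" by simp
  have "sqnorm (interior S) (weak_deriv (interior S) \<alpha> F) \<le> q" if \<alpha>: "morder \<alpha> = m" for \<alpha>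
  proof -
    obtain js where "\<alpha> = count_list js" "length js = morder \<alpha>" by (rule ex_list_multi_index)
    with weak_deriv_L2_deriv(2)[OF open_interior assms(1)[of js]] assms(2)[of js] \<alpha> show ?thesis by simp
  qed
  then have "(\<Sum>\<alpha> | morder \<alpha> = m. sqnorm (interior S) (weak_deriv (interior S) \<alpha> F)) \<le> (\<Sum>\<alpha>::'n multi_index | morder \<alpha> = m. q)"
    by (intro sum_mono) simp
  then show ?thesis by (simp add: sobolev_seminorm_def L2_norm_on_sq[OF Us] sum_nonneg)
qed

section \<open>Bounds for sums and for derivatives of affine pullbacks\<close>

lemma sqnorm_sum_le:
  fixes f :: "'i \<Rightarrow> real^'n::finite \<Rightarrow> 'a::euclidean_space"
  assumes "\<And>i. i \<in> I \<Longrightarrow> in_L2 (lebesgue_on U) (f i)"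
  shows "sqnorm U (\<lambda>x. \<Sum>i\<in>I. f i x) \<le> card I * (\<Sum>i\<in>I. sqnorm U (f i))"
proof -
  have "sqnorm U (\<lambda>x. \<Sum>i\<in>I. f i x) \<le> (LINT x|lebesgue_on U. card I * (\<Sum>i\<in>I. (norm (f i x))\<^sup>2))"
  proof (rule integral_mono)
    show "integrable (lebesgue_on U) (\<lambda>x. (norm (\<Sum>i\<in>I. f i x))\<^sup>2)"
      using in_L2_sum[of I "lebesgue_on U" f, OF assms] by (simp add: in_L2_def)
    show "integrable (lebesgue_on U) (\<lambda>x. card I * (\<Sum>i\<in>I. (norm (f i x))\<^sup>2))"
      using assms by (intro integrable_mult_right Bochner_Integration.integrable_sum) (simp add: in_L2_def)
    fix x
    have "(norm (\<Sum>i\<in>I. f i x))\<^sup>2 \<le> (\<Sum>i\<in>I. norm (f i x))\<^sup>2" by (intro power_mono norm_sum) simp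
    also have "\<dots> \<le> (\<Sum>i\<in>I. (norm (f i x))\<^sup>2) * card I" by (rule sum_squared_le_sum_of_squares)
    finally show "(norm (\<Sum>i\<in>I. f i x))\<^sup>2 \<le> card I * (\<Sum>i\<in>I. (norm (f i x))\<^sup>2)" by (simp add: mult.commute)
  qed
  also have "\<dots> = card I * (\<Sum>i\<in>I. sqnorm U (f i))"
    using assms by (simp add: in_L2_def)
  finally show ?thesis .
qed

lemma sqnorm_scaleR: "sqnorm U (\<lambda>x. c *\<^sub>R f x) = c\<^sup>2 * sqnorm U f"
  by (simp add: power_mult_distrib)

lemma sqnorm_diff_le:
  fixes f g :: "real^'n::finite \<Rightarrow> 'a::euclidean_space"
  assumes f: "in_L2 (lebesgue_on U) f" and g: "in_L2 (lebesgue_on U) g"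
  shows "sqnorm U (\<lambda>x. f x - g x) \<le> 2 * (sqnorm U f + sqnorm U g)"
proof -
  \<comment> \<open>The difference is written as a sum over the two-element type of truth values,
    which yields the factor 2.\<close>
  define h where "h i = (if i then f else (\<lambda>x. (-1) *\<^sub>R g x))" for i
  have "in_L2 (lebesgue_on U) (h i)" for i using f in_L2_scaleR[OF g, of "-1"] by (simp add: h_def)
  from sqnorm_sum_le[of UNIV U h, OF this] show ?thesis by (simp add: h_def UNIV_bool)
qed

lemma abs_matrix_coeff_le:
  assumes B: "\<And>i j. \<bar>B $ i $ j\<bar> \<le> \<beta>" and len: "length is = length js"
  shows "\<bar>matrix_coeff B is js\<bar> \<le> \<beta> ^ length js"
  using len
proof (induction "is" js rule: list_induct2)
  case (Cons i "is" j js)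
  have "\<bar>B $ i $ j\<bar> * \<bar>matrix_coeff B is js\<bar> \<le> \<beta> * \<beta> ^ length js"
    using Cons.IH B[of i j] by (intro mult_mono) auto
  then show ?case by (simp add: matrix_coeff_def abs_mult)
qed (simp add: matrix_coeff_def)

text \<open>Used in both directions: with entries of order h for pulling \<open>F\<close> back, and
  of order 1/h for returning the error. The bound \<open>q\<close> is required after composition, so
  the volume factor is left to the caller. The cardinality is squared because one copy comes from
  Cauchy-Schwarz and one from the number of summands.\<close>

lemma L2_deriv_affine_bound:
  fixes F :: "real^'n::finite \<Rightarrow> 'a::euclidean_space"
  assumes A: "affine_scaling B b c" and V: "V \<in> sets lebesgue"
    and F: "\<And>is. length is = length js \<Longrightarrow> L2_deriv (affine_map B b ` V) is F (G is)"
    and B: "\<And>i j. \<bar>B $ i $ j\<bar> \<le> \<beta>"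
    and q: "\<And>is. length is = length js \<Longrightarrow> sqnorm V (\<lambda>x. G is (affine_map B b x)) \<le> q"
  obtains H where "L2_deriv V js (\<lambda>x. F (affine_map B b x)) H"
    "sqnorm V H \<le> (real (card {is::'n list. length is = length js}) * \<beta> ^ length js)\<^sup>2 * q"
proof
  let ?S = "{is::'n list. length is = length js}"
  show "L2_deriv V js (\<lambda>x. F (affine_map B b x)) (\<lambda>x. \<Sum>is\<in>?S. matrix_coeff B is js *\<^sub>R G is (affine_map B b x))"
    by (rule L2_deriv_affine[OF A V F])
  have "sqnorm V (\<lambda>x. \<Sum>is\<in>?S. matrix_coeff B is js *\<^sub>R G is (affine_map B b x)) \<le>
      card ?S * (\<Sum>is\<in>?S. sqnorm V (\<lambda>x. matrix_coeff B is js *\<^sub>R G is (affine_map B b x)))"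
    by (intro sqnorm_sum_le in_L2_scaleR in_L2_affine(1)[OF A V] L2_derivD(2)[OF F]) simp
  also have "\<dots> \<le> card ?S * (\<Sum>is\<in>?S. (\<beta> ^ length js)\<^sup>2 * q)"
  proof (intro mult_left_mono sum_mono)
    fix "is" assume "is \<in> ?S"
    then have l: "length is = length js" by simp
    have "(matrix_coeff B is js)\<^sup>2 \<le> (\<beta> ^ length js)\<^sup>2"
      using power_mono[OF abs_matrix_coeff_le[OF B l], of 2] by simp
    then show "sqnorm V (\<lambda>x. matrix_coeff B is js *\<^sub>R G is (affine_map B b x)) \<le> (\<beta> ^ length js)\<^sup>2 * q"
      unfolding sqnorm_scaleR by (intro mult_mono q l) auto
  qed simp
  also have "\<dots> = (real (card ?S) * \<beta> ^ length js)\<^sup>2 * q" by (simp add: power2_eq_square mult_ac)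
  finally show "sqnorm V (\<lambda>x. \<Sum>is\<in>?S. matrix_coeff B is js *\<^sub>R G is (affine_map B b x)) \<le>
      (real (card ?S) * \<beta> ^ length js)\<^sup>2 * q" .
qed

subsection \<open>The estimate on the reference element\<close>

lemma rectangular_elementE:
  fixes S :: "(real^'n::finite) set"
  assumes "rectangular_element S"
  obtains a b where "\<And>j. a $ j < b $ j" "box a b \<subseteq> S" "S \<subseteq> cbox a b" "interior S = box a b"
proof -
  obtain a b where ab: "\<And>j. a $ j < b $ j" "box a b \<subseteq> S" "S \<subseteq> cbox a b" using assms unfolding rectangular_element_def by blast
  have "interior S \<subseteq> box a b" using interior_mono[OF ab(3)] by (simp add: interior_cbox)
  moreover have "box a b \<subseteq> interior S" by (rule interior_maximal[OF ab(2) open_box])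
  ultimately show thesis using that[OF ab] by blast
qed

lemma ae_eq_interior: "ae_eq S F G \<Longrightarrow> AE x in lebesgue. x \<in> interior S \<longrightarrow> F x = G x"
  unfolding ae_eq_def by (elim eventually_mono) (use interior_subset in blast)

text \<open>With q = v - p, additivity and reproduction of \<open>p\<close> give v - T v = q - T q
  almost everywhere. Boundedness of \<open>T\<close> then estimates both terms by the full norm of
  q, which the polynomial was chosen to control by the seminorm of v.\<close>

lemma reference_estimate:
  fixes S :: "(real^'n::finite) set" and T :: "(real^'n \<Rightarrow> 'a::{real_normed_field, euclidean_space}) \<Rightarrow> real^'n \<Rightarrow> 'a"
  assumes S: "rectangular_element S" and m: "m \<le> k + 1"
    and T: "T \<in> sobolev_operators (k + 1) m S" and Tp: "\<forall>p\<in>poly_space k S. ae_eq S (T p) p"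
  obtains C where "0 \<le> C" "\<And>v js. v \<in> sobolev (k + 1) S \<Longrightarrow> length js \<le> m \<Longrightarrow>
     \<exists>W. L2_deriv (interior S) js (\<lambda>x. v x - T v x) W \<and> sqnorm (interior S) W \<le> C * (sobolev_seminorm (k + 1) S v)\<^sup>2"
proof -
  obtain a b where ab: "\<And>j. a $ j < b $ j" and int: "interior S = box a b" using rectangular_elementE[OF S] by metis
  let ?U = "interior S" and ?N = "real (card {is::'n list. length is = k + 1})" and ?Na = "real (card {\<alpha>::'n multi_index. morder \<alpha> \<le> k + 1})"
  have U: "?U \<in> sets lebesgue" by simp
  obtain C0 where C0: "0 \<le> C0" and BH: "\<And>v (V :: 'n list \<Rightarrow> real^'n \<Rightarrow> 'a). (\<And>js. length js \<le> k + 1 \<Longrightarrow> L2_deriv ?U js v (V js)) \<Longrightarrow>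
      \<exists>p Dp. (\<forall>S. p \<in> poly_space k S) \<and> (\<forall>js. L2_deriv ?U js p (Dp js)) \<and>
        (\<forall>js. length js \<le> k + 1 \<longrightarrow> sqnorm ?U (\<lambda>x. V js x - Dp js x) \<le> C0 * (\<Sum>is | length is = k + 1. sqnorm ?U (V is)))"
  proof (rule bramble_hilbert[OF ab, of k, where 'a = 'a], goal_cases)
    case (1 C)
    show ?case unfolding int by (rule 1(1)[unfolded int]) (fact 1)+
  qed
  from T obtain K where TS: "\<And>F. F \<in> sobolev (k + 1) S \<Longrightarrow> T F \<in> sobolev m S"
    and Tadd: "\<And>F G. F \<in> sobolev (k + 1) S \<Longrightarrow> G \<in> sobolev (k + 1) S \<Longrightarrow> ae_eq S (T (\<lambda>x. F x + G x)) (\<lambda>x. T F x + T G x)"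
    and TK: "\<And>F. F \<in> sobolev (k + 1) S \<Longrightarrow> sobolev_norm m S (T F) \<le> K * sobolev_norm (k + 1) S F"
    unfolding sobolev_operators_def by blast
  \<comment> \<open>The 2 comes from the square of a difference, \<open>?N\<close> from bounding
    each top derivative of \<open>v\<close> by the seminorm, and the factor of K^2 and
    \<open>?Na\<close> from the operator bound applied to the full norm of \<open>q\<close>.\<close>
  define C where "C = 2 * (C0 * ?N + K\<^sup>2 * (?Na * (C0 * ?N)))"
  show thesis
  proof (rule that[of C])
    show "0 \<le> C" using C0 by (simp add: C_def)
    fix v :: "real^'n \<Rightarrow> 'a" and js :: "'n list" assume v: "v \<in> sobolev (k + 1) S" and js: "length js \<le> m"
    define V where "V js = weak_deriv ?U (count_list js) v" for js
    let ?s = "(sobolev_seminorm (k + 1) S v)\<^sup>2"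
    have V: "L2_deriv ?U js v (V js)" if "length js \<le> k + 1" for js unfolding V_def by (rule sobolev_imp_L2_deriv[OF v that])
    obtain p Dp where p: "p \<in> poly_space k S" "\<And>js. L2_deriv ?U js p (Dp js)"
      and pb: "\<And>js. length js \<le> k + 1 \<Longrightarrow> sqnorm ?U (\<lambda>x. V js x - Dp js x) \<le> C0 * (\<Sum>is | length is = k + 1. sqnorm ?U (V is))"
      using BH[OF V] by blast
    have "(\<Sum>is | length is = k + 1. sqnorm ?U (V is)) \<le> (\<Sum>is::'n list | length is = k + 1. ?s)"
      unfolding V_def by (intro sum_mono sqnorm_le_sobolev_seminorm) simp
    then have "C0 * (\<Sum>is | length is = k + 1. sqnorm ?U (V is)) \<le> C0 * (?N * ?s)"
      using C0 by (intro mult_left_mono) simp_all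
    then have qb: "sqnorm ?U (\<lambda>x. V js x - Dp js x) \<le> C0 * ?N * ?s" if "length js \<le> k + 1" for js
      using pb[OF that] by (simp add: mult.assoc)
    define q where "q x = v x - p x" for x
    have q: "L2_deriv ?U js q (\<lambda>x. V js x - Dp js x)" if "length js \<le> k + 1" for js
      unfolding q_def[abs_def] by (intro L2_deriv_diff U V that p)
    have qS: "q \<in> sobolev (k + 1) S" by (rule L2_deriv_imp_sobolev[OF q])
    have pS: "p \<in> sobolev (k + 1) S" by (rule L2_deriv_imp_sobolev[OF p(2)])
    have v_eq: "v = (\<lambda>x. q x + p x)" by (simp add: q_def)
    have "AE x in lebesgue. x \<in> ?U \<longrightarrow> T v x = T q x + T p x" using ae_eq_interior[OF Tadd[OF qS pS]] v_eq by simp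
    moreover have "AE x in lebesgue. x \<in> ?U \<longrightarrow> T p x = p x" using ae_eq_interior Tp p(1) by blast
    ultimately have ae: "AE x in lebesgue. x \<in> ?U \<longrightarrow> q x - T q x = v x - T v x"
      by eventually_elim (auto simp: q_def)
    let ?TW = "weak_deriv ?U (count_list js) (T q)"
    have TW: "L2_deriv ?U js (T q) ?TW" by (rule sobolev_imp_L2_deriv[OF TS[OF qS] js])
    have jk: "length js \<le> k + 1" using js m by simp
    have "sqnorm ?U ?TW \<le> (sobolev_norm m S (T q))\<^sup>2" by (rule sqnorm_le_sobolev_norm[OF js])
    \<comment> \<open>The sign of \<open>K\<close> is not given; squaring is monotone here because
      the norm on the left is nonnegative.\<close>
    also have "\<dots> \<le> (K * sobolev_norm (k + 1) S q)\<^sup>2"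
      by (intro power_mono TK[OF qS]) (simp add: sobolev_norm_def sum_nonneg)
    also have "\<dots> = K\<^sup>2 * (sobolev_norm (k + 1) S q)\<^sup>2" by (rule power_mult_distrib)
    also have "\<dots> \<le> K\<^sup>2 * (?Na * (C0 * ?N * ?s))"
      by (intro mult_left_mono sobolev_norm_sq_le[OF q qb]) auto
    finally have Tb: "sqnorm ?U ?TW \<le> K\<^sup>2 * (?Na * (C0 * ?N * ?s))" .
    show "\<exists>W. L2_deriv ?U js (\<lambda>x. v x - T v x) W \<and> sqnorm ?U W \<le> C * ?s"
    proof (intro exI conjI)
      show "L2_deriv ?U js (\<lambda>x. v x - T v x) (\<lambda>x. (V js x - Dp js x) - ?TW x)"
        by (rule L2_deriv_AE_cong[OF U L2_deriv_diff[OF U q[OF jk] TW] ae])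
      have "sqnorm ?U (\<lambda>x. (V js x - Dp js x) - ?TW x) \<le> 2 * (sqnorm ?U (\<lambda>x. V js x - Dp js x) + sqnorm ?U ?TW)"
        by (intro sqnorm_diff_le L2_derivD(2)[OF q[OF jk]] L2_derivD(2)[OF TW])
      also have "\<dots> \<le> 2 * (C0 * ?N * ?s + K\<^sup>2 * (?Na * (C0 * ?N * ?s)))"
        by (intro mult_left_mono add_mono qb jk Tb) simp
      also have "\<dots> = C * ?s" by (simp add: C_def algebra_simps)
      finally show "sqnorm ?U (\<lambda>x. (V js x - Dp js x) - ?TW x) \<le> C * ?s" .
    qed
  qed
qed

subsection \<open>Affine equivalent elements\<close>

lemma abs_component_le_diameter:
  fixes S :: "(real^'n::finite) set"
  assumes "bounded S" "x \<in> S" "y \<in> S"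
  shows "\<bar>(y - x) $ i\<bar> \<le> diameter S"
  using component_le_norm_cart[of "y - x" i] diameter_bounded_bound[OF assms(1,3,2)] by (simp add: dist_norm)

lemma affine_map_axis: "(affine_map B b (x + s *\<^sub>R axis j 1) - affine_map B b x) $ i = s * B $ i $ j"
  by (simp add: affine_map_def matrix_vector_right_distrib)
     (simp add: matrix_vector_mult_def axis_def if_distrib sum.delta cong: if_cong)

text \<open>The columns of \<open>B\<close> and \<open>B'\<close> are increments of the two maps
  along axis directions. A quarter of a side, added to the centre of the box, stays in the box, so
  its image is an increment within \<open>S\<close> and has components of size at most h. A radius
  of a ball inscribed in \<open>S\<close> is mapped back to an increment within the box; the
  supremum over balls brings in \<open>inner_diameter\<close>, which shape regularity trades for
  h.\<close>

lemma affine_element_bounds: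
  fixes S Sh :: "(real^'n::finite) set"
  assumes ab: "\<And>j. a $ j < b $ j" and Sh: "box a b \<subseteq> Sh" "Sh \<subseteq> cbox a b"
    and S: "affine_map B b0 ` Sh = S" "S \<subseteq> unit_cell" and reg: "diameter S / inner_diameter S \<le> \<kappa>"
    and inv: "\<And>x. affine_map B' b' (affine_map B b0 x) = x" "\<And>x. affine_map B b0 (affine_map B' b' x) = x"
  shows "0 < diameter S" "diameter S \<le> diameter (cbox 0 1 :: (real^'n) set)"
    "\<bar>B $ i $ j\<bar> \<le> (\<Sum>j\<in>UNIV. 4 / (b $ j - a $ j)) * diameter S"
    "\<bar>B' $ i $ j\<bar> \<le> 2 * \<kappa> * (\<Sum>j\<in>UNIV. b $ j - a $ j) / diameter S"
proof -
  let ?A = "affine_map B b0" and ?A' = "affine_map B' b'" and ?h = "diameter S"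
  have sub: "S \<subseteq> cbox 0 1" using S(2) by (auto simp: unit_cell_def mem_box_cart less_imp_le)
  then have bdd: "bounded S" by (rule bounded_subset[OF bounded_cbox])
  show "?h \<le> diameter (cbox 0 1 :: (real^'n) set)" by (rule diameter_subset[OF sub bounded_cbox])
  define x0 where "x0 = (\<chi> j. (a $ j + b $ j) / 2)"
  have x0: "x0 \<in> box a b" using ab by (simp add: x0_def mem_box_cart)
  have "\<bar>(b $ j - a $ j) / 4 * B $ i $ j\<bar> \<le> ?h"
  proof -
    have "x0 + ((b $ j - a $ j) / 4) *\<^sub>R axis j 1 \<in> box a b"
      using ab less_imp_le[OF ab] by (auto simp: x0_def mem_box_cart axis_def field_simps)
    then have "?A (x0 + ((b $ j - a $ j) / 4) *\<^sub>R axis j 1) \<in> S" "?A x0 \<in> S" using x0 Sh(1) S(1) by blast+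
    from abs_component_le_diameter[OF bdd this(2,1), of i] show ?thesis unfolding affine_map_axis .
  qed
  then have "\<bar>B $ i $ j\<bar> \<le> 4 / (b $ j - a $ j) * ?h"
    using ab[of j] by (simp add: abs_mult field_simps)
  also have "\<dots> \<le> (\<Sum>j\<in>UNIV. 4 / (b $ j - a $ j)) * ?h"
    using ab by (intro mult_right_mono member_le_sum diameter_ge_0 bdd) (auto simp: less_imp_le)
  finally show "\<bar>B $ i $ j\<bar> \<le> (\<Sum>j\<in>UNIV. 4 / (b $ j - a $ j)) * ?h" .
  let ?R = "{(c, r). 0 < r \<and> cball c r \<subseteq> S}"
  let ?\<rho> = "inner_diameter S"
  have le_h: "(case p of (c, r) \<Rightarrow> diameter (cball c r)) \<le> ?h" if "p \<in> ?R" for p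
    using that diameter_subset[OF _ bdd] by (auto simp del: diameter_cball)
  \<comment> \<open>A ball around the image of the centre lies in \<open>S\<close>, and all
    inscribed balls have diameter at most h. The supremum is therefore genuine and positive, and the
    quotient in \<open>reg\<close> is not the default value of a division by 0.\<close>
  have "open (?A ` box a b)"
    unfolding vimage_eq_image_inverse[OF inv(2,1), symmetric] by (intro open_vimage open_box continuous_affine_map)
  moreover have "?A ` box a b \<subseteq> S" using Sh(1) S(1) by blast
  ultimately obtain r where r: "0 < r" "cball (?A x0) r \<subseteq> S"
    using x0 open_contains_cball by (meson imageI subset_trans)
  have bddR: "bdd_above ((\<lambda>p. case p of (c, r) \<Rightarrow> diameter (cball c r)) ` ?R)"
    by (rule bdd_aboveI2[OF le_h])
  have "diameter (cball (?A x0) r) \<le> ?\<rho>"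
    unfolding inner_diameter_def using cSUP_upper[OF _ bddR, of "(?A x0, r)"] r by simp
  then have \<rho>: "0 < ?\<rho>" using r(1) by (simp add: diameter_cball)
  show h: "0 < ?h" using le_h[of "(?A x0, r)"] r by (simp add: diameter_cball)
  have h\<rho>: "?h \<le> \<kappa> * ?\<rho>" using reg \<rho> by (simp add: pos_divide_le_eq)
  have \<kappa>: "0 < \<kappa>" using h h\<rho> \<rho> by (metis less_le_trans zero_less_mult_pos2)
  define L where "L = (\<Sum>j\<in>UNIV. b $ j - a $ j)"
  have L: "b $ j - a $ j \<le> L" for j
    unfolding L_def using ab by (intro member_le_sum) (auto simp: less_imp_le)
  have L0: "0 < L" using L[of i] ab[of i] by simp
  have "\<bar>B' $ i $ j\<bar> * ?\<rho> \<le> 2 * L"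
  proof (cases "B' $ i $ j = 0")
    case False
    then have nz: "0 < \<bar>B' $ i $ j\<bar>" by simp
    have "?\<rho> \<le> 2 * L / \<bar>B' $ i $ j\<bar>"
      unfolding inner_diameter_def
    proof (rule cSUP_least)
      show "?R \<noteq> {}" using r by blast
      fix p assume "p \<in> ?R"
      then obtain c s where p: "p = (c, s)" "0 < s" "cball c s \<subseteq> S" by blast
      have "c \<in> S" "c + s *\<^sub>R axis j 1 \<in> S" using p(2,3) by (auto simp: subset_iff dist_norm)
      then have "?A' c \<in> cbox a b" "?A' (c + s *\<^sub>R axis j 1) \<in> cbox a b" using S(1) Sh(2) inv(1) by force+
      then have "\<bar>(?A' (c + s *\<^sub>R axis j 1) - ?A' c) $ i\<bar> \<le> b $ i - a $ i"
        by (simp add: mem_box_cart) (smt (verit))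
      then have "s * \<bar>B' $ i $ j\<bar> \<le> L" unfolding affine_map_axis using p(2) L[of i] by (simp add: abs_mult)
      then show "(case p of (c, r) \<Rightarrow> diameter (cball c r)) \<le> 2 * L / \<bar>B' $ i $ j\<bar>"
        using p(1,2) nz by (simp add: diameter_cball field_simps)
    qed
    then show ?thesis using nz by (simp add: field_simps)
  qed (use L0 in simp)
  then have "\<bar>B' $ i $ j\<bar> * (\<kappa> * ?\<rho>) \<le> 2 * \<kappa> * L" using \<kappa> by (simp add: mult.left_commute mult.assoc)
  moreover have "\<bar>B' $ i $ j\<bar> * ?h \<le> \<bar>B' $ i $ j\<bar> * (\<kappa> * ?\<rho>)" by (intro mult_left_mono h\<rho>) simp
  ultimately show "\<bar>B' $ i $ j\<bar> \<le> 2 * \<kappa> * L / ?h" using h by (simp add: pos_le_divide_eq)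
qed

lemma interior_affine_image:
  assumes inv: "\<And>x. affine_map B' b' (affine_map B b x) = x" "\<And>x. affine_map B b (affine_map B' b' x) = x"
  shows "interior (affine_map B b ` S) = affine_map B b ` interior S"
proof
  let ?A = "affine_map B b" and ?A' = "affine_map B' b'"
  have "open (?A ` interior S)"
    unfolding vimage_eq_image_inverse[OF inv(2,1), symmetric] by (intro open_vimage open_interior continuous_affine_map)
  then show "?A ` interior S \<subseteq> interior (?A ` S)" by (intro interior_maximal image_mono interior_subset)
  have "open (?A' ` interior (?A ` S))"
    unfolding vimage_eq_image_inverse[OF inv, symmetric] by (intro open_vimage open_interior continuous_affine_map)
  moreover have "?A' ` interior (?A ` S) \<subseteq> S"
    using image_mono[OF interior_subset[of "?A ` S"], of ?A'] by (simp add: image_image inv)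
  ultimately have "?A' ` interior (?A ` S) \<subseteq> interior S" by (intro interior_maximal)
  from image_mono[OF this, of ?A] show "interior (?A ` S) \<subseteq> ?A ` interior S" by (simp add: image_image inv)
qed

text \<open>The exceptional set is carried along by a differentiable map and remains null.\<close>

lemma AE_affine_image:
  fixes B :: "real^'n::finite^'n"
  assumes ae: "AE x in lebesgue. Q x" and inv: "\<And>x. affine_map B b (affine_map B' b' x) = x"
  shows "AE y in lebesgue. Q (affine_map B' b' y)"
proof -
  obtain N where N: "\<And>x. x \<in> space lebesgue - N \<Longrightarrow> Q x" "N \<in> null_sets lebesgue" using AE_E3[OF ae] by blast
  have "negligible (affine_map B b ` N)"
    using N(2) by (intro negligible_differentiable_image_negligible affine_map_differentiable_on) (auto simp: negligible_iff_null_sets)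
  then have "AE y in lebesgue. y \<notin> affine_map B b ` N" by (intro AE_not_in) (simp add: negligible_iff_null_sets)
  then show ?thesis
  proof eventually_elim
    fix y assume "y \<notin> affine_map B b ` N"
    then have "affine_map B' b' y \<notin> N" using inv by (metis imageI)
    then show "Q (affine_map B' b' y)" using N(1) by simp
  qed
qed

theorem theorem4p4:
  fixes k m :: nat
    and \<kappa> :: real
    and \<Theta>h :: "(real^'n::finite) set"
    and t :: "'n \<Rightarrow> nat \<Rightarrow> real"
    and Ph :: "(real^'n \<Rightarrow> 'a::{real_normed_field, euclidean_space}) \<Rightarrow> real^'n \<Rightarrow> 'a"
  assumes "1 \<le> k"
    and "m \<le> k + 1"
    and "rectangular_element \<Theta>h"
    and "lagrange_grid k \<Theta>h t"
    and "Ph = lagrange_interpolation k \<Theta>h t"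
    and "Ph \<in> sobolev_operators (k + 1) m \<Theta>h"
    and "\<forall>p\<in>poly_space k \<Theta>h. ae_eq \<Theta>h (Ph p) p"
    and "0 < \<kappa>"
  shows "\<exists>C::real. \<forall>\<Theta> B b P.
    affine_equivalent_via B b \<Theta>h \<Theta> \<and> \<Theta> \<subseteq> unit_cell \<and>
    diameter \<Theta> / inner_diameter \<Theta> \<le> \<kappa> \<and>
    (\<forall>F\<in>sobolev (k + 1) \<Theta>. ae_eq \<Theta>h (P F \<circ> affine_map B b) (Ph (F \<circ> affine_map B b)))
    \<longrightarrow> (\<forall>F\<in>sobolev (k + 1) \<Theta>.
          (\<lambda>x. F x - P F x) \<in> sobolev m \<Theta> \<and>
          sobolev_norm m \<Theta> (\<lambda>x. F x - P F x)
            \<le> C * diameter \<Theta> ^ (k + 1 - m) * sobolev_seminorm (k + 1) \<Theta> F)"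
proof -
  obtain a b where ab: "\<And>j. a $ j < b $ j" "box a b \<subseteq> \<Theta>h" "\<Theta>h \<subseteq> cbox a b"
    using rectangular_elementE[OF assms(3)] by metis
  let ?U = "interior \<Theta>h"
  have U: "?U \<in> sets lebesgue" by simp
  obtain C1 where C1: "0 \<le> C1" and ref: "\<And>v js. v \<in> sobolev (k + 1) \<Theta>h \<Longrightarrow> length js \<le> m \<Longrightarrow>
     \<exists>W. L2_deriv ?U js (\<lambda>x. v x - Ph v x) W \<and> sqnorm ?U W \<le> C1 * (sobolev_seminorm (k + 1) \<Theta>h v)\<^sup>2"
  proof (rule reference_estimate[OF assms(3,2,6,7)], goal_cases)
    case (1 C)
    show ?case by (rule 1(1)) (fact 1)+
  qed
  define L1 where "L1 = (\<Sum>j\<in>UNIV. 4 / (b $ j - a $ j))"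
  define L2 where "L2 = 2 * \<kappa> * (\<Sum>j\<in>UNIV. b $ j - a $ j)"
  define H where "H = diameter (cbox 0 1 :: (real^'n) set)"
  \<comment> \<open>\<open>L2 / h\<close> bounds the inverse matrix, and \<open>H\<close> bounds the
    diameter of every element in the unit cell. With their sum in the numerator,
    \<open>G / h\<close> is also at least 1, so its lower powers are dominated by the m-th.\<close>
  define G where "G = L2 + H"
  have L1: "0 \<le> L1" unfolding L1_def using ab(1) by (intro sum_nonneg) (simp add: less_imp_le)
  have L2: "0 \<le> L2" unfolding L2_def using assms(8) ab(1) by (intro mult_nonneg_nonneg sum_nonneg) (auto simp: less_imp_le)
  let ?N = "real (card {is::'n list. length is = k + 1})" and ?Nm = "real (card {is::'n list. set is \<subseteq> UNIV \<and> length is \<le> m})"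
  let ?Na = "real (card {\<alpha>::'n multi_index. morder \<alpha> = k + 1})" and ?Nam = "real (card {\<alpha>::'n multi_index. morder \<alpha> \<le> m})"
  \<comment> \<open>\<open>L1 ^ (k + 1)\<close> comes from pulling \<open>F\<close> back,
    \<open>C1\<close> from the reference estimate, \<open>G ^ m\<close> from returning the error;
    the cardinalities count words and multi-indices. Nothing here involves \<open>\<Theta>\<close>,
    the affine map or \<open>F\<close>.\<close>
  define C where "C = sqrt (?Nam * C1 * ?Na) * (?Nm * ?N * G ^ m * L1 ^ (k + 1))"
  have main: "(\<lambda>x. F x - P F x) \<in> sobolev m \<Theta> \<and>
      sobolev_norm m \<Theta> (\<lambda>x. F x - P F x) \<le> C * diameter \<Theta> ^ (k + 1 - m) * sobolev_seminorm (k + 1) \<Theta> F"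
    if eq: "affine_equivalent_via B b0 \<Theta>h \<Theta>" and cell: "\<Theta> \<subseteq> unit_cell" and reg: "diameter \<Theta> / inner_diameter \<Theta> \<le> \<kappa>"
      and PF: "\<forall>F\<in>sobolev (k + 1) \<Theta>. ae_eq \<Theta>h (P F \<circ> affine_map B b0) (Ph (F \<circ> affine_map B b0))"
      and F: "F \<in> sobolev (k + 1) \<Theta>" for \<Theta> B b0 P and F :: "real^'n \<Rightarrow> 'a"
  proof -
    let ?A = "affine_map B b0" and ?V = "interior \<Theta>" and ?h = "diameter \<Theta>"
    have V: "?V \<in> sets lebesgue" by simp
    have B: "invertible B" and \<Theta>: "?A ` \<Theta>h = \<Theta>" using eq by (auto simp: affine_equivalent_via_def)
    obtain B' b' where B': "invertible B'" and inv: "\<And>x. affine_map B' b' (?A x) = x" "\<And>x. ?A (affine_map B' b' x) = x"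
      using affine_map_inverse[OF B] by metis
    let ?A' = "affine_map B' b'"
    have VU: "?V = ?A ` ?U" unfolding \<Theta>[symmetric] by (rule interior_affine_image[OF inv])
    have UV: "?A' ` ?V = ?U" by (simp add: VU image_image inv)
    obtain c where c: "affine_scaling B b0 c" using ex_affine_scaling[OF B] by blast
    obtain c' where c': "affine_scaling B' b' c'" using ex_affine_scaling[OF B'] by blast
    have c0: "0 < c" using c by (simp add: affine_scaling_def)
    note bounds = affine_element_bounds[OF ab \<Theta> cell reg inv]
    have h: "0 < ?h" by (rule bounds(1))
    have hG: "?h \<le> G" using bounds(2) L2 by (simp add: G_def H_def)
    have \<beta>: "\<bar>B $ i $ j\<bar> \<le> L1 * ?h" for i j unfolding L1_def by (rule bounds(3))
    have "\<bar>B' $ i $ j\<bar> \<le> L2 / ?h" for i j unfolding L2_def by (rule bounds(4))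
    moreover have "L2 / ?h \<le> G / ?h" using h hG bounds(2) by (intro divide_right_mono) (auto simp: G_def H_def)
    ultimately have \<beta>': "\<bar>B' $ i $ j\<bar> \<le> G / ?h" for i j by (rule order_trans)
    have \<beta>1: "1 \<le> G / ?h" using h hG by simp
    let ?s = "(sobolev_seminorm (k + 1) \<Theta> F)\<^sup>2"
    define v where "v = F \<circ> ?A"
    have FG: "L2_deriv (?A ` ?U) js F (weak_deriv ?V (count_list js) F)" if "length js \<le> k + 1" for js
      using sobolev_imp_L2_deriv[OF F that] by (simp add: VU)
    have "L2_deriv ?U js v (\<lambda>x. \<Sum>is | length is = length js. matrix_coeff B is js *\<^sub>R weak_deriv ?V (count_list is) F (?A x))"
      if "length js \<le> k + 1" for js
      unfolding v_def o_def using that by (intro L2_deriv_affine[OF c U] FG) simp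
    then have v: "v \<in> sobolev (k + 1) \<Theta>h" by (rule L2_deriv_imp_sobolev)
    \<comment> \<open>Each of the \<open>k + 1\<close> derivatives brings one matrix entry of size
      at most \<open>L1 * ?h\<close>, and the change of variables one factor
      \<open>c\<close>.\<close>
    have "(sobolev_seminorm (k + 1) \<Theta>h v)\<^sup>2 \<le> ?Na * ((?N * (L1 * ?h) ^ (k + 1))\<^sup>2 * (c * ?s))"
    proof (rule sobolev_seminorm_sq_le)
      fix js :: "'n list" assume js: "length js = k + 1"
      show "L2_deriv ?U js v (weak_deriv ?U (count_list js) v)" using js by (intro sobolev_imp_L2_deriv[OF v]) simp
      obtain H where H: "L2_deriv ?U js (\<lambda>x. F (?A x)) H" "sqnorm ?U H \<le> (real (card {is::'n list. length is = length js}) * (L1 * ?h) ^ length js)\<^sup>2 * (c * ?s)"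
      proof (rule L2_deriv_affine_bound[OF c U, of js F "\<lambda>is. weak_deriv ?V (count_list is) F" "L1 * ?h" "c * ?s"])
        fix "is" :: "'n list" assume l: "length is = length js"
        show "L2_deriv (?A ` ?U) is F (weak_deriv ?V (count_list is) F)" using l js by (intro FG) simp
        then have "sqnorm ?U (\<lambda>x. weak_deriv ?V (count_list is) F (?A x)) = c * sqnorm ?V (weak_deriv ?V (count_list is) F)"
          by (simp only: in_L2_affine(2)[OF c U L2_derivD(2)] VU)
        also have "\<dots> \<le> c * ?s" using c0 l js by (intro mult_left_mono sqnorm_le_sobolev_seminorm) auto
        finally show "sqnorm ?U (\<lambda>x. weak_deriv ?V (count_list is) F (?A x)) \<le> c * ?s" .
      qed (rule \<beta>)
      have "L2_deriv ?U js v H" using H(1) by (simp add: v_def o_def)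
      from weak_deriv_L2_deriv(2)[OF open_interior this] H(2)
      show "sqnorm ?U (weak_deriv ?U (count_list js) v) \<le> (?N * (L1 * ?h) ^ (k + 1))\<^sup>2 * (c * ?s)" by (simp only: js)
    qed
    note semi_v = this
    define w where "w x = v x - Ph v x" for x
    have W: "L2_deriv ?U js w (weak_deriv ?U (count_list js) w)" "sqnorm ?U (weak_deriv ?U (count_list js) w) \<le> C1 * (sobolev_seminorm (k + 1) \<Theta>h v)\<^sup>2"
      if js: "length js \<le> m" for js
    proof -
      obtain W where "L2_deriv ?U js w W" "sqnorm ?U W \<le> C1 * (sobolev_seminorm (k + 1) \<Theta>h v)\<^sup>2"
        using ref[OF v js] unfolding w_def[abs_def] by blast
      with weak_deriv_L2_deriv[OF open_interior this(1)] show "L2_deriv ?U js w (weak_deriv ?U (count_list js) w)"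
        "sqnorm ?U (weak_deriv ?U (count_list js) w) \<le> C1 * (sobolev_seminorm (k + 1) \<Theta>h v)\<^sup>2" by simp_all
    qed
    \<comment> \<open>Returning to the element divides squared norms by \<open>c\<close>, the
      scaling of the forward map applied to the transported function. This cancels the factor
      \<open>c\<close> in \<open>semi_v\<close>.\<close>
    define q where "q = C1 * (sobolev_seminorm (k + 1) \<Theta>h v)\<^sup>2 / c"
    have q0: "0 \<le> q" using C1 c0 by (simp add: q_def)
    define D where "D x = F x - P F x" for x
    \<comment> \<open>\<open>P\<close> is specified only through its pullback and almost everywhere
      on the reference element; the identity is carried over to the element, where null sets
      correspond.\<close>
    have "AE x in lebesgue. x \<in> \<Theta>h \<longrightarrow> P F (?A x) = Ph v x"
      using bspec[OF PF F] by (simp add: ae_eq_def v_def)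
    from AE_affine_image[OF this inv(2)]
    have ae: "AE y in lebesgue. y \<in> ?V \<longrightarrow> w (?A' y) = D y"
    proof eventually_elim
      fix y assume y: "?A' y \<in> \<Theta>h \<longrightarrow> P F (?A (?A' y)) = Ph v (?A' y)"
      show "y \<in> ?V \<longrightarrow> w (?A' y) = D y"
      proof
        assume "y \<in> ?V"
        then have "?A' y \<in> \<Theta>h" using UV interior_subset by blast
        then show "w (?A' y) = D y" using y by (simp add: w_def v_def D_def inv)
      qed
    qed
    \<comment> \<open>For words shorter than \<open>m\<close> the powers of \<open>G / ?h\<close>
      are lower and are raised to the m-th by \<open>\<beta>1\<close>; \<open>?Nm\<close> bounds the
      number of words of any single length up to \<open>m\<close>.\<close>
    have ex: "\<exists>H. L2_deriv ?V js D H \<and> sqnorm ?V H \<le> (?Nm * (G / ?h) ^ m)\<^sup>2 * q" if js: "length js \<le> m" for js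
    proof -
      obtain H where H: "L2_deriv ?V js (\<lambda>x. w (?A' x)) H" "sqnorm ?V H \<le> (real (card {is::'n list. length is = length js}) * (G / ?h) ^ length js)\<^sup>2 * q"
      proof (rule L2_deriv_affine_bound[OF c' V, of js w "\<lambda>is. weak_deriv ?U (count_list is) w" "G / ?h" q])
        fix "is" :: "'n list" assume "length is = length js"
        then have l: "length is \<le> m" using js by simp
        let ?W = "weak_deriv ?U (count_list is) w"
        show wdW: "L2_deriv (?A' ` ?V) is w ?W" unfolding UV by (rule W(1)[OF l])
        have "in_L2 (lebesgue_on ?V) (\<lambda>x. ?W (?A' x))" by (rule in_L2_affine(1)[OF c' V L2_derivD(2)[OF wdW]])
        then have "sqnorm ?U ?W = c * sqnorm ?V (\<lambda>x. ?W (?A' x))"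
          using in_L2_affine(2)[OF c U, of "\<lambda>x. ?W (?A' x)"] by (simp add: VU inv)
        then show "sqnorm ?V (\<lambda>x. ?W (?A' x)) \<le> q" using W(2)[OF l] c0 by (simp add: q_def field_simps)
      qed (rule \<beta>')
      have "card {is::'n list. length is = length js} \<le> card {is::'n list. set is \<subseteq> UNIV \<and> length is \<le> m}"
        using js by (intro card_mono finite_lists_length_le finite) auto
      then have "(real (card {is::'n list. length is = length js}) * (G / ?h) ^ length js)\<^sup>2 * q \<le> (?Nm * (G / ?h) ^ m)\<^sup>2 * q"
        using \<beta>1 js by (intro mult_right_mono power_mono mult_mono power_increasing q0) auto
      with H(2) L2_deriv_AE_cong[OF V H(1) ae] show ?thesis by (meson order_trans)
    qed
    have L2_derivD': "L2_deriv ?V js D (weak_deriv ?V (count_list js) D)" "sqnorm ?V (weak_deriv ?V (count_list js) D) \<le> (?Nm * (G / ?h) ^ m)\<^sup>2 * q"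
      if js: "length js \<le> m" for js
    proof -
      obtain H where H: "L2_deriv ?V js D H" "sqnorm ?V H \<le> (?Nm * (G / ?h) ^ m)\<^sup>2 * q" using ex[OF js] by blast
      with weak_deriv_L2_deriv[OF open_interior H(1)] show "L2_deriv ?V js D (weak_deriv ?V (count_list js) D)"
        "sqnorm ?V (weak_deriv ?V (count_list js) D) \<le> (?Nm * (G / ?h) ^ m)\<^sup>2 * q" by simp_all
    qed
    have "q \<le> C1 * (?Na * ((?N * (L1 * ?h) ^ (k + 1))\<^sup>2 * (c * ?s))) / c"
      unfolding q_def using C1 c0 by (intro divide_right_mono mult_left_mono semi_v) auto
    also have "\<dots> = C1 * ?Na * (?N * (L1 * ?h) ^ (k + 1))\<^sup>2 * ?s" using c0 by simp
    finally have qle: "q \<le> C1 * ?Na * (?N * (L1 * ?h) ^ (k + 1))\<^sup>2 * ?s" .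
    have "(sobolev_norm m \<Theta> D)\<^sup>2 \<le> ?Nam * ((?Nm * (G / ?h) ^ m)\<^sup>2 * q)"
      by (rule sobolev_norm_sq_le[OF L2_derivD'])
    also have "\<dots> \<le> ?Nam * ((?Nm * (G / ?h) ^ m)\<^sup>2 * (C1 * ?Na * (?N * (L1 * ?h) ^ (k + 1))\<^sup>2 * ?s))"
      by (intro mult_left_mono qle) auto
    also have "\<dots> = (?Nam * C1 * ?Na) * (?Nm * ?N * G ^ m * L1 ^ (k + 1) * (?h ^ (k + 1) / ?h ^ m))\<^sup>2 * ?s"
      by (simp only: power_mult_distrib power_divide times_divide_eq_right times_divide_eq_left mult_ac)
    \<comment> \<open>Subtraction on the naturals is exact here because
      \<open>m \<le> k + 1\<close>.\<close>
    also have "?h ^ (k + 1) / ?h ^ m = ?h ^ (k + 1 - m)" using h assms(2) by (simp add: power_diff)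
    also have "?Nam * C1 * ?Na = (sqrt (?Nam * C1 * ?Na))\<^sup>2" using C1 by simp
    also have "\<dots> * (?Nm * ?N * G ^ m * L1 ^ (k + 1) * ?h ^ (k + 1 - m))\<^sup>2 * ?s = (C * ?h ^ (k + 1 - m) * sobolev_seminorm (k + 1) \<Theta> F)\<^sup>2"
      by (simp only: C_def power_mult_distrib mult_ac)
    finally have "(sobolev_norm m \<Theta> D)\<^sup>2 \<le> (C * ?h ^ (k + 1 - m) * sobolev_seminorm (k + 1) \<Theta> F)\<^sup>2" .
    moreover have "0 \<le> C * ?h ^ (k + 1 - m) * sobolev_seminorm (k + 1) \<Theta> F"
      using C1 L1 h hG by (intro mult_nonneg_nonneg) (auto simp: C_def sobolev_seminorm_def sum_nonneg intro!: mult_nonneg_nonneg)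
    ultimately have "sobolev_norm m \<Theta> D \<le> C * ?h ^ (k + 1 - m) * sobolev_seminorm (k + 1) \<Theta> F" by (rule power2_le_imp_le)
    moreover have "D \<in> sobolev m \<Theta>" by (rule L2_deriv_imp_sobolev[OF L2_derivD'(1)])
    ultimately show ?thesis by (simp add: D_def[abs_def])
  qed
  show ?thesis by (intro exI[of _ C] allI impI ballI) (use main in blast)
qed

end
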